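(* Let $G$ and $H$ be infinite finitely generated groups. If $H$ has linear growth (or equivalently, $H$ has a subgroup of finite index isomorphic to $\mathbb{Z}$) then $\beta^*(G\wr H)\ge \frac{1+\beta^*(G)}{2}$. For all other infinite finitely generated groups $H$ we have $\beta^*(G\wr H)=1$.
   Context: $\beta^*(G)$ is the supremum of all $\beta\ge 0$ for which there exist a finite symmetric generating set $S$ of $G$ and $c>0$ such that $\mathbb{E}[d_G(W_t,e)]\ge c\,t^\beta$ for all $t\in\mathbb{N}$, where $\{W_t\}_{t\ge0}$ is the simple random walk on the Cayley graph of $G$ determined by $S$ started at the identity $e$ (so $W_t$ is distributed as $\sigma_1\cdots\sigma_t$ with $\sigma_i$ i.i.d. uniform on $S$), and $d_G$ is the left-invariant word metric of $S$. The wreath product $G\wr H$ is the group of all pairs $(f,x)$ with $f:H\to G$ finitely supported (i.e. $f(z)=e_G$ for all but finitely many $z$) and $x\in H$, with product $(f,x)(g,y)=(z\mapsto f(z)g(x^{-1}z),\,xy)$. $H$ has linear growth if the cardinality of its balls of radius $r\ge1$ is bounded above and below by positive constant multiples of $r$. *)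

theory Defs
  imports "HOL-Algebra.Algebra" "HOL-Probability.Probability"
begin

text \<open>The subset \<open>S\<close> is required to be nonempty so that the uniform distribution on \<open>S\<close> makes
  sense; this only matters for the trivial group. It may contain the identity.\<close>

definition sym_gen_set :: "('a, 'm) monoid_scheme \<Rightarrow> 'a set \<Rightarrow> bool" where
  "sym_gen_set G S \<longleftrightarrow>
     finite S \<and> S \<noteq> {} \<and> S \<subseteq> carrier G \<and> (\<forall>s\<in>S. inv\<^bsub>G\<^esub> s \<in> S) \<and> generate G S = carrier G"

definition finitely_generated :: "('a, 'm) monoid_scheme \<Rightarrow> bool" where
  "finitely_generated G \<longleftrightarrow> (\<exists>S. finite S \<and> S \<subseteq> carrier G \<and> generate G S = carrier G)"

definition word_prod :: "('a, 'm) monoid_scheme \<Rightarrow> 'a list \<Rightarrow> 'a" where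
  "word_prod G w = foldr (\<otimes>\<^bsub>G\<^esub>) w \<one>\<^bsub>G\<^esub>"

text \<open>Only used for symmetric \<open>S\<close>, so inverses of letters need not be allowed separately.\<close>

definition word_dist :: "('a, 'm) monoid_scheme \<Rightarrow> 'a set \<Rightarrow> 'a \<Rightarrow> 'a \<Rightarrow> nat" where
  "word_dist G S x y =
     (LEAST n. \<exists>w. set w \<subseteq> S \<and> length w = n \<and> word_prod G w = inv\<^bsub>G\<^esub> x \<otimes>\<^bsub>G\<^esub> y)"

definition word_ball :: "('a, 'm) monoid_scheme \<Rightarrow> 'a set \<Rightarrow> nat \<Rightarrow> 'a set" where
  "word_ball G S r = {x \<in> carrier G. word_dist G S x \<one>\<^bsub>G\<^esub> \<le> r}"

text \<open>The law of \<open>W\<^sub>t = \<sigma>\<^sub>1 \<cdots> \<sigma>\<^sub>t\<close>, where the \<open>\<sigma>\<^sub>i\<close> are independent and uniform on \<open>S\<close>.\<close>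

definition walk :: "('a, 'm) monoid_scheme \<Rightarrow> 'a set \<Rightarrow> nat \<Rightarrow> 'a pmf" where
  "walk G S t = map_pmf (word_prod G) (replicate_pmf t (pmf_of_set S))"

text \<open>The inequality is trivial at \<open>t = 0\<close>, because \<open>0 powr \<beta> = 0\<close> even for \<open>\<beta> = 0\<close>; thus \<open>t\<close>
  effectively ranges over the positive integers.\<close>

definition speed_exponent :: "('a, 'm) monoid_scheme \<Rightarrow> real \<Rightarrow> bool" where
  "speed_exponent G \<beta> \<longleftrightarrow>
     \<beta> \<ge> 0 \<and>
     (\<exists>S c. sym_gen_set G S \<and> c > 0 \<and>
        (\<forall>t::nat. measure_pmf.expectation (walk G S t) (\<lambda>x. real (word_dist G S x \<one>\<^bsub>G\<^esub>))
                   \<ge> c * real t powr \<beta>))"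

text \<open>For a finitely generated group with more than one element the supremum is that of a nonempty
  set (\<open>\<beta> = 0\<close> qualifies) bounded by \<open>1\<close> (as the walk moves by at most one letter per step), so it
  is a genuine real supremum.\<close>

definition beta_star :: "('a, 'm) monoid_scheme \<Rightarrow> real" where
  "beta_star G = Sup {\<beta>. speed_exponent G \<beta>}"

text \<open>The choice of the generating set affects only the constants.\<close>

definition linear_growth :: "('a, 'm) monoid_scheme \<Rightarrow> bool" where
  "linear_growth H \<longleftrightarrow>
     (\<exists>S. sym_gen_set H S \<and>
        (\<exists>c C::real. c > 0 \<and> C > 0 \<and>
           (\<forall>r\<ge>1. c * real r \<le> real (card (word_ball H S r)) \<and>
                   real (card (word_ball H S r)) \<le> C * real r)))"

definition virtually_Z :: "('a, 'm) monoid_scheme \<Rightarrow> bool" where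
  "virtually_Z H \<longleftrightarrow>
     (\<exists>K. subgroup K H \<and> finite (rcosets\<^bsub>H\<^esub> K) \<and> H\<lparr>carrier := K\<rparr> \<cong> integer_group)"

text \<open>Functions on \<open>carrier H\<close> are represented by their extensional representatives
  (with value \<open>undefined\<close> outside \<open>carrier H\<close>), so that equality of elements is equality of
  functions on \<open>carrier H\<close>.\<close>

definition wreath ::
  "('a, 'm) monoid_scheme \<Rightarrow> ('b, 'n) monoid_scheme \<Rightarrow> (('b \<Rightarrow> 'a) \<times> 'b) monoid" where
  "wreath G H =
    \<lparr>carrier = {f \<in> carrier H \<rightarrow>\<^sub>E carrier G. finite {z \<in> carrier H. f z \<noteq> \<one>\<^bsub>G\<^esub>}} \<times> carrier H,
     monoid.mult = (\<lambda>(f, x) (g, y).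
        ((\<lambda>z\<in>carrier H. f z \<otimes>\<^bsub>G\<^esub> g (inv\<^bsub>H\<^esub> x \<otimes>\<^bsub>H\<^esub> z)), x \<otimes>\<^bsub>H\<^esub> y)),
     one = ((\<lambda>z\<in>carrier H. \<one>\<^bsub>G\<^esub>), \<one>\<^bsub>H\<^esub>)\<rparr>"

lemma wreath_group:
  fixes G :: "('a, 'm) monoid_scheme" and H :: "('b, 'n) monoid_scheme"
  assumes "group G" and "group H"
  shows "group (wreath G H)"
proof -
  interpret G: group G by fact
  interpret H: group H by fact
  have shift: "finite {z \<in> carrier H. g (h \<otimes>\<^bsub>H\<^esub> z) \<noteq> \<one>\<^bsub>G\<^esub>}"
    if "finite {z \<in> carrier H. g z \<noteq> \<one>\<^bsub>G\<^esub>}" "h \<in> carrier H" for g h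
  proof (rule finite_subset)
    show "{z \<in> carrier H. g (h \<otimes>\<^bsub>H\<^esub> z) \<noteq> \<one>\<^bsub>G\<^esub>}
            \<subseteq> (\<lambda>z. inv\<^bsub>H\<^esub> h \<otimes>\<^bsub>H\<^esub> z) ` {z \<in> carrier H. g z \<noteq> \<one>\<^bsub>G\<^esub>}"
    proof
      fix z assume z: "z \<in> {z \<in> carrier H. g (h \<otimes>\<^bsub>H\<^esub> z) \<noteq> \<one>\<^bsub>G\<^esub>}"
      then have "z = inv\<^bsub>H\<^esub> h \<otimes>\<^bsub>H\<^esub> (h \<otimes>\<^bsub>H\<^esub> z)"
        using that(2) by (simp add: H.m_assoc [symmetric])
      with z that(2) show "z \<in> (\<lambda>z. inv\<^bsub>H\<^esub> h \<otimes>\<^bsub>H\<^esub> z) ` {z \<in> carrier H. g z \<noteq> \<one>\<^bsub>G\<^esub>}"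
        by blast
    qed
  qed (use that in simp)
  have closed: "finite {z \<in> carrier H. f z \<otimes>\<^bsub>G\<^esub> g (inv\<^bsub>H\<^esub> x \<otimes>\<^bsub>H\<^esub> z) \<noteq> \<one>\<^bsub>G\<^esub>}"
    if "finite {z \<in> carrier H. f z \<noteq> \<one>\<^bsub>G\<^esub>}" "finite {z \<in> carrier H. g z \<noteq> \<one>\<^bsub>G\<^esub>}"
      "x \<in> carrier H" for f g x
    by (rule finite_subset [of _ "{z \<in> carrier H. f z \<noteq> \<one>\<^bsub>G\<^esub>}
             \<union> {z \<in> carrier H. g (inv\<^bsub>H\<^esub> x \<otimes>\<^bsub>H\<^esub> z) \<noteq> \<one>\<^bsub>G\<^esub>}"])
       (use that shift [of g "inv\<^bsub>H\<^esub> x"] in auto)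
  show ?thesis
  proof (rule groupI)
    fix p q assume "p \<in> carrier (wreath G H)" "q \<in> carrier (wreath G H)"
    then show "p \<otimes>\<^bsub>wreath G H\<^esub> q \<in> carrier (wreath G H)"
      using closed by (auto simp: wreath_def PiE_iff cong: conj_cong)
  next
    show "\<one>\<^bsub>wreath G H\<^esub> \<in> carrier (wreath G H)"
      by (auto simp: wreath_def cong: conj_cong)
  next
    fix p q r
    assume "p \<in> carrier (wreath G H)" "q \<in> carrier (wreath G H)" "r \<in> carrier (wreath G H)"
    then show "p \<otimes>\<^bsub>wreath G H\<^esub> q \<otimes>\<^bsub>wreath G H\<^esub> r
                 = p \<otimes>\<^bsub>wreath G H\<^esub> (q \<otimes>\<^bsub>wreath G H\<^esub> r)"
      by (auto simp: wreath_def PiE_iff G.m_assoc H.m_assoc H.inv_mult_group intro!: restrict_ext)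
  next
    fix p assume "p \<in> carrier (wreath G H)"
    then show "\<one>\<^bsub>wreath G H\<^esub> \<otimes>\<^bsub>wreath G H\<^esub> p = p"
      by (auto simp: wreath_def PiE_iff extensional_def restrict_def fun_eq_iff)
  next
    fix p assume p: "p \<in> carrier (wreath G H)"
    obtain f x where fx: "p = (f, x)" by force
    have f: "f \<in> carrier H \<rightarrow>\<^sub>E carrier G" "finite {z \<in> carrier H. f z \<noteq> \<one>\<^bsub>G\<^esub>}" "x \<in> carrier H"
      using p by (auto simp: fx wreath_def)
    define q where "q = ((\<lambda>z\<in>carrier H. inv\<^bsub>G\<^esub> f (x \<otimes>\<^bsub>H\<^esub> z)), inv\<^bsub>H\<^esub> x)"
    have "finite {z \<in> carrier H. inv\<^bsub>G\<^esub> f (x \<otimes>\<^bsub>H\<^esub> z) \<noteq> \<one>\<^bsub>G\<^esub>}"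
      by (rule finite_subset [OF _ shift [OF f(2,3)]]) auto
    then have "q \<in> carrier (wreath G H)"
      using f by (auto simp: q_def wreath_def PiE_iff cong: conj_cong)
    moreover have "q \<otimes>\<^bsub>wreath G H\<^esub> p = \<one>\<^bsub>wreath G H\<^esub>"
      using f by (auto simp: q_def fx wreath_def PiE_iff intro!: restrict_ext)
    ultimately show "\<exists>q\<in>carrier (wreath G H). q \<otimes>\<^bsub>wreath G H\<^esub> p = \<one>\<^bsub>wreath G H\<^esub>"
      by blast
  qed
qed

end

theory Submission
  imports Defs
begin

text \<open>
  Everything rests on one estimate for a walk on \<open>G \<wr> H\<close>. Let \<open>q\<^sub>n\<close> be the probability that two
  independent walks on \<open>H\<close> are at the same place at time \<open>n\<close>, and put
  \<open>K\<^sub>t = 1 + 4 \<Sum>\<^bsub>j<t\<^esub> q\<^bsub>\<lfloor>j/2\<rfloor>\<^esub>\<close>; up to constants, \<open>K\<^sub>t\<close> bounds the expected number of visits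
  to any one point of \<open>H\<close> before time \<open>t\<close>. If \<open>\<beta>\<close> is a speed exponent of \<open>G\<close>, then there are generators
  of \<open>G \<wr> H\<close> and \<open>c > 0\<close> with
  \<open>E d(W\<^sub>t) \<ge> c t K\<^sub>t\<^bsup>\<beta>-1\<^esup>\<close> (\<open>speed_ge\<close>). The generators are chosen so that one step switches
  the lamp at the current position, moves, and switches the lamp at the new position. Conditionally on the
  path in \<open>H\<close>, the lamp at \<open>z\<close> is then a walk on \<open>G\<close> run for as many steps as there are departures from
  and arrivals at \<open>z\<close> (\<open>law_of_lamp\<close>). If \<open>n\<^sub>z\<close> is this number, the distance is at least half the sum of
  the distances of the lamps, so its expectation is at least of order \<open>\<Sum>\<^sub>z E n\<^sub>z\<^bsup>\<beta>\<^esup>\<close>. The \<open>n\<^sub>z\<close> sum to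
  \<open>2t\<close>, and by the Markov property \<open>E n\<^sub>z\<^sup>2 \<le> K\<^sub>t E n\<^sub>z\<close>: visits cannot concentrate on fewer than about
  \<open>t / K\<^sub>t\<close> points, and by concavity of the power \<open>\<beta>\<close> this is what the estimate needs.

  It remains to bound \<open>K\<^sub>t\<close>. If \<open>B\<^sub>k\<close> is the set of products of \<open>2k\<close> generators of \<open>H\<close>, then comparing
  the law of the walk with its translates by the elements of \<open>B\<^sub>k\<close> gives
  \<open>q\<^sub>n \<le> 1 / |B\<^sub>k| + k\<^sup>2 |S|\<^sup>2 (q\<^sub>n - q\<^bsub>n+1\<^esub>)\<close> (\<open>collision_prob_le_ball\<close>). In an infinite group
  \<open>|B\<^sub>k| \<ge> k\<close>; optimizing over \<open>k\<close> this yields \<open>q\<^sub>n = O(n\<^bsup>-1/2\<^esup>)\<close> and \<open>K\<^sub>t = O(\<surd>t)\<close>, which is the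
  exponent \<open>(1 + \<beta>) / 2\<close>. If \<open>|B\<^sub>k| \<ge> k\<^sup>2\<close>, then \<open>q\<^sub>n = O(1/n)\<close> and \<open>K\<^sub>t = O(log t)\<close>, and already
  \<open>\<beta> = 0\<close> gives speed \<open>t / log t\<close>, hence every exponent below \<open>1\<close>.

  Finally, every infinite finitely generated group that is not virtually infinite cyclic has at least
  quadratic growth. The shortlex least words form a language of normal forms that is closed under taking
  factors. The argument of Morse and Hedlund shows that such a language has more than \<open>n\<close> words of every
  length \<open>n\<close>, or else consists of words \<open>x y\<^sup>k z\<close> with \<open>x, y, z\<close> of bounded length
  (\<open>factorial_language_dichotomy\<close>). In the second case the group is a finite union of cosets of cyclic
  subgroups, so by a lemma of B. H. Neumann one of these has finite index. Conversely, a virtually infinite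
  cyclic group has linear growth because a word of length \<open>r\<close> can only reach powers of exponent \<open>O(r)\<close>
  modulo a finite set of coset representatives.
\<close>

section \<open>Words in a group\<close>

lemma word_prod_Nil [simp]: "word_prod G [] = \<one>\<^bsub>G\<^esub>"
  by (simp add: word_prod_def)

lemma word_prod_Cons [simp]: "word_prod G (a # w) = a \<otimes>\<^bsub>G\<^esub> word_prod G w"
  by (simp add: word_prod_def)

context group
begin

lemma word_prod_closed [simp, intro]: "set w \<subseteq> carrier G \<Longrightarrow> word_prod G w \<in> carrier G"
  by (induction w) auto

lemma word_prod_append:
  "set u \<subseteq> carrier G \<Longrightarrow> set v \<subseteq> carrier G \<Longrightarrow> word_prod G (u @ v) = word_prod G u \<otimes> word_prod G v"
  by (induction u) (auto simp: m_assoc)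

lemma word_prod_rev_inv:
  "set w \<subseteq> carrier G \<Longrightarrow> word_prod G (rev (map (\<lambda>x. inv x) w)) = inv (word_prod G w)"
proof (induction w)
  case (Cons a w)
  moreover from Cons.prems have "set (rev (map (\<lambda>x. inv x) w)) \<subseteq> carrier G" by auto
  ultimately show ?case by (simp add: word_prod_append inv_mult_group)
qed simp

lemma word_prod_power:
  "set w \<subseteq> carrier G \<Longrightarrow> word_prod G (concat (replicate k w)) = word_prod G w [^] (k::nat)"
proof (induction k)
  case (Suc k)
  have "set (concat (replicate k w)) \<subseteq> carrier G" using Suc.prems by auto
  then show ?case
    using Suc nat_pow_Suc2 [of "word_prod G w" k] by (simp add: word_prod_append)
qed simp

lemma sym_gen_set_word:
  assumes S: "sym_gen_set G S" and x: "x \<in> carrier G"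
  obtains w where "set w \<subseteq> S" "word_prod G w = x"
proof -
  have SG: "S \<subseteq> carrier G" and inv_S: "\<forall>s\<in>S. inv s \<in> S" using S by (auto simp: sym_gen_set_def)
  have "x \<in> generate G S" using S x by (simp add: sym_gen_set_def)
  then have "\<exists>w. set w \<subseteq> S \<and> word_prod G w = x"
  proof induction
    case one
    show ?case by (rule exI [of _ "[]"]) simp
  next
    case (incl h)
    then show ?case using SG by (intro exI [of _ "[h]"]) auto
  next
    case (inv h)
    then show ?case using SG inv_S by (intro exI [of _ "[inv h]"]) auto
  next
    case (eng h1 h2)
    then obtain w1 w2 where "set w1 \<subseteq> S" "word_prod G w1 = h1" "set w2 \<subseteq> S" "word_prod G w2 = h2"
      by blast
    then show ?case using SG by (intro exI [of _ "w1 @ w2"]) (auto simp: word_prod_append)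
  qed
  then show thesis using that by blast
qed

lemma generate_eq_carrier_remove_one:
  assumes "S \<subseteq> carrier G" and "generate G S = carrier G"
  shows "generate G (S - {\<one>}) = carrier G"
proof
  show "generate G (S - {\<one>}) \<subseteq> carrier G"
    using assms(1) by (intro generate_incl) auto
  have "x \<in> generate G (S - {\<one>})" if "x \<in> generate G S" for x
    using that
  proof induction
    case one
    show ?case by (rule generate.one)
  next
    case (incl h)
    then show ?case by (cases "h = \<one>") (auto intro: generate.intros)
  next
    case (inv h)
    then show ?case by (cases "h = \<one>") (auto intro: generate.intros)
  next
    case (eng h1 h2)
    then show ?case by (auto intro: generate.intros)
  qed
  then show "carrier G \<subseteq> generate G (S - {\<one>})" using assms(2) by auto
qed

lemma sym_gen_set_insert_one:
  assumes "sym_gen_set G S"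
  shows "sym_gen_set G (insert \<one> S)"
  unfolding sym_gen_set_def
proof (intro conjI)
  show "generate G (insert \<one> S) = carrier G"
  proof
    show "generate G (insert \<one> S) \<subseteq> carrier G"
      using assms by (intro generate_incl) (auto simp: sym_gen_set_def)
    show "carrier G \<subseteq> generate G (insert \<one> S)"
      using mono_generate [of S "insert \<one> S"] assms by (auto simp: sym_gen_set_def)
  qed
qed (use assms in \<open>auto simp: sym_gen_set_def\<close>)

lemma sym_gen_set_without_one:
  assumes "finitely_generated G" and "infinite (carrier G)"
  obtains S where "sym_gen_set G S" "\<one> \<notin> S"
proof -
  obtain T where T: "finite T" "T \<subseteq> carrier G" "generate G T = carrier G"
    using assms(1) by (auto simp: finitely_generated_def)
  define S where "S = T \<union> (\<lambda>x. inv x) ` T"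
  have SG: "S \<subseteq> carrier G" using T by (auto simp: S_def)
  have gen: "generate G S = carrier G"
  proof
    show "generate G S \<subseteq> carrier G" using SG by (rule generate_incl)
    show "carrier G \<subseteq> generate G S"
      using mono_generate [of T S] T by (auto simp: S_def)
  qed
  have "sym_gen_set G (S - {\<one>})"
    unfolding sym_gen_set_def
  proof (intro conjI ballI)
    show "finite (S - {\<one>})" using T by (auto simp: S_def)
    show gen': "generate G (S - {\<one>}) = carrier G"
      by (rule generate_eq_carrier_remove_one [OF SG gen])
    show "S - {\<one>} \<noteq> {}"
    proof
      assume "S - {\<one>} = {}"
      with gen' generate_empty have "carrier G = {\<one>}" by metis
      with assms(2) show False by simp
    qed
    show "S - {\<one>} \<subseteq> carrier G" using SG by auto
    show "inv s \<in> S - {\<one>}" if s: "s \<in> S - {\<one>}" for s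
    proof -
      have "s \<in> carrier G" using s SG by auto
      then have "inv s \<noteq> \<one>" using s by (metis DiffE insertCI inv_inv inv_one)
      moreover have "inv s \<in> S" using s T by (auto simp: S_def) 
      ultimately show ?thesis by simp
    qed
  qed
  then show thesis using that by blast
qed

lemma word_dist_le_length:
  assumes S: "sym_gen_set G S" and w: "set w \<subseteq> S"
  shows "word_dist G S (word_prod G w) \<one> \<le> length w"
proof -
  have wG: "set w \<subseteq> carrier G" using S w by (auto simp: sym_gen_set_def)
  have "set (rev (map (\<lambda>x. inv x) w)) \<subseteq> S"
    using S w by (auto simp: sym_gen_set_def)
  moreover have "word_prod G (rev (map (\<lambda>x. inv x) w)) = inv (word_prod G w) \<otimes> \<one>"
    using wG by (simp add: word_prod_rev_inv)
  ultimately show ?thesis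
    unfolding word_dist_def by (intro Least_le) (metis length_map length_rev)
qed

lemma word_dist_attained:
  assumes S: "sym_gen_set G S" and x: "x \<in> carrier G"
  obtains w where "set w \<subseteq> S" "length w = word_dist G S x \<one>" "word_prod G w = x"
proof -
  let ?P = "\<lambda>n. \<exists>w. set w \<subseteq> S \<and> length w = n \<and> word_prod G w = inv x \<otimes> \<one>"
  obtain w0 where "set w0 \<subseteq> S" "word_prod G w0 = inv x"
    using sym_gen_set_word [OF S] x by (metis inv_closed)
  then have "?P (length w0)" using x by auto
  then have "?P (LEAST n. ?P n)" by (rule LeastI)
  then obtain w where w: "set w \<subseteq> S" "length w = word_dist G S x \<one>" "word_prod G w = inv x"
    using x by (auto simp: word_dist_def)
  have "set w \<subseteq> carrier G" using S w by (auto simp: sym_gen_set_def)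
  then have "word_prod G (rev (map (\<lambda>x. inv x) w)) = x"
    using x w by (simp add: word_prod_rev_inv)
  moreover have "set (rev (map (\<lambda>x. inv x) w)) \<subseteq> S"
    using S w by (auto simp: sym_gen_set_def)
  ultimately show thesis using that w by (metis length_map length_rev)
qed

lemma word_dist_mult_le:
  assumes S: "sym_gen_set G S" and x: "x \<in> carrier G" and y: "y \<in> carrier G"
  shows "word_dist G S (x \<otimes> y) \<one> \<le> word_dist G S x \<one> + word_dist G S y \<one>"
proof -
  have SG: "S \<subseteq> carrier G" using S by (simp add: sym_gen_set_def)
  obtain u where u: "set u \<subseteq> S" "length u = word_dist G S x \<one>" "word_prod G u = x"
    using word_dist_attained [OF S x] .
  obtain v where v: "set v \<subseteq> S" "length v = word_dist G S y \<one>" "word_prod G v = y"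
    using word_dist_attained [OF S y] .
  have "word_prod G (u @ v) = x \<otimes> y" using u v SG by (subst word_prod_append) auto
  then show ?thesis
    using word_dist_le_length [OF S, of "u @ v"] u v by auto
qed

lemma word_dist_one [simp]: "sym_gen_set G S \<Longrightarrow> word_dist G S \<one> \<one> = 0"
  using word_dist_le_length [of S "[]"] by simp

lemma word_dist_generator_le:
  "sym_gen_set G S \<Longrightarrow> s \<in> S \<Longrightarrow> word_dist G S s \<one> \<le> 1"
  using word_dist_le_length [of S "[s]"] by (auto simp: sym_gen_set_def)

lemma word_dist_pos:
  assumes "sym_gen_set G S" and "x \<in> carrier G" and "x \<noteq> \<one>"
  shows "word_dist G S x \<one> > 0"
proof (rule ccontr)
  assume "\<not> ?thesis"
  then show False using word_dist_attained [OF assms(1,2)] assms(3)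
    by (metis length_0_conv less_numeral_extra(3) neq0_conv word_prod_Nil)
qed

end

section \<open>Normal forms closed under taking factors\<close>

text \<open>A word is a normal form if no word with the same product precedes it in the length-lexicographic
  order of a well-ordering of the letters. Replacing a factor by a smaller word with the same
  product makes the whole word smaller, so factors of normal forms are normal forms.\<close>

lemma (in group) factorial_normal_forms:
  assumes S: "sym_gen_set G S"
  obtains L where "L \<subseteq> lists S" "bij_betw (word_prod G) L (carrier G)"
    "\<forall>u v w. u @ v @ w \<in> L \<longrightarrow> v \<in> L"
proof -
  have SG: "S \<subseteq> carrier G" using S by (simp add: sym_gen_set_def)
  obtain r0 :: "'a rel" where r0: "well_order_on UNIV r0"
    using well_order_on by blast
  define r where "r = r0 - Id"
  have wf_r: "wf r" using r0 by (simp add: r_def well_order_on_def)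
  have irr: "irrefl r" by (simp add: r_def irrefl_def)
  have tot: "total r" using r0 by (auto simp: r_def well_order_on_def linear_order_on_def total_on_def)
  define L where "L = {w \<in> lists S. \<forall>v\<in>lists S. word_prod G v = word_prod G w \<longrightarrow> (v, w) \<notin> lenlex r}"
  show thesis
  proof (rule that)
    show "L \<subseteq> lists S" by (auto simp: L_def)
    show "\<forall>u v w. u @ v @ w \<in> L \<longrightarrow> v \<in> L"
    proof (intro allI impI)
      fix u v w assume uvw: "u @ v @ w \<in> L"
      have sub: "u \<in> lists S" "v \<in> lists S" "w \<in> lists S" using uvw by (auto simp: L_def)
      have "(v', v) \<notin> lenlex r" if v': "v' \<in> lists S" "word_prod G v' = word_prod G v" for v'
      proof
        assume less: "(v', v) \<in> lenlex r"
        have "(v' @ w, v @ w) \<in> lenlex r"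
          using lenlex_append1 [OF less refl] .
        then have "(u @ v' @ w, u @ v @ w) \<in> lenlex r"
          using irr by simp
        moreover have "word_prod G (u @ v' @ w) = word_prod G (u @ v @ w)"
          using sub v' SG by (simp add: word_prod_append subset_iff in_lists_conv_set)
        moreover have "u @ v' @ w \<in> lists S" using sub v' by auto
        ultimately show False using uvw by (auto simp: L_def)
      qed
      then show "v \<in> L" using sub by (auto simp: L_def)
    qed
    show "bij_betw (word_prod G) L (carrier G)"
    proof (rule bij_betw_imageI)
      show "inj_on (word_prod G) L"
      proof (rule inj_onI)
        fix v w assume vw: "v \<in> L" "w \<in> L" "word_prod G v = word_prod G w"
        then have "(v, w) \<notin> lenlex r" "(w, v) \<notin> lenlex r" by (auto simp: L_def)
        then show "v = w" using total_lenlex [OF tot] by (auto simp: total_on_def)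
      qed
      show "word_prod G ` L = carrier G"
      proof
        show "word_prod G ` L \<subseteq> carrier G" using SG by (auto simp: L_def)
        show "carrier G \<subseteq> word_prod G ` L"
        proof
          fix x assume "x \<in> carrier G"
          then obtain w where "set w \<subseteq> S" "word_prod G w = x"
            using sym_gen_set_word [OF S] by blast
          then have ne: "w \<in> {w \<in> lists S. word_prod G w = x}" by (auto simp: in_lists_conv_set)
          from wfE_min [OF wf_lenlex [OF wf_r] ne] obtain z where
            "z \<in> {w \<in> lists S. word_prod G w = x}"
            "\<And>y. (y, z) \<in> lenlex r \<Longrightarrow> y \<notin> {w \<in> lists S. word_prod G w = x}"
            by blast
          then have "z \<in> L" "word_prod G z = x" by (auto simp: L_def)
          then show "x \<in> word_prod G ` L" by blast
        qed
      qed
    qed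
  qed
qed

section \<open>A Morse--Hedlund dichotomy for factorial languages\<close>

lemma finite_words_of_length:
  assumes "finite S" "L \<subseteq> lists S"
  shows "finite {w \<in> L. length w = n}"
  by (rule finite_subset [OF _ finite_lists_length_eq [OF assms(1), of n]])
     (use assms(2) in \<open>auto simp: in_lists_conv_set\<close>)

lemma periodic_list_decomposition:
  assumes "q > 0" and "\<And>l. l + q < length v \<Longrightarrow> v ! l = v ! (l + q)"
  shows "\<exists>k z. v = concat (replicate k (take q v)) @ z \<and> length z < q"
  using assms(2)
proof (induction "length v" arbitrary: v rule: less_induct)
  case less
  consider "length v < q" | "q \<le> length v" "length v < 2 * q" | "2 * q \<le> length v" by linarith
  then show ?case
  proof cases
    case 1
    then show ?thesis by (intro exI [of _ 0] exI [of _ v]) simp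
  next
    case 2
    then show ?thesis by (intro exI [of _ 1] exI [of _ "drop q v"]) auto
  next
    case 3
    have "take q (drop q v) = take q v"
      using 3 less.prems by (intro nth_equalityI) (auto simp: add.commute)
    moreover have "\<exists>k z. drop q v = concat (replicate k (take q (drop q v))) @ z \<and> length z < q"
      using 3 assms(1) less.prems [of "q + _"] by (intro less.hyps) (auto simp: add.assoc)
    ultimately obtain k z where "drop q v = concat (replicate k (take q v)) @ z" "length z < q"
      by auto
    then have "v = concat (replicate (Suc k) (take q v)) @ z"
      by (metis append.assoc append_take_drop_id concat.simps(2) replicate_Suc)
    with \<open>length z < q\<close> show ?thesis by blast
  qed
qed

text \<open>Apply the Morse--Hedlund argument to the words \<open>E\<close> that can be extended arbitrarily far in both
  directions within \<open>L\<close>. If their number \<open>p n\<close> grows strictly with the length \<open>n\<close>, then \<open>p n > n\<close>.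
  Otherwise \<open>p (m + 1) \<le> p m\<close> for some \<open>m\<close>, and then \<open>m\<close> consecutive letters determine the next
  one, so long words in \<open>E\<close> are eventually periodic. A word of \<open>L\<close> behaves like one of \<open>E\<close> away
  from its two ends.\<close>

lemma factorial_language_dichotomy:
  fixes L :: "'a list set"
  assumes fin: "finite S" and sub: "L \<subseteq> lists S" and inf: "infinite L"
    and fac: "\<forall>u v w. u @ v @ w \<in> L \<longrightarrow> v \<in> L"
  shows "(\<forall>n. n + 1 \<le> card {w \<in> L. length w = n}) \<or>
         (\<exists>M. \<forall>w\<in>L. \<exists>x y z k. w = x @ concat (replicate k y) @ z \<and>
                length x \<le> M \<and> length y \<le> M \<and> length z \<le> M)"
proof -
  define E where "E = {w. \<forall>k. \<exists>u v. k \<le> length u \<and> k \<le> length v \<and> u @ w @ v \<in> L}"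
  have EL: "E \<subseteq> L" unfolding E_def using fac by blast
  have finL: "finite {w \<in> L. length w = n}" for n
    using fin sub by (rule finite_words_of_length)
  have finE: "finite {w \<in> E. length w = n}" for n
    by (rule finite_subset [OF _ finL [of n]]) (use EL in auto)
  have prefE: "v \<in> E" if "v @ w \<in> E" for v w
    unfolding E_def
  proof (intro CollectI allI)
    fix k
    obtain u x where "k \<le> length u" "k \<le> length x" "u @ (v @ w) @ x \<in> L"
      using \<open>v @ w \<in> E\<close> unfolding E_def by blast
    then show "\<exists>u x. k \<le> length u \<and> k \<le> length x \<and> u @ v @ x \<in> L"
      by (intro exI [of _ u] exI [of _ "w @ x"]) auto
  qed
  have nilE: "[] \<in> E"
    unfolding E_def
  proof (intro CollectI allI)
    fix k
    have "\<exists>w\<in>L. 2 * k \<le> length w"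
    proof (rule ccontr)
      assume "\<not> ?thesis"
      then have "L \<subseteq> (\<Union>n<2 * k. {w \<in> L. length w = n})" by fastforce
      with inf finL show False by (meson finite_UN finite_lessThan finite_subset)
    qed
    then obtain w where "w \<in> L" "2 * k \<le> length w" by blast
    then show "\<exists>u v. k \<le> length u \<and> k \<le> length v \<and> u @ [] @ v \<in> L"
      by (intro exI [of _ "take k w"] exI [of _ "drop k w"]) auto
  qed
  \<comment> \<open>Otherwise every letter \<open>a\<close> fails from some depth \<open>\<kappa> a\<close> on, and a deep extension of \<open>w\<close>
    starts with one of finitely many letters.\<close>
  have extE: "\<exists>a. w @ [a] \<in> E" if w: "w \<in> E" for w
  proof (rule ccontr)
    assume "\<not> ?thesis"
    then have "\<forall>a. \<exists>k. \<forall>u v. k \<le> length u \<longrightarrow> k \<le> length v \<longrightarrow> u @ (w @ [a]) @ v \<notin> L"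
      by (auto simp: E_def)
    then obtain \<kappa> where \<kappa>: "\<And>a u v. \<kappa> a \<le> length u \<Longrightarrow> \<kappa> a \<le> length v \<Longrightarrow> u @ (w @ [a]) @ v \<notin> L"
      by metis
    define k where "k = (\<Sum>a\<in>S. \<kappa> a)"
    obtain u v where uv: "Suc k \<le> length u" "Suc k \<le> length v" "u @ w @ v \<in> L"
      using w unfolding E_def by blast
    then obtain a v' where v: "v = a # v'" by (cases v) auto
    have "a \<in> S" using uv sub by (auto simp: v)
    then have "\<kappa> a \<le> k" unfolding k_def using fin by (intro member_le_sum) auto
    then show False using \<kappa> [of a u v'] uv by (auto simp: v)
  qed
  define p where "p n = card {w \<in> E. length w = n}" for n
  have take_E: "take m ` {w \<in> E. length w = Suc m} = {w \<in> E. length w = m}" for m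
  proof
    show "take m ` {w \<in> E. length w = Suc m} \<subseteq> {w \<in> E. length w = m}"
    proof (rule image_subsetI)
      fix w assume "w \<in> {w \<in> E. length w = Suc m}"
      then show "take m w \<in> {w \<in> E. length w = m}"
        using prefE [of "take m w" "drop m w"] by auto
    qed
    show "{w \<in> E. length w = m} \<subseteq> take m ` {w \<in> E. length w = Suc m}"
    proof
      fix w assume w: "w \<in> {w \<in> E. length w = m}"
      then obtain a where "w @ [a] \<in> E" using extE by blast
      then show "w \<in> take m ` {w \<in> E. length w = Suc m}"
        using w by (intro image_eqI [of _ _ "w @ [a]"]) auto
    qed
  qed
  show ?thesis
  proof (cases "\<forall>m. p m < p (Suc m)")
    case True
    have "{w \<in> E. length w = 0} = {[]}" using nilE by auto
    then have "p 0 = 1" by (simp add: p_def)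
    then have "n + 1 \<le> p n" for n
      by (induction n) (use True in \<open>auto simp: Suc_le_eq intro: le_less_trans\<close>)
    moreover have "p n \<le> card {w \<in> L. length w = n}" for n
      unfolding p_def by (rule card_mono [OF finL]) (use EL in auto)
    ultimately show ?thesis by (meson order_trans)
  next
    case False
    then obtain m where m: "p (Suc m) \<le> p m" by (auto simp: not_less)
    have "inj_on (take m) {w \<in> E. length w = Suc m}"
    proof (rule eq_card_imp_inj_on [OF finE])
      show "card (take m ` {w \<in> E. length w = Suc m}) = card {w \<in> E. length w = Suc m}"
        using m card_image_le [OF finE, of "take m" "Suc m"] by (simp add: take_E p_def)
    qed
    then have det: "u = v" if "u \<in> E" "v \<in> E" "length u = Suc m" "length v = Suc m" "take m u = take m v" for u v
      using that by (auto dest: inj_onD)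
    define F where "F = {f \<in> lists S. length f = Suc m}"
    have finF: "finite F" unfolding F_def using fin subset_refl by (rule finite_words_of_length)
    have "\<forall>f. \<exists>k. f \<notin> E \<longrightarrow> (\<forall>u v. k \<le> length u \<longrightarrow> k \<le> length v \<longrightarrow> u @ f @ v \<notin> L)"
      by (auto simp: E_def)
    then obtain \<kappa> where \<kappa>: "\<And>f u v. f \<notin> E \<Longrightarrow> \<kappa> f \<le> length u \<Longrightarrow> \<kappa> f \<le> length v \<Longrightarrow> u @ f @ v \<notin> L"
      by metis
    define K where "K = (\<Sum>f\<in>F. \<kappa> f)"
    \<comment> \<open>Only finitely many words have length \<open>m + 1\<close>, so one depth \<open>K\<close> certifies membership in \<open>E\<close>
      for all of them.\<close>
    have KE: "f \<in> E" if "length f = Suc m" "K \<le> length u" "K \<le> length v" "u @ f @ v \<in> L" for f u v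
    proof (rule ccontr)
      assume "f \<notin> E"
      have "f \<in> F" using that sub by (auto simp: F_def)
      then have "\<kappa> f \<le> K" unfolding K_def using finF by (intro member_le_sum) auto
      then show False using \<kappa> [OF \<open>f \<notin> E\<close>, of u v] that by auto
    qed
    define M where "M = 2 * K + m + p m + 1"
    have "\<exists>x y z k. w = x @ concat (replicate k y) @ z \<and> length x \<le> M \<and> length y \<le> M \<and> length z \<le> M"
      if w: "w \<in> L" for w
    proof (cases "length w \<le> M")
      case True
      then show ?thesis by (intro exI [of _ "[]"] exI [of _ w] exI [of _ 0]) simp
    next
      case False
      define w1 where "w1 = take (length w - 2 * K) (drop K w)"
      define n where "n = length w1"
      have n: "n = length w - 2 * K" "m + p m + 1 < n"
        using False by (auto simp: n_def w1_def M_def)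
      have w_eq: "w = take K w @ w1 @ drop (length w - K) w"
      proof -
        have "drop (length w - 2 * K) (drop K w) = drop (length w - K) w"
          using False by (simp add: M_def)
        then show ?thesis unfolding w1_def by (metis append_take_drop_id)
      qed
      have factor: "take (Suc m) (drop i w1) \<in> E" if i: "i + m < n" for i
      proof (rule KE)
        show "length (take (Suc m) (drop i w1)) = Suc m" using i by (simp add: n_def)
        have "w1 = take i w1 @ take (Suc m) (drop i w1) @ drop (Suc m) (drop i w1)"
          by (metis append_take_drop_id)
        then show "(take K w @ take i w1) @ take (Suc m) (drop i w1) @
              (drop (Suc m) (drop i w1) @ drop (length w - K) w) \<in> L"
          using w w_eq by (metis append.assoc)
        show "K \<le> length (take K w @ take i w1)" using False by (simp add: M_def)
        show "K \<le> length (drop (Suc m) (drop i w1) @ drop (length w - K) w)"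
          using False by (simp add: M_def)
      qed
      have state: "take m (drop i w1) \<in> {w \<in> E. length w = m}" if i: "i + m < n" for i
      proof -
        have "take m (take (Suc m) (drop i w1)) \<in> E"
          by (rule prefE [of _ "drop m (take (Suc m) (drop i w1))"])
             (simp only: append_take_drop_id factor [OF i])
        then show ?thesis using i by (simp add: min_def n_def)
      qed
      \<comment> \<open>There are only \<open>p m\<close> possible windows of length \<open>m\<close>, so one of them recurs among the first
        \<open>p m + 1\<close> positions; from there on the word repeats itself.\<close>
      have "\<not> inj_on (\<lambda>i. take m (drop i w1)) {..p m}"
      proof
        assume "inj_on (\<lambda>i. take m (drop i w1)) {..p m}"
        moreover have "(\<lambda>i. take m (drop i w1)) ` {..p m} \<subseteq> {w \<in> E. length w = m}"
          using state n by auto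
        ultimately have "card {..p m} \<le> p m"
          unfolding p_def using finE by (rule card_inj_on_le)
        then show False by simp
      qed
      then obtain i j where ij: "i < j" "j \<le> p m" "take m (drop i w1) = take m (drop j w1)"
        unfolding inj_on_def by (metis atMost_iff linorder_neqE_nat)
      define q where "q = j - i"
      have q: "q > 0" "j = i + q" using ij by (auto simp: q_def)
      have step: "take (Suc m) (drop (i + l) w1) = take (Suc m) (drop (j + l) w1)"
        if "take m (drop (i + l) w1) = take m (drop (j + l) w1)" "j + l + m < n" for l
      proof (rule det)
        show "take (Suc m) (drop (i + l) w1) \<in> E" "take (Suc m) (drop (j + l) w1) \<in> E"
          using that ij by (auto intro: factor)
      qed (use that ij in \<open>auto simp: n_def min_def\<close>)
      have same: "take m (drop (i + l) w1) = take m (drop (j + l) w1)" if "j + l + m \<le> n" for l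
        using that
      proof (induction l)
        case (Suc l)
        have shift: "take m (drop (Suc a) w1) = drop 1 (take (Suc m) (drop a w1))" for a
          by (simp add: drop_take add.commute)
        show ?case using step [of l] Suc by (simp add: shift)
      qed (use ij in simp)
      have letters: "w1 ! (i + l) = w1 ! (j + l)" if l: "j + l + m < n" for l
      proof -
        have "take (Suc m) (drop (i + l) w1) ! 0 = take (Suc m) (drop (j + l) w1) ! 0"
          using step [OF same] l by simp
        then show ?thesis using l ij by (simp add: n_def)
      qed
      define v where "v = drop i (take (n - m) w1)"
      have "v ! l = v ! (l + q)" if "l + q < length v" for l
        using letters [of l] that q by (simp add: v_def n_def algebra_simps)
      then obtain k z where kz: "v = concat (replicate k (take q v)) @ z" "length z < q"
        using periodic_list_decomposition [OF q(1)] by blast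
      have "w1 = take i w1 @ v @ drop (n - m) w1"
      proof -
        have "take i (take (n - m) w1) = take i w1" using ij n by simp
        then show ?thesis unfolding v_def by (metis append.assoc append_take_drop_id)
      qed
      then have "w = (take K w @ take i w1) @ concat (replicate k (take q v)) @ (z @ drop (n - m) w1 @ drop (length w - K) w)"
        using w_eq kz(1) by (metis append.assoc)
      moreover have "length (take K w @ take i w1) \<le> M" "length (take q v) \<le> M"
        using ij q by (auto simp: M_def)
      moreover have "length (z @ drop (n - m) w1 @ drop (length w - K) w) \<le> M"
        using kz(2) ij q n by (auto simp: M_def n_def)
      ultimately show ?thesis by blast
    qed
    then show ?thesis by blast
  qed
qed

section \<open>Linear growth and virtually infinite cyclic groups\<close>

text \<open>B. H. Neumann's lemma, by induction on the number of subgroups. If \<open>K\<close> has infinite index, some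
  coset \<open>K g\<close> is not in the list. It is disjoint from the listed cosets of \<open>K\<close>, hence covered by
  cosets of the other subgroups, and so is every translate of it. Therefore \<open>K\<close> can be removed from
  the covering.\<close>

lemma (in group) Neumann_covering:
  assumes "finite \<K>" and "\<And>K. K \<in> \<K> \<Longrightarrow> subgroup K G"
    and "finite A" and "A \<subseteq> \<K> \<times> carrier G" and "carrier G \<subseteq> (\<Union>(K, a)\<in>A. K #> a)"
  shows "\<exists>K\<in>\<K>. finite (rcosets K)"
  using assms
proof (induction \<K> arbitrary: A)
  case empty
  then show ?case by auto
next
  case (insert K \<K>)
  note sub = insert.prems(1) and finA = insert.prems(2) and AK = insert.prems(3) and cov = insert.prems(4)
  have K: "subgroup K G" using sub by simp
  then have KG: "K \<subseteq> carrier G" by (rule subgroup.subset)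
  show ?case
  proof (cases "finite (rcosets K)")
    case True
    then show ?thesis by blast
  next
    case False
    then have "\<not> rcosets K \<subseteq> (\<lambda>(L, a). L #> a) ` A"
      using finA finite_subset by blast
    then obtain g where g: "g \<in> carrier G" "K #> g \<notin> (\<lambda>(L, a). L #> a) ` A"
      by (auto simp: RCOSETS_def)
    define A1 where "A1 = {(L, a) \<in> A. L \<in> \<K>}"
    have cov_g: "\<exists>(L, a)\<in>A1. x \<in> L #> a" if x: "x \<in> K #> g" for x
    proof -
      have "x \<in> carrier G" using x KG g(1) r_coset_subset_G by blast
      then obtain L a where La: "(L, a) \<in> A" "x \<in> L #> a" using cov by blast
      have aG: "a \<in> carrier G" using La AK by auto
      have "L \<noteq> K"
      proof
        assume "L = K"
        then have "K #> g = K #> a"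
          using repr_independence [OF x g(1) K] repr_independence [OF _ aG K] La(2) by metis
        with g(2) La(1) \<open>L = K\<close> show False by force
      qed
      then have "(L, a) \<in> A1" using La AK by (auto simp: A1_def)
      with La(2) show ?thesis by blast
    qed
    define A2 where "A2 = A1 \<union> (\<lambda>((L, a), (_, b)). (L, a \<otimes> inv g \<otimes> b)) ` (A1 \<times> A)"
    have "\<exists>L\<in>\<K>. finite (rcosets L)"
    proof (rule insert.IH)
      show "subgroup L G" if "L \<in> \<K>" for L using sub that by simp
      have "A1 \<subseteq> A" by (auto simp: A1_def)
      then have "finite A1" using finA finite_subset by blast
      then show "finite A2" using finA by (simp add: A2_def)
      show "A2 \<subseteq> \<K> \<times> carrier G"
      proof
        fix p assume "p \<in> A2"
        then consider "p \<in> A1"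
          | L a M b where "(L, a) \<in> A1" "(M, b) \<in> A" "p = (L, a \<otimes> inv g \<otimes> b)"
          by (force simp: A2_def)
        then show "p \<in> \<K> \<times> carrier G"
        proof cases
          case 1
          then show ?thesis using AK by (auto simp: A1_def)
        next
          case 2
          then have "L \<in> \<K>" "a \<in> carrier G" "b \<in> carrier G" using AK by (auto simp: A1_def)
          then show ?thesis using 2 g(1) by simp
        qed
      qed
      show "carrier G \<subseteq> (\<Union>(L, a)\<in>A2. L #> a)"
      proof
        fix x assume x: "x \<in> carrier G"
        then obtain L b where Lb: "(L, b) \<in> A" "x \<in> L #> b" using cov by blast
        have bG: "b \<in> carrier G" using Lb AK by auto
        show "x \<in> (\<Union>(L, a)\<in>A2. L #> a)"
        proof (cases "L \<in> \<K>")
          case True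
          then show ?thesis using Lb by (auto simp: A2_def A1_def)
        next
          case False
          then have "L = K" using Lb AK by auto
          then obtain k where k: "k \<in> K" "x = k \<otimes> b" using Lb by (auto simp: r_coset_def)
          then have kG: "k \<in> carrier G" using KG by auto
          have "k \<otimes> g \<in> K #> g" using k by (auto simp: r_coset_def)
          then obtain L' a where La: "(L', a) \<in> A1" "k \<otimes> g \<in> L' #> a" using cov_g by blast
          have aG: "a \<in> carrier G" and L': "L' \<subseteq> carrier G"
            using La AK sub by (auto simp: A1_def dest: subgroup.subset)
          from La obtain l where l: "l \<in> L'" "k \<otimes> g = l \<otimes> a" by (auto simp: r_coset_def)
          have lG: "l \<in> carrier G" using l L' by auto
          have "x = k \<otimes> g \<otimes> inv g \<otimes> b" using k kG g(1) bG by (simp add: m_assoc)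
          also have "\<dots> = l \<otimes> (a \<otimes> inv g \<otimes> b)"
            using l lG aG g(1) bG by (simp add: m_assoc)
          finally have "x \<in> L' #> (a \<otimes> inv g \<otimes> b)" using l by (auto simp: r_coset_def)
          moreover have "(L', a \<otimes> inv g \<otimes> b) \<in> A2"
            unfolding A2_def using La Lb by force
          ultimately show ?thesis by blast
        qed
      qed
    qed
    then show ?thesis by blast
  qed
qed

lemma (in group) pow_conjugate:
  assumes "a \<in> carrier G" "b \<in> carrier G"
  shows "(a \<otimes> b \<otimes> inv a) [^] (k::nat) = a \<otimes> b [^] k \<otimes> inv a"
proof (induction k)
  case (Suc k)
  have "(a \<otimes> b \<otimes> inv a) [^] Suc k = a \<otimes> b [^] k \<otimes> inv a \<otimes> (a \<otimes> b \<otimes> inv a)"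
    by (simp add: Suc.IH)
  also have "\<dots> = a \<otimes> b [^] k \<otimes> (inv a \<otimes> (a \<otimes> (b \<otimes> inv a)))"
    using assms by (simp add: m_assoc)
  also have "inv a \<otimes> (a \<otimes> (b \<otimes> inv a)) = b \<otimes> inv a"
    using assms by (simp add: m_assoc [symmetric])
  finally show ?case using assms by (simp add: m_assoc)
qed (use assms in simp)

lemma (in group) infinite_subgroup_of_finite_index:
  assumes K: "subgroup K G" and "finite (rcosets K)" and "infinite (carrier G)"
  shows "infinite K"
proof
  assume "finite K"
  then have "finite (\<Union>(rcosets K))"
    using assms(2) by (auto simp: RCOSETS_def r_coset_def)
  then show False using rcosets_part_G [OF K] assms(3) by simp
qed

lemma (in group) virtually_Z_of_cyclic_finite_index:
  assumes g: "g \<in> carrier G" and fin: "finite (rcosets (generate G {g}))" and inf: "infinite (carrier G)"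
  shows "virtually_Z G"
proof -
  define K where "K = generate G {g}"
  have K: "subgroup K G" unfolding K_def using g by (intro generate_is_subgroup) auto
  have K_eq: "K = range (\<lambda>i::int. g [^] i)" using generate_pow [OF g] by (auto simp: K_def)
  have "infinite K"
    using infinite_subgroup_of_finite_index [OF K] fin inf by (simp add: K_def)
  then have "\<forall>m n::int. g [^] m = g [^] n \<longrightarrow> m = n"
    using infinite_cyclic_subgroup_int [OF g]
    by (simp add: K_eq carrier_subgroup_generated_by_singleton [OF g])
  then have "bij_betw (\<lambda>i::int. g [^] i) UNIV K"
    by (auto simp: bij_betw_def inj_on_def K_eq)
  then have "(\<lambda>i::int. g [^] i) \<in> iso integer_group (G\<lparr>carrier := K\<rparr>)"
    using g by (auto simp: iso_def hom_def int_pow_mult K_eq)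
  then have "integer_group \<cong> G\<lparr>carrier := K\<rparr>" by (auto simp: is_iso_def)
  then have "G\<lparr>carrier := K\<rparr> \<cong> integer_group"
    by (rule group.iso_sym [OF group_integer_group])
  with K fin show ?thesis by (auto simp: virtually_Z_def K_def)
qed

text \<open>Since \<open>a b\<^sup>k c = (a b a\<^bsup>-1\<^esup>)\<^sup>k a c\<close>, elements \<open>x y\<^sup>k z\<close> with bounded \<open>x, y, z\<close> lie in finitely many
  right cosets of cyclic subgroups.\<close>

lemma (in group) virtually_Z_of_periodic_words:
  assumes S: "sym_gen_set G S" and inf: "infinite (carrier G)"
    and forms: "\<And>g. g \<in> carrier G \<Longrightarrow> \<exists>x y z k. set x \<subseteq> S \<and> set y \<subseteq> S \<and> set z \<subseteq> S \<and>
        length x \<le> M \<and> length y \<le> M \<and> length z \<le> M \<and>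
        g = word_prod G (x @ concat (replicate k y) @ z)"
  shows "virtually_Z G"
proof -
  have SG: "S \<subseteq> carrier G" and finS: "finite S" using S by (auto simp: sym_gen_set_def)
  define T where "T = word_prod G ` {w. set w \<subseteq> S \<and> length w \<le> M}"
  have finT: "finite T" unfolding T_def using finite_lists_length_le [OF finS] by simp
  have TG: "T \<subseteq> carrier G" using SG by (auto simp: T_def)
  define \<K> where "\<K> = (\<lambda>(a, b). generate G {a \<otimes> b \<otimes> inv a}) ` (T \<times> T)"
  define A where "A = (\<lambda>(a, b, c). (generate G {a \<otimes> b \<otimes> inv a}, a \<otimes> c)) ` (T \<times> T \<times> T)"
  have "\<exists>K\<in>\<K>. finite (rcosets K)"
  proof (rule Neumann_covering)
    show "finite \<K>" "finite A" using finT by (auto simp: \<K>_def A_def)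
    show "subgroup K G" if "K \<in> \<K>" for K
      using that TG by (auto simp: \<K>_def intro!: generate_is_subgroup)
    show "A \<subseteq> \<K> \<times> carrier G"
      using TG by (auto simp: A_def \<K>_def)
    show "carrier G \<subseteq> (\<Union>(K, a)\<in>A. K #> a)"
    proof
      fix g assume "g \<in> carrier G"
      then obtain x y z k where xyz: "set x \<subseteq> S" "set y \<subseteq> S" "set z \<subseteq> S"
        "length x \<le> M" "length y \<le> M" "length z \<le> M"
        and g_eq: "g = word_prod G (x @ concat (replicate k y) @ z)"
        using forms by blast
      define a b c where "a = word_prod G x" and "b = word_prod G y" and "c = word_prod G z"
      have abc: "a \<in> T" "b \<in> T" "c \<in> T" using xyz by (auto simp: a_def b_def c_def T_def)
      then have abcG: "a \<in> carrier G" "b \<in> carrier G" "c \<in> carrier G" using TG by auto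
      have sets: "set x \<subseteq> carrier G" "set (concat (replicate k y)) \<subseteq> carrier G" "set y \<subseteq> carrier G"
        "set z \<subseteq> carrier G" using xyz SG by auto
      have "g = a \<otimes> (b [^] k \<otimes> c)"
        using sets by (simp add: g_eq word_prod_append word_prod_power a_def b_def c_def)
      also have "\<dots> = a \<otimes> b [^] k \<otimes> inv a \<otimes> (a \<otimes> c)"
      proof -
        have "inv a \<otimes> (a \<otimes> c) = c" using abcG by (simp add: m_assoc [symmetric])
        then show ?thesis using abcG by (simp add: m_assoc)
      qed
      also have "\<dots> = (a \<otimes> b \<otimes> inv a) [^] (int k) \<otimes> (a \<otimes> c)"
        using abcG by (simp add: pow_conjugate int_pow_int)
      finally have "g \<in> generate G {a \<otimes> b \<otimes> inv a} #> (a \<otimes> c)"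
        using abcG generate_pow [of "a \<otimes> b \<otimes> inv a"] by (auto simp: r_coset_def)
      then show "g \<in> (\<Union>(K, a)\<in>A. K #> a)"
        using abc by (force simp: A_def)
    qed
  qed
  then obtain a b where "a \<in> T" "b \<in> T" "finite (rcosets (generate G {a \<otimes> b \<otimes> inv a}))"
    by (auto simp: \<K>_def)
  then show ?thesis
    using TG inf by (intro virtually_Z_of_cyclic_finite_index [of "a \<otimes> b \<otimes> inv a"]) auto
qed

text \<open>The language \<open>L\<close> of normal forms contains words of every length, being infinite and closed under
  prefixes. It cannot satisfy the second alternative of the dichotomy unless the group is virtually
  infinite cyclic.\<close>

lemma (in group) normal_form_growth:
  assumes S: "sym_gen_set G S" and inf: "infinite (carrier G)"
  obtains L where "L \<subseteq> lists S" "inj_on (word_prod G) L"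
    "\<forall>n. 1 \<le> card {w \<in> L. length w = n}"
    "\<not> virtually_Z G \<longrightarrow> (\<forall>n. n + 1 \<le> card {w \<in> L. length w = n})"
proof -
  have finS: "finite S" using S by (simp add: sym_gen_set_def)
  obtain L where L: "L \<subseteq> lists S" "bij_betw (word_prod G) L (carrier G)"
    and fac': "\<forall>u v w. u @ v @ w \<in> L \<longrightarrow> v \<in> L"
    using factorial_normal_forms [OF S] .
  have fac: "v \<in> L" if "u @ v @ w \<in> L" for u v w using fac' that by blast
  have infL: "infinite L" using L(2) inf bij_betw_finite by blast
  have finL: "finite {w \<in> L. length w = n}" for n
    using finS L(1) by (rule finite_words_of_length)
  have "1 \<le> card {w \<in> L. length w = n}" for n
  proof -
    have "\<exists>w\<in>L. n \<le> length w"
    proof (rule ccontr)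
      assume "\<not> ?thesis"
      then have "L \<subseteq> (\<Union>m<n. {w \<in> L. length w = m})" by fastforce
      with infL finL show False by (meson finite_UN finite_lessThan finite_subset)
    qed
    then obtain w where w: "w \<in> L" "n \<le> length w" by blast
    have "take n w \<in> L" using fac [of "[]" "take n w" "drop n w"] w by simp
    then have "take n w \<in> {w \<in> L. length w = n}" using w by simp
    then have "card {w \<in> L. length w = n} > 0" using finL card_gt_0_iff by blast
    then show ?thesis by simp
  qed
  moreover have "\<forall>n. n + 1 \<le> card {w \<in> L. length w = n}" if not: "\<not> virtually_Z G"
  proof (rule ccontr)
    assume "\<not> ?thesis"
    then obtain M where M: "\<And>w. w \<in> L \<Longrightarrow> \<exists>x y z k. w = x @ concat (replicate k y) @ z \<and>
         length x \<le> M \<and> length y \<le> M \<and> length z \<le> M"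
      using factorial_language_dichotomy [OF finS L(1) infL fac'] by blast
    have "virtually_Z G"
    proof (rule virtually_Z_of_periodic_words [OF S inf])
      fix g assume "g \<in> carrier G"
      then obtain w where w: "w \<in> L" "g = word_prod G w" using L(2) by (auto simp: bij_betw_def)
      then obtain x y z k where xyz: "w = x @ concat (replicate k y) @ z"
         "length x \<le> M" "length y \<le> M" "length z \<le> M" using M by blast
      \<comment> \<open>For \<open>k = 0\<close> the letters of \<open>y\<close> do not occur in \<open>w\<close> and need not belong to \<open>S\<close>.\<close>
      define y' where "y' = (if k = 0 then [] else y)"
      have "set w \<subseteq> S" using w L(1) by auto
      then have "set x \<subseteq> S" "set y' \<subseteq> S" "set z \<subseteq> S" "length y' \<le> M"
          "concat (replicate k y) = concat (replicate k y')"
        using xyz by (auto simp: y'_def)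
      then show "\<exists>x y z k. set x \<subseteq> S \<and> set y \<subseteq> S \<and> set z \<subseteq> S \<and>
        length x \<le> M \<and> length y \<le> M \<and> length z \<le> M \<and>
        g = word_prod G (x @ concat (replicate k y) @ z)"
        using xyz by (intro exI [of _ x] exI [of _ y'] exI [of _ z] exI [of _ k]) (simp add: w(2))
    qed
    with not show False ..
  qed
  ultimately show thesis using that L by (auto simp: bij_betw_def)
qed

lemma (in group) finite_word_ball:
  assumes S: "sym_gen_set G S"
  shows "finite (word_ball G S r)"
proof (rule finite_subset)
  have finS: "finite S" using S by (simp add: sym_gen_set_def)
  show "finite (word_prod G ` {w. set w \<subseteq> S \<and> length w \<le> r})"
    using finite_lists_length_le [OF finS] by simp
  show "word_ball G S r \<subseteq> word_prod G ` {w. set w \<subseteq> S \<and> length w \<le> r}"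
      proof
    fix x assume x: "x \<in> word_ball G S r"
    then obtain w where "set w \<subseteq> S" "length w = word_dist G S x \<one>" "word_prod G w = x"
      using word_dist_attained [OF S, of x] by (auto simp: word_ball_def)
    with x show "x \<in> word_prod G ` {w. set w \<subseteq> S \<and> length w \<le> r}"
      by (auto simp: word_ball_def)
  qed
qed

lemma (in group) card_word_ball_ge:
  assumes S: "sym_gen_set G S" and L: "L \<subseteq> lists S" "inj_on (word_prod G) L"
  shows "(\<Sum>n\<le>r. card {w \<in> L. length w = n}) \<le> card (word_ball G S r)"
proof -
  have finS: "finite S" and SG: "S \<subseteq> carrier G" using S by (auto simp: sym_gen_set_def)
  have finL: "finite {w \<in> L. length w = n}" for n
    using finS L(1) by (rule finite_words_of_length)
  have "(\<Sum>n\<le>r. card {w \<in> L. length w = n}) = card (\<Union>n\<le>r. {w \<in> L. length w = n})"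
    using finL by (subst card_UN_disjoint) auto
  also have "\<dots> \<le> card (word_ball G S r)"
  proof (rule card_inj_on_le [OF _ _ finite_word_ball [OF S]])
    show "inj_on (word_prod G) (\<Union>n\<le>r. {w \<in> L. length w = n})"
      by (rule inj_on_subset [OF L(2)]) auto
    show "word_prod G ` (\<Union>n\<le>r. {w \<in> L. length w = n}) \<subseteq> word_ball G S r"
    proof (rule image_subsetI)
      fix w assume "w \<in> (\<Union>n\<le>r. {w \<in> L. length w = n})"
      then have w: "w \<in> L" "length w \<le> r" by auto
      then have "set w \<subseteq> S" using L(1) by auto
      then show "word_prod G w \<in> word_ball G S r"
        using w word_dist_le_length [OF S, of w] SG by (auto simp: word_ball_def)
    qed
  qed
  finally show ?thesis .
qed

text \<open>Let \<open>\<psi>\<close> identify \<open>\<int>\<close> with a subgroup of finite index and let \<open>T\<close> represent its right cosets.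
  Multiplying \<open>\<psi> i t\<close> by a generator on the right gives \<open>\<psi> (i + j) t'\<close>, where \<open>j\<close> takes finitely
  many values, so a word of length \<open>r\<close> reaches only exponents of size \<open>O(r)\<close>.\<close>

lemma (in group) virtually_Z_word_ball_le:
  assumes S: "sym_gen_set G S" and "virtually_Z G"
  obtains C :: real where "C > 0" "\<forall>r\<ge>1. real (card (word_ball G S r)) \<le> C * real r"
proof -
  have finS: "finite S" and SG: "S \<subseteq> carrier G" using S by (auto simp: sym_gen_set_def)
  obtain K where K: "subgroup K G" and finK: "finite (rcosets K)"
    and "G\<lparr>carrier := K\<rparr> \<cong> integer_group"
    using assms(2) by (auto simp: virtually_Z_def)
  moreover have "group (G\<lparr>carrier := K\<rparr>)" using K by (rule subgroup_imp_group)
  ultimately have "integer_group \<cong> G\<lparr>carrier := K\<rparr>" using group.iso_sym by blast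
  then obtain \<psi> where "\<psi> \<in> iso integer_group (G\<lparr>carrier := K\<rparr>)"
    by (auto simp: is_iso_def)
  then have \<psi>: "bij_betw \<psi> UNIV K" "\<And>i j. \<psi> (i + j) = \<psi> i \<otimes> \<psi> j"
    by (auto simp: iso_def hom_def)
  have KG: "K \<subseteq> carrier G" using K by (rule subgroup.subset)
  have \<psi>K: "\<psi> i \<in> K" for i using \<psi>(1) by (auto simp: bij_betw_def)
  then have \<psi>G: "\<psi> i \<in> carrier G" for i using KG by auto
  have \<psi>0: "\<psi> 0 = \<one>" using \<psi>(2) [of 0 0] \<psi>G by simp
  have "rcosets K \<subseteq> (\<lambda>a. K #> a) ` carrier G" by (auto simp: RCOSETS_def)
  from finite_subset_image [OF finK this]
  obtain T0 where T0: "T0 \<subseteq> carrier G" "finite T0" "rcosets K = (\<lambda>a. K #> a) ` T0"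
    by (elim exE conjE)
  define T where "T = insert \<one> T0"
  have finT: "finite T" and TG: "T \<subseteq> carrier G" using T0 by (auto simp: T_def)
  have rep: "\<exists>i. \<exists>t\<in>T. x = \<psi> i \<otimes> t" if "x \<in> carrier G" for x
  proof -
    have "x \<in> \<Union>(rcosets K)" using rcosets_part_G [OF K] that by simp
    then obtain t where "t \<in> T0" "x \<in> K #> t" using T0 by auto
    then obtain k where "k \<in> K" "x = k \<otimes> t" by (auto simp: r_coset_def)
    moreover obtain i where "k = \<psi> i" using \<psi>(1) \<open>k \<in> K\<close> by (auto simp: bij_betw_def)
    ultimately show ?thesis using \<open>t \<in> T0\<close> by (auto simp: T_def)
  qed
  then obtain \<nu> \<tau> where \<nu>: "\<And>x. x \<in> carrier G \<Longrightarrow> \<tau> x \<in> T \<and> x = \<psi> (\<nu> x) \<otimes> \<tau> x"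
    by metis
  define N where "N = nat (\<Sum>p\<in>T \<times> S. \<bar>\<nu> (fst p \<otimes> snd p)\<bar>)"
  have N: "\<bar>\<nu> (t \<otimes> s)\<bar> \<le> int N" if "t \<in> T" "s \<in> S" for t s
  proof -
    have "\<bar>\<nu> (fst (t, s) \<otimes> snd (t, s))\<bar> \<le> (\<Sum>p\<in>T \<times> S. \<bar>\<nu> (fst p \<otimes> snd p)\<bar>)"
      by (rule member_le_sum [where f = "\<lambda>p. \<bar>\<nu> (fst p \<otimes> snd p)\<bar>"])
         (use that finT finS in simp_all)
    then show ?thesis by (simp add: N_def)
  qed
  have word: "\<exists>i t. t \<in> T \<and> \<bar>i\<bar> \<le> int (N * length w) \<and> word_prod G w = \<psi> i \<otimes> t"
    if "set w \<subseteq> S" for w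
    using that
  proof (induction w rule: rev_induct)
    case Nil
    show ?case by (rule exI [of _ 0], rule exI [of _ \<one>]) (simp add: \<psi>0 T_def)
  next
    case (snoc s w)
    then obtain i t where it: "t \<in> T" "\<bar>i\<bar> \<le> int (N * length w)" "word_prod G w = \<psi> i \<otimes> t" by auto
    have s: "s \<in> S" "s \<in> carrier G" and tG: "t \<in> carrier G" using snoc.prems SG it TG by auto
    have sw: "set w \<subseteq> carrier G" using snoc.prems SG by auto
    define j t' where "j = \<nu> (t \<otimes> s)" and "t' = \<tau> (t \<otimes> s)"
    have j: "t' \<in> T" "t \<otimes> s = \<psi> j \<otimes> t'" using \<nu> [of "t \<otimes> s"] s tG by (auto simp: j_def t'_def)
    then have t'G: "t' \<in> carrier G" using TG by auto
    have "word_prod G (w @ [s]) = \<psi> i \<otimes> t \<otimes> s" using sw s it by (simp add: word_prod_append)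
    also have "\<dots> = \<psi> i \<otimes> (t \<otimes> s)" using tG s \<psi>G by (simp add: m_assoc)
    also have "\<dots> = \<psi> (i + j) \<otimes> t'" using j t'G \<psi>G by (simp add: \<psi>(2) m_assoc)
    finally have "word_prod G (w @ [s]) = \<psi> (i + j) \<otimes> t'" .
    moreover have "\<bar>i + j\<bar> \<le> int (N * length (w @ [s]))"
      using it(2) N [OF it(1) s(1)] by (simp add: j_def algebra_simps)
    ultimately show ?case using j(1) by blast
  qed
  have ball: "card (word_ball G S r) \<le> (2 * N * r + 1) * card T" for r
  proof -
    have "word_ball G S r \<subseteq> (\<lambda>(i, t). \<psi> i \<otimes> t) ` ({- int (N * r)..int (N * r)} \<times> T)"
    proof
      fix x assume x: "x \<in> word_ball G S r"
      then have xG: "x \<in> carrier G" and xr: "word_dist G S x \<one> \<le> r" by (auto simp: word_ball_def)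
      obtain w where w: "set w \<subseteq> S" "length w = word_dist G S x \<one>" "word_prod G w = x"
        using word_dist_attained [OF S xG] .
      obtain i t where it: "t \<in> T" "\<bar>i\<bar> \<le> int (N * length w)" "x = \<psi> i \<otimes> t"
        using word [OF w(1)] w(3) by auto
      have "N * length w \<le> N * r" using w(2) xr by (intro mult_le_mono2) simp
      then have "int (N * length w) \<le> int (N * r)" by (simp only: of_nat_le_iff)
      then have "i \<in> {- int (N * r)..int (N * r)}" using it(2) by (simp only: atLeastAtMost_iff abs_le_iff) linarith
      then show "x \<in> (\<lambda>(i, t). \<psi> i \<otimes> t) ` ({- int (N * r)..int (N * r)} \<times> T)"
        using it by (intro image_eqI [of _ _ "(i, t)"]) (simp_all only: mem_Times_iff prod.case fst_conv snd_conv)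
    qed
    then have "card (word_ball G S r) \<le> card ({- int (N * r)..int (N * r)} \<times> T)"
      using finT by (intro surj_card_le) auto
    also have "\<dots> = (2 * N * r + 1) * card T"
      by (simp add: card_cartesian_product nat_add_distrib nat_mult_distrib)
    finally show ?thesis .
  qed
  show thesis
  proof (rule that)
    show "(2 * real N + 1) * real (card T) > 0"
      using finT by (simp add: T_def card_gt_0_iff add_nonneg_pos)
    have "real (card (word_ball G S r)) \<le> (2 * real N + 1) * real (card T) * real r"
      if r: "r \<ge> 1" for r
    proof -
    have "real (card (word_ball G S r)) \<le> real ((2 * N * r + 1) * card T)"
      using ball [of r] by (simp only: of_nat_le_iff)
    also have "\<dots> \<le> (2 * real N + 1) * real (card T) * real r"
    proof -
      have "(2 * real N * real r + 1) * real (card T) \<le> (2 * real N * real r + real r) * real (card T)"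
        using r by (intro mult_right_mono) auto
      then show ?thesis by (simp add: algebra_simps)
    qed
    finally show ?thesis .
    qed
    then show "\<forall>r\<ge>1. real (card (word_ball G S r)) \<le> (2 * real N + 1) * real (card T) * real r"
      by blast
  qed
qed

text \<open>If the group is not virtually infinite cyclic, then counting normal forms gives more than
  \<open>r\<^sup>2 / 2\<close> elements in a ball of radius \<open>r\<close>.\<close>

lemma (in group) linear_growth_iff_virtually_Z:
  assumes fg: "finitely_generated G" and inf: "infinite (carrier G)"
  shows "linear_growth G \<longleftrightarrow> virtually_Z G"
proof
  assume "linear_growth G"
  then obtain S and c C :: real where S: "sym_gen_set G S" and C: "\<forall>r\<ge>1. c * real r \<le> real (card (word_ball G S r)) \<and>
                   real (card (word_ball G S r)) \<le> C * real r"
    unfolding linear_growth_def by blast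
  show "virtually_Z G"
  proof (rule ccontr)
    assume not: "\<not> virtually_Z G"
    obtain L where L: "L \<subseteq> lists S" "inj_on (word_prod G) L"
      and "\<forall>n. 1 \<le> card {w \<in> L. length w = n}"
      and "\<not> virtually_Z G \<longrightarrow> (\<forall>n. n + 1 \<le> card {w \<in> L. length w = n})"
      using normal_form_growth [OF S inf] .
    with not have cardL: "n + 1 \<le> card {w \<in> L. length w = n}" for n by blast
    obtain r :: nat where r: "real r > 2 * C" "r \<ge> 1"
      using reals_Archimedean2 [of "max 1 (2 * C)"] by fastforce
    have "real r * real r / 2 \<le> (\<Sum>n\<le>r. real n + 1)"
      by (induction r) (auto simp: field_simps)
    also have "\<dots> \<le> real (\<Sum>n\<le>r. card {w \<in> L. length w = n})"
    proof -
      have "real n + 1 \<le> real (card {w \<in> L. length w = n})" for n using cardL [of n] by linarith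
      then show ?thesis unfolding of_nat_sum by (rule sum_mono)
    qed
    also have "\<dots> \<le> C * real r"
      using card_word_ball_ge [OF S L, of r] C [rule_format, OF r(2)] by linarith
    finally have "real r / 2 \<le> C" using r(2) by (simp add: field_simps)
    with r(1) show False by simp
  qed
next
  assume vz: "virtually_Z G"
  obtain S where S: "sym_gen_set G S" using sym_gen_set_without_one [OF fg inf] .
  obtain L where L: "L \<subseteq> lists S" "inj_on (word_prod G) L"
      and cardL: "\<forall>n. 1 \<le> card {w \<in> L. length w = n}"
      and "\<not> virtually_Z G \<longrightarrow> (\<forall>n. n + 1 \<le> card {w \<in> L. length w = n})"
    using normal_form_growth [OF S inf] .
  obtain C :: real where C: "C > 0" "\<forall>r\<ge>1. real (card (word_ball G S r)) \<le> C * real r"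
    using virtually_Z_word_ball_le [OF S vz] .
  have "1 * real r \<le> real (card (word_ball G S r))" for r
  proof -
    have "(\<Sum>n\<le>r. 1) \<le> (\<Sum>n\<le>r. card {w \<in> L. length w = n})" using cardL by (intro sum_mono) auto
    then show ?thesis using card_word_ball_ge [OF S L, of r] by simp
  qed
  then have "\<forall>r\<ge>1. 1 * real r \<le> real (card (word_ball G S r)) \<and> real (card (word_ball G S r)) \<le> C * real r"
    using C(2) by blast
  then have "\<exists>c C::real. c > 0 \<and> C > 0 \<and> (\<forall>r\<ge>1. c * real r \<le> real (card (word_ball G S r)) \<and>
                   real (card (word_ball G S r)) \<le> C * real r)"
    using C(1) zero_less_one by blast
  with S show "linear_growth G"
    unfolding linear_growth_def by blast
qed

section \<open>Decay of the return probabilities\<close>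

lemma walk_0 [simp]: "walk G S 0 = return_pmf \<one>\<^bsub>G\<^esub>"
  by (simp add: walk_def)

lemma walk_Suc:
  "walk G S (Suc n) = bind_pmf (pmf_of_set S) (\<lambda>s. map_pmf (\<lambda>x. s \<otimes>\<^bsub>G\<^esub> x) (walk G S n))"
  by (simp add: walk_def map_bind_pmf map_pmf_def bind_assoc_pmf bind_return_pmf)

lemma set_walk:
  assumes "sym_gen_set G S"
  shows "set_pmf (walk G S n) = word_prod G ` {w. set w \<subseteq> S \<and> length w = n}"
proof -
  have "{w \<in> lists S. length w = n} = {w. set w \<subseteq> S \<and> length w = n}"
    by (auto simp: in_lists_conv_set)
  then show ?thesis
    using assms by (simp add: walk_def set_replicate_pmf sym_gen_set_def)
qed

lemma finite_set_walk: "sym_gen_set G S \<Longrightarrow> finite (set_pmf (walk G S n))"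
  using finite_lists_length_eq [of S n] by (simp add: set_walk) (simp add: sym_gen_set_def)

lemma integrable_count_space_finite_support:
  fixes F :: "'a \<Rightarrow> real"
  assumes "finite {x \<in> B. F x \<noteq> 0}"
  shows "integrable (count_space B) F"
proof -
  have "Infinite_Set_Sum.abs_summable_on F {x \<in> B. F x \<noteq> 0}" using assms by simp
  also have "?this \<longleftrightarrow> Infinite_Set_Sum.abs_summable_on F B" by (rule abs_summable_on_cong_neutral) auto
  finally show ?thesis by (simp add: abs_summable_on_def)
qed

lemma integral_count_space_eq_sum:
  fixes F :: "'a \<Rightarrow> real"
  assumes "finite A" "A \<subseteq> B" "\<And>x. x \<in> B \<Longrightarrow> x \<notin> A \<Longrightarrow> F x = 0"
  shows "integral\<^sup>L (count_space B) F = sum F A"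
proof -
  have fin: "finite {x \<in> B. F x \<noteq> 0}" by (rule finite_subset [OF _ assms(1)]) (use assms(3) in auto)
  then have "integral\<^sup>L (count_space B) F = (\<Sum>x | x \<in> B \<and> F x \<noteq> 0. F x)"
    by (rule lebesgue_integral_count_space_finite_support)
  also have "\<dots> = sum F A"
    by (rule sum.mono_neutral_left) (use assms in auto)
  finally show ?thesis .
qed

context group
begin

text \<open>Sums over the group are integrals for the counting measure, so that translation invariance
  holds without keeping track of supports; all integrands have finite support.\<close>

abbreviation gsum :: "('a \<Rightarrow> real) \<Rightarrow> real" where
  "gsum F \<equiv> integral\<^sup>L (count_space (carrier G)) F"

text \<open>The probability that two independent walks are at the same place at time \<open>n\<close>. As \<open>S\<close> is
  symmetric, it is also the probability of a return to the identity at time \<open>2n\<close>.\<close>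

definition collision_prob :: "'a set \<Rightarrow> nat \<Rightarrow> real" where
  "collision_prob S n = gsum (\<lambda>x. (pmf (walk G S n) x)\<^sup>2)"

lemma set_walk_subset: "sym_gen_set G S \<Longrightarrow> set_pmf (walk G S n) \<subseteq> carrier G"
  by (auto simp: set_walk sym_gen_set_def)

lemma bij_betw_left_mult: "g \<in> carrier G \<Longrightarrow> bij_betw (\<lambda>x. g \<otimes> x) (carrier G) (carrier G)"
  by (rule bij_betw_byWitness [where f' = "\<lambda>x. inv g \<otimes> x"]) (auto simp: m_assoc [symmetric])

lemma gsum_left_mult:
  "g \<in> carrier G \<Longrightarrow> gsum (\<lambda>x. F (g \<otimes> x)) = gsum (\<lambda>x. F x)"
  by (rule integral_bij_count_space [OF bij_betw_left_mult])

lemma pmf_map_left_mult: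
  assumes "set_pmf p \<subseteq> carrier G" "g \<in> carrier G" "x \<in> carrier G"
  shows "pmf (map_pmf (\<lambda>y. g \<otimes> y) p) x = pmf p (inv g \<otimes> x)"
proof -
  have "(\<lambda>y. g \<otimes> y) -` {x} \<inter> set_pmf p = {inv g \<otimes> x} \<inter> set_pmf p"
    using assms by (auto simp: m_assoc [symmetric])
  then have "measure p ((\<lambda>y. g \<otimes> y) -` {x}) = measure p {inv g \<otimes> x}"
    by (metis measure_Int_set_pmf)
  then show ?thesis by (simp add: pmf_map measure_pmf_single)
qed

text \<open>The generators are multiplied on the left, so the laws of the walk are related by left
  translations; symmetry of \<open>S\<close> replaces \<open>s\<^bsup>-1\<^esup>\<close> by \<open>s\<close>.\<close>

lemma pmf_walk_Suc:
  assumes S: "sym_gen_set G S" and x: "x \<in> carrier G"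
  shows "pmf (walk G S (Suc n)) x = (\<Sum>s\<in>S. pmf (walk G S n) (s \<otimes> x)) / real (card S)"
proof -
  have finS: "finite S" "S \<noteq> {}" and SG: "S \<subseteq> carrier G" and invS: "\<And>s. s \<in> S \<Longrightarrow> inv s \<in> S"
    using S by (auto simp: sym_gen_set_def)
  have "pmf (walk G S (Suc n)) x = (\<Sum>s\<in>S. pmf (map_pmf (\<lambda>y. s \<otimes> y) (walk G S n)) x) / real (card S)"
    using finS by (simp add: walk_Suc pmf_bind integral_pmf_of_set)
  also have "(\<Sum>s\<in>S. pmf (map_pmf (\<lambda>y. s \<otimes> y) (walk G S n)) x) = (\<Sum>s\<in>S. pmf (walk G S n) (inv s \<otimes> x))"
    by (rule sum.cong [OF refl], rule pmf_map_left_mult) (use set_walk_subset [OF S] SG x in auto)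
  also have "\<dots> = (\<Sum>s\<in>S. pmf (walk G S n) (s \<otimes> x))"
    by (rule sum.reindex_bij_witness [where i = "\<lambda>s. inv s" and j = "\<lambda>s. inv s"])
       (use invS SG in auto)
  finally show ?thesis .
qed

lemma walk_add:
  assumes S: "sym_gen_set G S"
  shows "walk G S (m + n) = bind_pmf (walk G S m) (\<lambda>x. map_pmf (\<lambda>y. x \<otimes> y) (walk G S n))"
proof (induction m)
  case 0
  have "map_pmf (\<lambda>y. \<one> \<otimes> y) (walk G S n) = map_pmf (\<lambda>y. y) (walk G S n)"
    by (rule map_pmf_cong) (use set_walk_subset [OF S, of n] in auto)
  then show ?case by (simp add: bind_return_pmf)
next
  case (Suc m)
  have finS: "finite S" "S \<noteq> {}" and SG: "S \<subseteq> carrier G"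
    using S by (auto simp: sym_gen_set_def)
  have "walk G S (Suc m + n) = bind_pmf (pmf_of_set S) (\<lambda>s. bind_pmf (walk G S m)
           (\<lambda>x. map_pmf (\<lambda>y. s \<otimes> (x \<otimes> y)) (walk G S n)))"
    by (simp add: walk_Suc Suc.IH map_bind_pmf pmf.map_comp o_def)
  also have "\<dots> = bind_pmf (pmf_of_set S) (\<lambda>s. bind_pmf (walk G S m)
           (\<lambda>x. map_pmf (\<lambda>y. (s \<otimes> x) \<otimes> y) (walk G S n)))"
    by (intro bind_pmf_cong map_pmf_cong refl)
       (use set_walk_subset [OF S, of n] set_walk_subset [OF S, of m] SG finS in \<open>auto simp: m_assoc subset_iff\<close>)
  also have "\<dots> = bind_pmf (walk G S (Suc m)) (\<lambda>x. map_pmf (\<lambda>y. x \<otimes> y) (walk G S n))"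
    by (simp add: walk_Suc bind_assoc_pmf bind_map_pmf)
  finally show ?case .
qed

lemma finite_translated_support:
  assumes "sym_gen_set G S" "g \<in> carrier G"
  shows "finite {x \<in> carrier G. pmf (walk G S n) (g \<otimes> x) \<noteq> 0}"
proof (rule finite_subset)
  show "finite ((\<lambda>y. inv g \<otimes> y) ` set_pmf (walk G S n))"
    using finite_set_walk [OF assms(1)] by simp
  show "{x \<in> carrier G. pmf (walk G S n) (g \<otimes> x) \<noteq> 0} \<subseteq> (\<lambda>y. inv g \<otimes> y) ` set_pmf (walk G S n)"
  proof
    fix x assume x: "x \<in> {x \<in> carrier G. pmf (walk G S n) (g \<otimes> x) \<noteq> 0}"
    then have "x = inv g \<otimes> (g \<otimes> x)" "g \<otimes> x \<in> set_pmf (walk G S n)"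
      using assms(2) by (auto simp: m_assoc [symmetric] set_pmf_iff)
    then show "x \<in> (\<lambda>y. inv g \<otimes> y) ` set_pmf (walk G S n)" by blast
  qed
qed

lemma integrable_translated:
  assumes S: "sym_gen_set G S" and g: "g \<in> carrier G" and h: "h \<in> carrier G"
    and F: "F 0 0 = (0::real)"
  shows "integrable (count_space (carrier G))
           (\<lambda>x. F (pmf (walk G S m) (g \<otimes> x)) (pmf (walk G S n) (h \<otimes> x)))"
proof (rule integrable_count_space_finite_support, rule finite_subset)
  show "finite ({x \<in> carrier G. pmf (walk G S m) (g \<otimes> x) \<noteq> 0} \<union>
                {x \<in> carrier G. pmf (walk G S n) (h \<otimes> x) \<noteq> 0})"
    using finite_translated_support [OF S] g h by simp
  show "{x \<in> carrier G. F (pmf (walk G S m) (g \<otimes> x)) (pmf (walk G S n) (h \<otimes> x)) \<noteq> 0} \<subseteq>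
     {x \<in> carrier G. pmf (walk G S m) (g \<otimes> x) \<noteq> 0} \<union> {x \<in> carrier G. pmf (walk G S n) (h \<otimes> x) \<noteq> 0}"
    using F by auto
qed

lemma integrable_walk:
  assumes S: "sym_gen_set G S" and F: "F 0 = (0::real)"
  shows "integrable (count_space (carrier G)) (\<lambda>x. F (pmf (walk G S n) x))"
proof -
  have "integrable (count_space (carrier G)) (\<lambda>x. F (pmf (walk G S n) (\<one> \<otimes> x)))"
    using integrable_translated [OF S one_closed one_closed, of "\<lambda>a b. F a" n n] F by simp
  also have "?this \<longleftrightarrow> ?thesis" by (rule Bochner_Integration.integrable_cong) simp_all
  finally show ?thesis .
qed

lemma collision_prob_translate:
  assumes "g \<in> carrier G"
  shows "gsum (\<lambda>x. (pmf (walk G S n) (g \<otimes> x))\<^sup>2) = collision_prob S n"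
  unfolding collision_prob_def by (rule gsum_left_mult [OF assms])

lemma gsum_pmf_walk:
  assumes S: "sym_gen_set G S"
  shows "gsum (\<lambda>x. pmf (walk G S n) x) = 1"
proof -
  have "gsum (\<lambda>x. pmf (walk G S n) x) = (\<Sum>x\<in>set_pmf (walk G S n). pmf (walk G S n) x)"
    by (rule integral_count_space_eq_sum) (use finite_set_walk [OF S] set_walk_subset [OF S, of n] in \<open>auto simp: set_pmf_iff\<close>)
  also have "\<dots> = 1" using finite_set_walk [OF S] by (intro sum_pmf_eq_1) auto
  finally show ?thesis .
qed

lemma collision_prob_pos:
  assumes S: "sym_gen_set G S"
  shows "collision_prob S n > 0"
proof -
  have "collision_prob S n = (\<Sum>x\<in>set_pmf (walk G S n). (pmf (walk G S n) x)\<^sup>2)"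
    unfolding collision_prob_def
    by (rule integral_count_space_eq_sum) (use finite_set_walk [OF S] set_walk_subset [OF S, of n] in \<open>auto simp: set_pmf_iff\<close>)
  also have "\<dots> > 0"
    using finite_set_walk [OF S] by (intro sum_pos) (auto simp: set_pmf_not_empty set_pmf_iff)
  finally show ?thesis .
qed

lemma collision_prob_le_1:
  assumes S: "sym_gen_set G S"
  shows "collision_prob S n \<le> 1"
proof -
  have "collision_prob S n = (\<Sum>x\<in>set_pmf (walk G S n). (pmf (walk G S n) x)\<^sup>2)"
    unfolding collision_prob_def
    by (rule integral_count_space_eq_sum) (use finite_set_walk [OF S] set_walk_subset [OF S, of n] in \<open>auto simp: set_pmf_iff\<close>)
  also have "\<dots> \<le> (\<Sum>x\<in>set_pmf (walk G S n). pmf (walk G S n) x)"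
    by (intro sum_mono) (simp add: power2_eq_square mult_left_le pmf_le_1)
  also have "\<dots> = 1" using finite_set_walk [OF S] by (intro sum_pmf_eq_1) auto
  finally show ?thesis .
qed

end

lemma square_diff_le_variance:
  fixes a :: "'a \<Rightarrow> real"
  assumes "finite S" "s \<in> S" "t \<in> S"
  shows "(a s - a t)\<^sup>2 \<le> 2 * real (card S) ^ 2 * ((\<Sum>i\<in>S. (a i)\<^sup>2) / real (card S) - ((\<Sum>i\<in>S. a i) / real (card S))\<^sup>2)"
proof -
  define N where "N = real (card S)"
  have N: "N > 0" using assms by (auto simp: N_def card_gt_0_iff)
  have "(a s - a t)\<^sup>2 \<le> (\<Sum>j\<in>S. (a s - a j)\<^sup>2)"
    using assms by (intro member_le_sum [where f = "\<lambda>j. (a s - a j)\<^sup>2"]) auto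
  also have "\<dots> \<le> (\<Sum>i\<in>S. \<Sum>j\<in>S. (a i - a j)\<^sup>2)"
    using assms by (intro member_le_sum [where f = "\<lambda>i. \<Sum>j\<in>S. (a i - a j)\<^sup>2"]) (auto intro: sum_nonneg)
  also have "\<dots> = 2 * N * (\<Sum>i\<in>S. (a i)\<^sup>2) - 2 * (\<Sum>i\<in>S. a i)\<^sup>2"
  proof -
    define A1 A2 where "A1 = (\<Sum>i\<in>S. a i)" and "A2 = (\<Sum>i\<in>S. (a i)\<^sup>2)"
    have "(\<Sum>j\<in>S. (a i - a j)\<^sup>2) = N * (a i)\<^sup>2 + A2 - 2 * A1 * a i" for i
    proof -
      have "(\<Sum>j\<in>S. (a i - a j)\<^sup>2) = (\<Sum>j\<in>S. (a i)\<^sup>2 + (a j)\<^sup>2 - 2 * a i * a j)"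
        by (simp add: power2_diff)
      also have "\<dots> = N * (a i)\<^sup>2 + A2 - 2 * a i * A1"
        unfolding sum.distrib sum_subtractf sum_distrib_left [symmetric] A1_def A2_def by (simp add: N_def)
      finally show ?thesis by simp
    qed
    then have "(\<Sum>i\<in>S. \<Sum>j\<in>S. (a i - a j)\<^sup>2) = (\<Sum>i\<in>S. N * (a i)\<^sup>2 + A2 - 2 * A1 * a i)" by simp
    also have "\<dots> = N * A2 + N * A2 - 2 * A1 * A1"
      unfolding sum.distrib sum_subtractf sum_distrib_left [symmetric] A1_def A2_def by (simp add: N_def)
    finally show ?thesis by (simp add: A1_def A2_def power2_eq_square)
  qed
  also have "\<dots> = 2 * N ^ 2 * ((\<Sum>i\<in>S. (a i)\<^sup>2) / N - ((\<Sum>i\<in>S. a i) / N)\<^sup>2)"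
    using N by (simp add: field_simps power2_eq_square)
  finally show ?thesis by (simp add: N_def)
qed

context group
begin

text \<open>The law at time \<open>n + 1\<close> is the average over \<open>s \<in> S\<close> of the translates by \<open>s\<close> of the law at time
  \<open>n\<close>. Hence the loss in \<open>collision_prob\<close> is the sum over the group of the variances of these
  translates, and it controls the distance between any two of them.\<close>

lemma two_step_energy_le:
  assumes S: "sym_gen_set G S" and s: "s \<in> S" and t: "t \<in> S"
  shows "gsum (\<lambda>x. (pmf (walk G S n) (s \<otimes> x) - pmf (walk G S n) (t \<otimes> x))\<^sup>2)
           \<le> 2 * real (card S) ^ 2 * (collision_prob S n - collision_prob S (Suc n))"
proof -
  have finS: "finite S" "S \<noteq> {}" and SG: "S \<subseteq> carrier G"
    using S by (auto simp: sym_gen_set_def)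
  define N where "N = real (card S)"
  have N: "N > 0" using finS by (simp add: N_def card_gt_0_iff)
  let ?p = "\<lambda>x. pmf (walk G S n) x" and ?q = "\<lambda>x. pmf (walk G S (Suc n)) x"
  have sum_sq: "integrable (count_space (carrier G)) (\<lambda>x. (?p (i \<otimes> x))\<^sup>2)" if "i \<in> S" for i
    using that SG integrable_translated [OF S, of i i "\<lambda>a b. a\<^sup>2" n n] by auto
  have sum_q: "integrable (count_space (carrier G)) (\<lambda>x. (?q x)\<^sup>2)"
    using integrable_walk [OF S, of "\<lambda>a. a\<^sup>2"] by simp
  have "gsum (\<lambda>x. (?p (s \<otimes> x) - ?p (t \<otimes> x))\<^sup>2)
       \<le> gsum (\<lambda>x. 2 * N ^ 2 * ((\<Sum>i\<in>S. (?p (i \<otimes> x))\<^sup>2) / N - (?q x)\<^sup>2))"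
  proof (rule integral_mono)
    show "integrable (count_space (carrier G)) (\<lambda>x. (?p (s \<otimes> x) - ?p (t \<otimes> x))\<^sup>2)"
      using s t SG integrable_translated [OF S, of s t "\<lambda>a b. (a - b)\<^sup>2" n n] by auto
    show "integrable (count_space (carrier G)) (\<lambda>x. 2 * N ^ 2 * ((\<Sum>i\<in>S. (?p (i \<otimes> x))\<^sup>2) / N - (?q x)\<^sup>2))"
      using sum_sq sum_q by simp
    fix x assume "x \<in> space (count_space (carrier G))"
    then show "(?p (s \<otimes> x) - ?p (t \<otimes> x))\<^sup>2 \<le> 2 * N ^ 2 * ((\<Sum>i\<in>S. (?p (i \<otimes> x))\<^sup>2) / N - (?q x)\<^sup>2)"
      using square_diff_le_variance [OF finS(1) s t, of "\<lambda>i. ?p (i \<otimes> x)"]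
      by (simp add: pmf_walk_Suc [OF S] N_def)
  qed
  also have "\<dots> = 2 * N ^ 2 * ((\<Sum>i\<in>S. gsum (\<lambda>x. (?p (i \<otimes> x))\<^sup>2)) / N - gsum (\<lambda>x. (?q x)\<^sup>2))"
    using sum_sq sum_q by simp
  also have "gsum (\<lambda>x. (?q x)\<^sup>2) = collision_prob S (Suc n)"
    by (simp add: collision_prob_def)
  also have "(\<Sum>i\<in>S. gsum (\<lambda>x. (?p (i \<otimes> x))\<^sup>2)) = (\<Sum>i\<in>S. collision_prob S n)"
    by (rule sum.cong) (use SG in \<open>auto simp: collision_prob_translate\<close>)
  also have "2 * N ^ 2 * ((\<Sum>i\<in>S. collision_prob S n) / N - collision_prob S (Suc n))
      = 2 * N ^ 2 * (collision_prob S n - collision_prob S (Suc n))"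
    using N by (simp add: N_def)
  finally show ?thesis by (simp add: N_def)
qed

text \<open>Translation by a product of \<open>k\<close> pairs of letters is reached in \<open>k\<close> steps of the previous kind;
  the triangle inequality in \<open>\<ell>\<^sup>2\<close> gives the factor \<open>k\<^sup>2\<close>. Pairs are used because in
  \<open>two_step_energy_le\<close> two translates are compared with each other; if \<open>\<one> \<notin> S\<close>,
  translation by a single letter may not be of this form.\<close>

lemma translation_energy_le:
  assumes S: "sym_gen_set G S" and w: "set w \<subseteq> S" "length w = 2 * k"
  shows "gsum (\<lambda>x. (pmf (walk G S n) x - pmf (walk G S n) (word_prod G w \<otimes> x))\<^sup>2)
           \<le> real k ^ 2 * (2 * real (card S) ^ 2 * (collision_prob S n - collision_prob S (Suc n)))"
  using w
proof (induction k arbitrary: w)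
  case 0
  then have "gsum (\<lambda>x. (pmf (walk G S n) x - pmf (walk G S n) (word_prod G w \<otimes> x))\<^sup>2) = gsum (\<lambda>x. 0)"
    by (intro Bochner_Integration.integral_cong) auto
  then show ?case by simp
next
  case (Suc k)
  have SG: "S \<subseteq> carrier G" using S by (simp add: sym_gen_set_def)
  obtain s t v where w_eq: "w = s # t # v" and v: "length v = 2 * k"
    using Suc.prems(2) by (auto simp: length_Suc_conv)
  have st: "s \<in> S" "t \<in> S" "set v \<subseteq> S" using Suc.prems(1) by (auto simp: w_eq)
  have stG: "s \<in> carrier G" "t \<in> carrier G" using st SG by auto
  define h where "h = word_prod G v"
  have hG: "h \<in> carrier G" using st SG by (auto simp: h_def)
  define D where "D = 2 * real (card S) ^ 2 * (collision_prob S n - collision_prob S (Suc n))"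
  let ?p = "\<lambda>x. pmf (walk G S n) x"
  have gh: "word_prod G w = s \<otimes> t \<otimes> h" using stG hG by (simp add: w_eq h_def m_assoc)
  have IH: "gsum (\<lambda>x. (?p x - ?p (h \<otimes> x))\<^sup>2) \<le> real k ^ 2 * D"
    using Suc.IH [OF st(3) v] by (simp add: h_def D_def)
  have tinv: "inv t \<in> S" using S st by (simp add: sym_gen_set_def)
  have two: "gsum (\<lambda>x. (?p (h \<otimes> x) - ?p (word_prod G w \<otimes> x))\<^sup>2) \<le> D"
  proof -
    have "gsum (\<lambda>x. (?p (h \<otimes> x) - ?p (word_prod G w \<otimes> x))\<^sup>2)
        = gsum (\<lambda>x. (?p (h \<otimes> x) - ?p (s \<otimes> t \<otimes> (h \<otimes> x)))\<^sup>2)"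
      by (intro Bochner_Integration.integral_cong) (use stG hG in \<open>auto simp: gh m_assoc\<close>)
    also have "\<dots> = gsum (\<lambda>x. (?p x - ?p (s \<otimes> t \<otimes> x))\<^sup>2)"
      by (rule gsum_left_mult [OF hG, of "\<lambda>x. (?p x - ?p (s \<otimes> t \<otimes> x))\<^sup>2"])
    also have "\<dots> = gsum (\<lambda>x. (?p (inv t \<otimes> x) - ?p (s \<otimes> t \<otimes> (inv t \<otimes> x)))\<^sup>2)"
      using stG by (intro gsum_left_mult [of "inv t" "\<lambda>x. (?p x - ?p (s \<otimes> t \<otimes> x))\<^sup>2", symmetric]) simp
    also have "\<dots> = gsum (\<lambda>x. (?p (inv t \<otimes> x) - ?p (s \<otimes> x))\<^sup>2)"
    proof (intro Bochner_Integration.integral_cong refl)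
      fix x assume "x \<in> space (count_space (carrier G))"
      then have x: "x \<in> carrier G" by simp
      have "t \<otimes> (inv t \<otimes> x) = x" using stG x by (simp add: m_assoc [symmetric])
      then have "s \<otimes> t \<otimes> (inv t \<otimes> x) = s \<otimes> x" using stG x by (simp add: m_assoc)
      then show "(?p (inv t \<otimes> x) - ?p (s \<otimes> t \<otimes> (inv t \<otimes> x)))\<^sup>2 = (?p (inv t \<otimes> x) - ?p (s \<otimes> x))\<^sup>2"
        by simp
    qed
    also have "\<dots> \<le> D" unfolding D_def by (rule two_step_energy_le [OF S tinv st(1)])
    finally show ?thesis .
  qed
  have gG: "word_prod G w \<in> carrier G" using stG hG by (simp add: gh)
  have int1: "integrable (count_space (carrier G)) (\<lambda>x. (?p x - ?p (g \<otimes> x))\<^sup>2)" if "g \<in> carrier G" for g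
  proof -
    have "integrable (count_space (carrier G)) (\<lambda>x. (?p (\<one> \<otimes> x) - ?p (g \<otimes> x))\<^sup>2)"
      using integrable_translated [OF S one_closed that, of "\<lambda>a b. (a - b)\<^sup>2" n n] by simp
    also have "?this \<longleftrightarrow> ?thesis" by (rule Bochner_Integration.integrable_cong) simp_all
    finally show ?thesis .
  qed
  have int2: "integrable (count_space (carrier G)) (\<lambda>x. (?p (h \<otimes> x) - ?p (word_prod G w \<otimes> x))\<^sup>2)"
    using integrable_translated [OF S hG gG, of "\<lambda>a b. (a - b)\<^sup>2" n n] by simp
  have "gsum (\<lambda>x. (?p x - ?p (word_prod G w \<otimes> x))\<^sup>2) \<le> real (Suc k) ^ 2 * D"
  proof (cases "k = 0")
    case True
    then have "h = \<one>" using v by (simp add: h_def)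
    then have "gsum (\<lambda>x. (?p x - ?p (word_prod G w \<otimes> x))\<^sup>2) = gsum (\<lambda>x. (?p (h \<otimes> x) - ?p (word_prod G w \<otimes> x))\<^sup>2)"
      by (intro Bochner_Integration.integral_cong) auto
    then show ?thesis using two True by simp
  next
    case False
    then have k: "real k > 0" by simp
    \<comment> \<open>The weights \<open>1 + 1 / k\<close> and \<open>1 + k\<close> turn \<open>k\<^sup>2\<close> and \<open>1\<close> into exactly \<open>(k + 1)\<^sup>2\<close>.\<close>
    have young: "(a - c)\<^sup>2 \<le> (1 + 1 / real k) * (a - b)\<^sup>2 + (1 + real k) * (b - c)\<^sup>2" for a b c :: real
    proof -
      have "0 \<le> ((a - b) - real k * (b - c))\<^sup>2 / real k" using k by simp
      also have "\<dots> = (1 + 1 / real k) * (a - b)\<^sup>2 + (1 + real k) * (b - c)\<^sup>2 - (a - c)\<^sup>2"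
        using k by (simp add: field_simps power2_eq_square)
      finally show ?thesis by simp
    qed
    have "gsum (\<lambda>x. (?p x - ?p (word_prod G w \<otimes> x))\<^sup>2)
       \<le> gsum (\<lambda>x. (1 + 1 / real k) * (?p x - ?p (h \<otimes> x))\<^sup>2
              + (1 + real k) * (?p (h \<otimes> x) - ?p (word_prod G w \<otimes> x))\<^sup>2)"
      by (rule integral_mono) (use int1 [OF gG] int1 [OF hG] int2 in \<open>auto intro: young\<close>)
    also have "\<dots> = (1 + 1 / real k) * gsum (\<lambda>x. (?p x - ?p (h \<otimes> x))\<^sup>2)
              + (1 + real k) * gsum (\<lambda>x. (?p (h \<otimes> x) - ?p (word_prod G w \<otimes> x))\<^sup>2)"
      using int1 [OF hG] int2 by simp
    also have "\<dots> \<le> (1 + 1 / real k) * (real k ^ 2 * D) + (1 + real k) * D"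
      by (intro add_mono mult_left_mono IH two) auto
    also have "\<dots> = real (Suc k) ^ 2 * D"
      using k by (simp add: field_simps power2_eq_square)
    finally show ?thesis .
  qed
  then show ?case by (simp add: D_def)
qed

lemma collision_prob_Suc_le:
  assumes S: "sym_gen_set G S"
  shows "collision_prob S (Suc n) \<le> collision_prob S n"
proof -
  obtain s where s: "s \<in> S" using S by (auto simp: sym_gen_set_def)
  have "0 \<le> 2 * real (card S) ^ 2 * (collision_prob S n - collision_prob S (Suc n))"
    using two_step_energy_le [OF S s s, of n] by simp
  moreover have "real (card S) > 0" using S by (simp add: sym_gen_set_def card_gt_0_iff)
  ultimately show ?thesis by (simp add: zero_le_mult_iff)
qed

lemma collision_prob_antimono:
  assumes "sym_gen_set G S" "m \<le> n"
  shows "collision_prob S n \<le> collision_prob S m"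
  using lift_Suc_antimono_le [of "collision_prob S"] collision_prob_Suc_le assms by blast

text \<open>For \<open>g \<in> B\<close> the correlation \<open>\<Sum>\<^sub>x p x p (g x)\<close> falls short of \<open>\<Sum>\<^sub>x (p x)\<^sup>2\<close> by at most half the
  squared distance between \<open>p\<close> and its translate. Summed over \<open>B\<close> the correlations are at most \<open>1\<close>,
  because \<open>p\<close> has total mass \<open>1\<close>, so their average is at most \<open>1 / card B\<close>.\<close>

lemma collision_prob_le_ball:
  fixes k :: nat
  assumes S: "sym_gen_set G S"
  defines "B \<equiv> word_prod G ` {w. set w \<subseteq> S \<and> length w = 2 * k}"
  shows "collision_prob S n \<le> 1 / real (card B) +
           real k ^ 2 * real (card S) ^ 2 * (collision_prob S n - collision_prob S (Suc n))"
proof -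
  have finS: "finite S" "S \<noteq> {}" and SG: "S \<subseteq> carrier G"
    using S by (auto simp: sym_gen_set_def)
  let ?p = "\<lambda>x. pmf (walk G S n) x"
  define u where "u = collision_prob S n"
  define E where "E = real k ^ 2 * real (card S) ^ 2 * (collision_prob S n - collision_prob S (Suc n))"
  have finB: "finite B" unfolding B_def using finite_lists_length_eq [OF finS(1)] by simp
  have BG: "B \<subseteq> carrier G" using SG by (auto simp: B_def)
  obtain s where "s \<in> S" using finS by blast
  then have "word_prod G (replicate (2 * k) s) \<in> B" unfolding B_def by (intro imageI) auto
  then have cardB: "real (card B) > 0" using finB by (auto simp: card_gt_0_iff)
  have int_sq: "integrable (count_space (carrier G)) (\<lambda>x. (?p x)\<^sup>2)"
    using integrable_walk [OF S, of "\<lambda>a. a\<^sup>2"] by simp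
  have int_sq': "integrable (count_space (carrier G)) (\<lambda>x. (?p (g \<otimes> x))\<^sup>2)" if "g \<in> carrier G" for g
    using integrable_translated [OF S that that, of "\<lambda>a b. a\<^sup>2" n n] by simp
  have int_pr: "integrable (count_space (carrier G)) (\<lambda>x. ?p x * ?p (g \<otimes> x))" if "g \<in> carrier G" for g
  proof -
    have "integrable (count_space (carrier G)) (\<lambda>x. ?p (\<one> \<otimes> x) * ?p (g \<otimes> x))"
      using integrable_translated [OF S one_closed that, of "\<lambda>a b. a * b" n n] by simp
    also have "?this \<longleftrightarrow> ?thesis" by (rule Bochner_Integration.integrable_cong) simp_all
    finally show ?thesis .
  qed
  have corr: "u - E \<le> gsum (\<lambda>x. ?p x * ?p (g \<otimes> x))" if g: "g \<in> B" for g
  proof -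
    have gG: "g \<in> carrier G" using g BG by auto
    have "gsum (\<lambda>x. (?p x - ?p (g \<otimes> x))\<^sup>2) = gsum (\<lambda>x. (?p x)\<^sup>2 + (?p (g \<otimes> x))\<^sup>2 - 2 * (?p x * ?p (g \<otimes> x)))"
      by (simp add: power2_diff mult.assoc)
    also have "\<dots> = gsum (\<lambda>x. (?p x)\<^sup>2) + gsum (\<lambda>x. (?p (g \<otimes> x))\<^sup>2) - 2 * gsum (\<lambda>x. ?p x * ?p (g \<otimes> x))"
      using int_sq int_sq' [OF gG] int_pr [OF gG] by simp
    also have "\<dots> = 2 * u - 2 * gsum (\<lambda>x. ?p x * ?p (g \<otimes> x))"
      using collision_prob_translate [OF gG, of S n] by (simp add: u_def collision_prob_def)
    finally have "gsum (\<lambda>x. (?p x - ?p (g \<otimes> x))\<^sup>2) = 2 * u - 2 * gsum (\<lambda>x. ?p x * ?p (g \<otimes> x))" .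
    moreover have "gsum (\<lambda>x. (?p x - ?p (g \<otimes> x))\<^sup>2) \<le> 2 * E"
    proof -
      obtain w where w: "set w \<subseteq> S" "length w = 2 * k" "g = word_prod G w" using g by (auto simp: B_def)
      show ?thesis unfolding w(3)
        using translation_energy_le [OF S w(1,2), of n] by (simp add: E_def mult.left_commute)
    qed
    ultimately show ?thesis by linarith
  qed
  have "real (card B) * (u - E) = (\<Sum>g\<in>B. u - E)" by simp
  also have "\<dots> \<le> (\<Sum>g\<in>B. gsum (\<lambda>x. ?p x * ?p (g \<otimes> x)))" by (rule sum_mono) (rule corr)
  also have "\<dots> = gsum (\<lambda>x. \<Sum>g\<in>B. ?p x * ?p (g \<otimes> x))"
    by (rule Bochner_Integration.integral_sum [symmetric]) (use int_pr BG in auto)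
  also have "\<dots> \<le> gsum ?p"
  proof (rule integral_mono)
    show "integrable (count_space (carrier G)) (\<lambda>x. \<Sum>g\<in>B. ?p x * ?p (g \<otimes> x))"
      by (rule Bochner_Integration.integrable_sum) (use int_pr BG in auto)
    show "integrable (count_space (carrier G)) ?p"
      using integrable_walk [OF S, of "\<lambda>a. a"] by simp
    fix x assume "x \<in> space (count_space (carrier G))"
    then have x: "x \<in> carrier G" by simp
    have inj: "inj_on (\<lambda>g. g \<otimes> x) B" 
    proof (rule inj_onI)
      fix g h assume "g \<in> B" "h \<in> B" "g \<otimes> x = h \<otimes> x"
      then show "g = h" using BG x right_cancel [of x g h] by blast
    qed
    have "(\<Sum>g\<in>B. ?p (g \<otimes> x)) = sum ?p ((\<lambda>g. g \<otimes> x) ` B)"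
      using inj by (simp add: sum.reindex)
    also have "\<dots> = measure (walk G S n) ((\<lambda>g. g \<otimes> x) ` B)"
      using finB by (simp add: measure_measure_pmf_finite)
    also have "\<dots> \<le> 1" by simp
    finally have "?p x * (\<Sum>g\<in>B. ?p (g \<otimes> x)) \<le> ?p x" by (simp add: mult_left_le)
    then show "(\<Sum>g\<in>B. ?p x * ?p (g \<otimes> x)) \<le> ?p x" by (simp add: sum_distrib_left)
  qed
  also have "\<dots> = 1" by (rule gsum_pmf_walk [OF S])
  finally have "u - E \<le> 1 / real (card B)" using cardB by (simp add: field_simps)
  then show ?thesis by (simp add: u_def E_def)
qed

text \<open>A normal form of even length is padded to length \<open>2 k\<close> by factors \<open>s s\<^bsup>-1\<^esup>\<close>.\<close>

lemma card_even_words_ge: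
  assumes S: "sym_gen_set G S" and L: "L \<subseteq> lists S" "inj_on (word_prod G) L"
  shows "(\<Sum>j\<le>k. card {w \<in> L. length w = 2 * j})
           \<le> card (word_prod G ` {w. set w \<subseteq> S \<and> length w = 2 * k})"
proof -
  have finS: "finite S" and SG: "S \<subseteq> carrier G" using S by (auto simp: sym_gen_set_def)
  obtain s where s: "s \<in> S" "inv s \<in> S" using S by (auto simp: sym_gen_set_def)
  have finL: "finite {w \<in> L. length w = n}" for n
    using finS L(1) by (rule finite_words_of_length)
  have "card (\<Union>j\<le>k. {w \<in> L. length w = 2 * j}) = (\<Sum>j\<le>k. card {w \<in> L. length w = 2 * j})"
  proof (rule card_UN_disjoint)
    show "\<forall>j\<in>{..k}. finite {w \<in> L. length w = 2 * j}" using finL by blast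
    show "\<forall>i\<in>{..k}. \<forall>j\<in>{..k}. i \<noteq> j \<longrightarrow> {w \<in> L. length w = 2 * i} \<inter> {w \<in> L. length w = 2 * j} = {}"
      by force
  qed simp
  then have "(\<Sum>j\<le>k. card {w \<in> L. length w = 2 * j}) = card (\<Union>j\<le>k. {w \<in> L. length w = 2 * j})"
    by (rule sym)
  also have "\<dots> \<le> card (word_prod G ` {w. set w \<subseteq> S \<and> length w = 2 * k})"
  proof (rule card_inj_on_le)
    show "inj_on (word_prod G) (\<Union>j\<le>k. {w \<in> L. length w = 2 * j})"
      by (rule inj_on_subset [OF L(2)]) auto
    show "finite (word_prod G ` {w. set w \<subseteq> S \<and> length w = 2 * k})"
      using finite_lists_length_eq [OF finS] by simp
    show "word_prod G ` (\<Union>j\<le>k. {w \<in> L. length w = 2 * j}) \<subseteq>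
            word_prod G ` {w. set w \<subseteq> S \<and> length w = 2 * k}"
    proof (rule image_subsetI)
      fix w assume "w \<in> (\<Union>j\<le>k. {w \<in> L. length w = 2 * j})"
      then obtain j where j: "j \<le> k" "w \<in> L" "length w = 2 * j" by auto
      define v where "v = concat (replicate (k - j) [s, inv s])"
      have v: "set v \<subseteq> S" "length v = 2 * (k - j)"
        using s by (auto simp: v_def length_concat sum_list_replicate)
      have w: "set w \<subseteq> S" using j L(1) by auto
      have "word_prod G v = word_prod G [s, inv s] [^] (k - j)"
        unfolding v_def using s SG by (intro word_prod_power) auto
      also have "\<dots> = \<one>" using s SG by (auto simp: subset_iff)
      finally have "word_prod G (w @ v) = word_prod G w"
        using w v SG by (subst word_prod_append) auto
      moreover have "w @ v \<in> {w. set w \<subseteq> S \<and> length w = 2 * k}" using w v j by auto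
      ultimately show "word_prod G w \<in> word_prod G ` {w. set w \<subseteq> S \<and> length w = 2 * k}"
        by (metis imageI)
    qed
  qed
  finally show ?thesis .
qed

end

text \<open>Choosing \<open>k\<close> so that \<open>1 / b k \<le> u n / 2\<close> turns the hypothesis into
  \<open>u (n + 1) \<le> u n (1 - c (u n)\<^sup>e)\<close>, and then \<open>1 / (u n)\<^sup>e\<close> increases by at least \<open>c\<close> in each step.
  The exponent \<open>e\<close> is \<open>2\<close> if \<open>b\<close> grows linearly and \<open>1\<close> if it grows quadratically.\<close>

lemma power_decay_from_recursion:
  fixes u :: "nat \<Rightarrow> real" and b :: "nat \<Rightarrow> real" and A :: real
  assumes u: "\<And>n. 0 < u n" "\<And>n. u n \<le> 1" "\<And>n. u (Suc n) \<le> u n"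
    and b: "\<And>k. 0 < b k" "\<And>k. real k ^ 2 \<le> b k ^ e" and e: "e > 0" and A: "A \<ge> 1"
    and rec: "\<And>n k. u n \<le> 1 / b k + real k ^ 2 * A * (u n - u (Suc n))"
  shows "u n ^ e * (real n + 1) \<le> 8 * 2 ^ e * A"
proof -
  define c where "c = 1 / (8 * 2 ^ e * A)"
  have two_e: "1 \<le> (2::real) ^ e" by simp
  then have "1 \<le> 8 * (2::real) ^ e" by linarith
  then have "1 * 1 \<le> (8 * 2 ^ e) * A" using A by (intro mult_mono) auto
  then have "1 \<le> 8 * 2 ^ e * A" by simp
  then have c: "0 < c" "c \<le> 1" using A by (auto simp: c_def)
  have step: "u (Suc n) \<le> u n * (1 - c * u n ^ e)" for n
  proof -
    define y where "y = 2 ^ e / u n ^ e"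
    have ue: "0 < u n ^ e" "u n ^ e \<le> 1" using u by (auto intro: power_le_one less_imp_le)
    have "u n ^ e \<le> 2 ^ e" using ue(2) two_e by linarith
    then have y: "y \<ge> 1" using ue(1) by (simp add: y_def)
    define k where "k = nat \<lceil>sqrt y\<rceil>"
    have sq1: "1 \<le> sqrt y" using y by simp
    have k: "sqrt y \<le> real k" "real k \<le> 2 * sqrt y"
      unfolding k_def using sq1 by linarith+
    have "y = sqrt y ^ 2" using y by simp
    also have "\<dots> \<le> real k ^ 2" using k(1) sq1 by (intro power_mono) auto
    also have "\<dots> \<le> b k ^ e" by (rule b(2))
    finally have "(2 / u n) ^ e \<le> b k ^ e" by (simp add: y_def power_divide)
    then have "2 / u n \<le> b k" 
      using e b(1) [of k] u(1) [of n] by (subst (asm) power_mono_iff) auto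
    then have "1 / b k \<le> u n / 2" using b(1) [of k] u(1) [of n] by (simp add: field_simps)
    then have "u n / 2 \<le> real k ^ 2 * A * (u n - u (Suc n))" using rec [of n k] by linarith
    also have "\<dots> \<le> (2 * sqrt y) ^ 2 * A * (u n - u (Suc n))"
      using k(2) A u(3) [of n] by (intro mult_right_mono power_mono) auto
    also have "\<dots> = 4 * y * A * (u n - u (Suc n))" using y by (simp add: power_mult_distrib)
    finally have "u n * u n ^ e \<le> 8 * 2 ^ e * A * (u n - u (Suc n))"
      using ue by (simp add: y_def field_simps)
    then have "c * (u n * u n ^ e) \<le> u n - u (Suc n)"
      using A by (simp add: c_def field_simps)
    then show ?thesis by (simp add: algebra_simps)
  qed
  have inv: "c * (real n + 1) \<le> 1 / u n ^ e" for n
  proof (induction n)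
    case 0
    have "u 0 ^ e \<le> 1" "0 < u 0 ^ e" using u by (auto intro: power_le_one less_imp_le)
    then have "1 \<le> 1 / u 0 ^ e" by simp
    then show ?case using c by simp
  next
    case (Suc n)
    define w where "w = u n ^ e"
    have w: "0 < w" using u by (simp add: w_def)
    have cw: "0 < 1 - c * w"
      using step [of n] u(1) [of n] u(1) [of "Suc n"] by (simp add: w_def) (smt (verit) zero_less_mult_pos)
    have cw1: "1 - c * w \<le> 1" using c w by simp
    have "u (Suc n) ^ e \<le> (u n * (1 - c * w)) ^ e"
      using step [of n] u(1) [of "Suc n"] by (intro power_mono) (auto simp: w_def less_imp_le)
    also have "\<dots> = w * (1 - c * w) ^ e" by (simp add: power_mult_distrib w_def)
    also have "\<dots> \<le> w * (1 - c * w)"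
      using w cw cw1 e power_decreasing [of 1 e "1 - c * w"] by (intro mult_left_mono) auto
    finally have "1 / (w * (1 - c * w)) \<le> 1 / u (Suc n) ^ e"
      using u(1) [of "Suc n"] by (intro divide_left_mono) (auto intro!: mult_pos_pos w cw)
    moreover have "1 / w + c \<le> 1 / (w * (1 - c * w))"
    proof -
      have "(1 + c * w) * (1 - c * w) = 1 - (c * w) * (c * w)" by (simp add: algebra_simps)
      also have "\<dots> \<le> 1" by simp
      finally have "(1 + c * w) * (1 - c * w) \<le> 1" .
      then have "(1 + c * w) * (1 - c * w) / (w * (1 - c * w)) \<le> 1 / (w * (1 - c * w))"
        using w cw by (intro divide_right_mono) auto
      moreover have "(1 + c * w) * (1 - c * w) / (w * (1 - c * w)) = 1 / w + c"
        using w cw by (simp add: add_divide_distrib)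
      ultimately show ?thesis by simp
    qed
    ultimately show ?case using Suc.IH by (simp add: w_def algebra_simps)
  qed
  show ?thesis
    using inv [of n] u(1) [of n] A by (simp add: c_def field_simps)
qed

context group
begin

lemma collision_prob_decay:
  assumes S: "sym_gen_set G S" and inf: "infinite (carrier G)"
  obtains C where "C > 0" "\<forall>n. collision_prob S n ^ 2 * (real n + 1) \<le> C"
    "\<not> virtually_Z G \<longrightarrow> (\<forall>n. collision_prob S n * (real n + 1) \<le> C)"
proof -
  have finS: "finite S" "S \<noteq> {}" using S by (auto simp: sym_gen_set_def)
  define A where "A = real (card S) ^ 2"
  have "card S \<noteq> 0" using finS by simp
  then have A: "A \<ge> 1" by (simp add: A_def)
  define b where "b k = real (card (word_prod G ` {w. set w \<subseteq> S \<and> length w = 2 * k}))" for k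
  have rec: "collision_prob S n \<le> 1 / b k + real k ^ 2 * A * (collision_prob S n - collision_prob S (Suc n))" for n k
    using collision_prob_le_ball [OF S, of n k] by (simp add: A_def b_def)
  obtain L where L: "L \<subseteq> lists S" "inj_on (word_prod G) L"
      and card1: "\<forall>n. 1 \<le> card {w \<in> L. length w = n}"
      and card2: "\<not> virtually_Z G \<longrightarrow> (\<forall>n. n + 1 \<le> card {w \<in> L. length w = n})"
    using normal_form_growth [OF S inf] .
  have b_ge: "real (\<Sum>j\<le>k. card {w \<in> L. length w = 2 * j}) \<le> b k" for k
    unfolding b_def using card_even_words_ge [OF S L, of k] by (simp only: of_nat_le_iff)
  have b1: "real k + 1 \<le> b k" for k
  proof -
    have "(\<Sum>j\<le>k. 1) \<le> (\<Sum>j\<le>k. card {w \<in> L. length w = 2 * j})" using card1 by (intro sum_mono) auto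
    then have "k + 1 \<le> (\<Sum>j\<le>k. card {w \<in> L. length w = 2 * j})" by simp
    then have "real (k + 1) \<le> real (\<Sum>j\<le>k. card {w \<in> L. length w = 2 * j})" by (simp only: of_nat_le_iff)
    then show ?thesis using b_ge [of k] by simp
  qed
  have bpos: "0 < b k" for k using b1 [of k] by linarith
  have "collision_prob S n ^ 2 * (real n + 1) \<le> 8 * 2 ^ 2 * A" for n
  proof (rule power_decay_from_recursion [where b = b])
    show "real k ^ 2 \<le> b k ^ 2" for k using b1 [of k] by (intro power_mono) auto
  qed (use collision_prob_pos [OF S] collision_prob_le_1 [OF S] collision_prob_Suc_le [OF S] bpos A rec in auto)
  then have dec1: "collision_prob S n ^ 2 * (real n + 1) \<le> 32 * A" for n by simp
  have dec2: "collision_prob S n * (real n + 1) \<le> 32 * A" if not: "\<not> virtually_Z G" for n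
  proof -
    have b2: "real k ^ 2 \<le> b k" for k
    proof -
      have "real k ^ 2 \<le> (\<Sum>j\<le>k. 2 * real j + 1)"
        by (induction k) (auto simp: power2_eq_square algebra_simps)
      also have "\<dots> \<le> real (\<Sum>j\<le>k. card {w \<in> L. length w = 2 * j})"
      proof -
        have "2 * real j + 1 \<le> real (card {w \<in> L. length w = 2 * j})" for j
        proof -
          have "2 * j + 1 \<le> card {w \<in> L. length w = 2 * j}" using card2 not by blast
          then show ?thesis by linarith
        qed
        then show ?thesis unfolding of_nat_sum by (rule sum_mono)
      qed
      finally show ?thesis using b_ge [of k] by linarith
    qed
    have "collision_prob S n ^ 1 * (real n + 1) \<le> 8 * 2 ^ 1 * A"
      by (rule power_decay_from_recursion [where b = b])
         (use collision_prob_pos [OF S] collision_prob_le_1 [OF S] collision_prob_Suc_le [OF S] bpos A rec b2 in auto)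
    then show ?thesis using A by simp
  qed
  show thesis by (rule that [of "32 * A"]) (use A dec1 dec2 in auto)
qed

text \<open>Split the walk at half time and apply \<open>a b \<le> (a\<^sup>2 + b\<^sup>2) / 2\<close> to the convolution of the laws of the
  two halves.\<close>

lemma pmf_walk_le_collision_prob:
  assumes S: "sym_gen_set G S" and y: "y \<in> carrier G"
  shows "pmf (walk G S n) y \<le> collision_prob S (n div 2)"
proof -
  define a b where "a = n div 2" and "b = n - n div 2"
  have ab: "n = a + b" "a \<le> b" by (auto simp: a_def b_def)
  let ?A = "set_pmf (walk G S a)"
  have finA: "finite ?A" and AG: "?A \<subseteq> carrier G" using finite_set_walk [OF S] set_walk_subset [OF S] by auto
  define h where "h x = inv x \<otimes> y" for x
  have bij: "bij_betw h (carrier G) (carrier G)"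
    by (rule bij_betw_byWitness [where f' = "\<lambda>z. y \<otimes> inv z"])
       (use y in \<open>auto simp: h_def inv_mult_group m_assoc [symmetric]\<close>, simp add: m_assoc)
  have "pmf (walk G S n) y = (\<Sum>x\<in>?A. pmf (map_pmf (\<lambda>z. x \<otimes> z) (walk G S b)) y * pmf (walk G S a) x)"
    unfolding ab(1) walk_add [OF S] pmf_bind using finA by (rule integral_measure_pmf_real)
  also have "\<dots> = (\<Sum>x\<in>?A. pmf (walk G S b) (h x) * pmf (walk G S a) x)"
    by (rule sum.cong [OF refl])
       (use AG y set_walk_subset [OF S, of b] in \<open>auto simp: pmf_map_left_mult h_def\<close>)
  also have "\<dots> \<le> (\<Sum>x\<in>?A. ((pmf (walk G S b) (h x))\<^sup>2 + (pmf (walk G S a) x)\<^sup>2) / 2)"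
  proof (rule sum_mono)
    fix x
    show "pmf (walk G S b) (h x) * pmf (walk G S a) x
            \<le> ((pmf (walk G S b) (h x))\<^sup>2 + (pmf (walk G S a) x)\<^sup>2) / 2"
      using sum_squares_bound [of "pmf (walk G S b) (h x)" "pmf (walk G S a) x"] by simp
  qed
  also have "\<dots> = ((\<Sum>x\<in>?A. (pmf (walk G S b) (h x))\<^sup>2) + (\<Sum>x\<in>?A. (pmf (walk G S a) x)\<^sup>2)) / 2"
    by (simp add: sum.distrib sum_divide_distrib add_divide_distrib)
  also have "(\<Sum>x\<in>?A. (pmf (walk G S a) x)\<^sup>2) = collision_prob S a"
    unfolding collision_prob_def
    by (rule integral_count_space_eq_sum [symmetric]) (use finA AG in \<open>auto simp: set_pmf_iff\<close>)
  also have "(\<Sum>x\<in>?A. (pmf (walk G S b) (h x))\<^sup>2) \<le> collision_prob S b"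
  proof -
    have inj: "inj_on h ?A" using bij AG by (auto simp: bij_betw_def intro: inj_on_subset)
    have hA: "h ` ?A \<subseteq> carrier G" using bij AG by (auto simp: bij_betw_def)
    let ?B = "set_pmf (walk G S b)"
    have finB: "finite ?B" and BG: "?B \<subseteq> carrier G" using finite_set_walk [OF S] set_walk_subset [OF S] by auto
    have "(\<Sum>x\<in>?A. (pmf (walk G S b) (h x))\<^sup>2) = (\<Sum>z\<in>h ` ?A. (pmf (walk G S b) z)\<^sup>2)"
      using inj by (simp add: sum.reindex)
    also have "\<dots> \<le> (\<Sum>z\<in>h ` ?A \<union> ?B. (pmf (walk G S b) z)\<^sup>2)"
      using finA finB by (intro sum_mono2) auto
    also have "\<dots> = collision_prob S b"
      unfolding collision_prob_def
      by (rule integral_count_space_eq_sum [symmetric]) (use finA finB hA BG in \<open>auto simp: set_pmf_iff\<close>)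
    finally show ?thesis .
  qed
  also have "collision_prob S b \<le> collision_prob S a" using collision_prob_antimono [OF S ab(2)] .
  finally show ?thesis by (simp add: a_def)
qed

end

section \<open>The switch--walk--switch walk on a wreath product\<close>

lemma wreath_mult:
  "(f, x) \<otimes>\<^bsub>wreath G H\<^esub> (g, y) =
     ((\<lambda>z\<in>carrier H. f z \<otimes>\<^bsub>G\<^esub> g (inv\<^bsub>H\<^esub> x \<otimes>\<^bsub>H\<^esub> z)), x \<otimes>\<^bsub>H\<^esub> y)"
  by (simp add: wreath_def)

lemma wreath_one: "\<one>\<^bsub>wreath G H\<^esub> = ((\<lambda>z\<in>carrier H. \<one>\<^bsub>G\<^esub>), \<one>\<^bsub>H\<^esub>)"
  by (simp add: wreath_def)

lemma in_carrier_wreath_iff: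
  "(f, x) \<in> carrier (wreath G H) \<longleftrightarrow>
     f \<in> carrier H \<rightarrow>\<^sub>E carrier G \<and> finite {z \<in> carrier H. f z \<noteq> \<one>\<^bsub>G\<^esub>} \<and> x \<in> carrier H"
  by (auto simp: wreath_def)

lemma pmf_of_set_Times:
  assumes "finite A" "A \<noteq> {}" "finite B" "B \<noteq> {}"
  shows "pmf_of_set (A \<times> B) = pair_pmf (pmf_of_set A) (pmf_of_set B)"
proof (rule pmf_eqI)
  fix p :: "'a \<times> 'b"
  obtain a b where p: "p = (a, b)" by force
  show "pmf (pmf_of_set (A \<times> B)) p = pmf (pair_pmf (pmf_of_set A) (pmf_of_set B)) p"
    using assms by (simp add: p pmf_pair indicator_def card_cartesian_product)
qed

text \<open>The number of switches made at \<open>z\<close> by a walker whose increments are the given word: each step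
  counts its departure point and its arrival point. The rest of the path is seen from the position
  after the first step.\<close>

primrec visits :: "('b, 'n) monoid_scheme \<Rightarrow> 'b list \<Rightarrow> 'b \<Rightarrow> nat" where
  "visits H [] z = 0"
| "visits H (h # w) z = of_bool (z = \<one>\<^bsub>H\<^esub>) + of_bool (z = h) + visits H w (inv\<^bsub>H\<^esub> h \<otimes>\<^bsub>H\<^esub> z)"

definition switch_walk_switch ::
  "('a, 'm) monoid_scheme \<Rightarrow> ('b, 'n) monoid_scheme \<Rightarrow> 'a \<Rightarrow> 'b \<Rightarrow> 'a \<Rightarrow> ('b \<Rightarrow> 'a) \<times> 'b" where
  "switch_walk_switch G H a h b =
     ((\<lambda>z\<in>carrier H. if z = \<one>\<^bsub>H\<^esub> then a else if z = h then b else \<one>\<^bsub>G\<^esub>), h)"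

locale wreath_walk = G: group G + H: group H
  for G :: "('a, 'm) monoid_scheme" and H :: "('b, 'n) monoid_scheme" +
  fixes A :: "'a set" and S :: "'b set"
  assumes A: "sym_gen_set G A" and one_A: "\<one>\<^bsub>G\<^esub> \<in> A"
    and S: "sym_gen_set H S" and one_S: "\<one>\<^bsub>H\<^esub> \<notin> S"
begin

abbreviation "W \<equiv> wreath G H"

sublocale W: group W
  by (rule wreath_group) (rule G.is_group, rule H.is_group)

definition gens :: "(('b \<Rightarrow> 'a) \<times> 'b) set" where
  "gens = (\<lambda>(h, a, b). switch_walk_switch G H a h b) ` (S \<times> A \<times> A)"

lemma A_sub: "finite A" "A \<noteq> {}" "A \<subseteq> carrier G" and A_inv: "a \<in> A \<Longrightarrow> inv\<^bsub>G\<^esub> a \<in> A"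
  using A by (auto simp: sym_gen_set_def)

lemma S_sub: "finite S" "S \<noteq> {}" "S \<subseteq> carrier H" and S_inv: "h \<in> S \<Longrightarrow> inv\<^bsub>H\<^esub> h \<in> S"
  using S by (auto simp: sym_gen_set_def)

lemma A_carrier [simp]: "a \<in> A \<Longrightarrow> a \<in> carrier G" using A_sub by auto
lemma S_carrier [simp]: "h \<in> S \<Longrightarrow> h \<in> carrier H" using S_sub by auto

text \<open>A uniform element of the generating set below must come from independent uniform choices of its
  three components. This requires \<open>\<one> \<notin> S\<close>: if the walker stayed in place, the two switches would
  be merged into one.\<close>

lemma inj_on_switch_walk_switch:
  "inj_on (\<lambda>(h, a, b). switch_walk_switch G H a h b) (S \<times> A \<times> A)"
proof (rule inj_onI)
  fix p q
  assume "p \<in> S \<times> A \<times> A" "q \<in> S \<times> A \<times> A"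
    and pq: "(\<lambda>(h, a, b). switch_walk_switch G H a h b) p = (\<lambda>(h, a, b). switch_walk_switch G H a h b) q"
  then obtain h a b h' a' b' where p_eq: "p = (h, a, b)" and q_eq: "q = (h', a', b')"
    and mem: "h \<in> S" "h' \<in> S" "a \<in> A" "b \<in> A" "a' \<in> A" "b' \<in> A"
    by force
  have eq: "switch_walk_switch G H a h b = switch_walk_switch G H a' h' b'"
    using pq by (simp add: p_eq q_eq)
  have h: "h = h'" using eq by (simp add: switch_walk_switch_def)
  have same: "(\<lambda>z\<in>carrier H. if z = \<one>\<^bsub>H\<^esub> then a else if z = h then b else \<one>\<^bsub>G\<^esub>) =
        (\<lambda>z\<in>carrier H. if z = \<one>\<^bsub>H\<^esub> then a' else if z = h then b' else \<one>\<^bsub>G\<^esub>)"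
    using eq unfolding h switch_walk_switch_def by simp
  have "h \<noteq> \<one>\<^bsub>H\<^esub>" using mem one_S by auto
  moreover have "h \<in> carrier H" using mem S by (auto simp: sym_gen_set_def)
  ultimately show "p = q"
    using fun_cong [OF same, of "\<one>\<^bsub>H\<^esub>"] fun_cong [OF same, of h] h by (simp add: p_eq q_eq)
qed

lemma switch_walk_switch_carrier:
  assumes "a \<in> carrier G" "b \<in> carrier G" "h \<in> carrier H"
  shows "switch_walk_switch G H a h b \<in> carrier W"
proof -
  have "finite {z \<in> carrier H. (\<lambda>z\<in>carrier H. if z = \<one>\<^bsub>H\<^esub> then a else if z = h then b else \<one>\<^bsub>G\<^esub>) z \<noteq> \<one>\<^bsub>G\<^esub>}"
    by (rule finite_subset [of _ "{\<one>\<^bsub>H\<^esub>, h}"]) auto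
  then show ?thesis
    using assms unfolding switch_walk_switch_def in_carrier_wreath_iff by auto
qed

lemma gensI: "h \<in> S \<Longrightarrow> a \<in> A \<Longrightarrow> b \<in> A \<Longrightarrow> switch_walk_switch G H a h b \<in> gens"
  unfolding gens_def by (rule image_eqI [of _ _ "(h, a, b)"]) simp_all

lemma gens_cases:
  assumes "s \<in> gens"
  obtains h a b where "h \<in> S" "a \<in> A" "b \<in> A" "s = switch_walk_switch G H a h b"
  using assms by (force simp: gens_def)

lemma gens_carrier: "gens \<subseteq> carrier W"
proof
  fix s assume "s \<in> gens"
  then obtain h a b where "h \<in> S" "a \<in> A" "b \<in> A" "s = switch_walk_switch G H a h b"
    by (rule gens_cases)
  then show "s \<in> carrier W" by (simp add: switch_walk_switch_carrier)
qed

lemma inv_switch_walk_switch: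
  assumes "h \<in> S" "a \<in> A" "b \<in> A"
  shows "inv\<^bsub>W\<^esub> (switch_walk_switch G H a h b)
           = switch_walk_switch G H (inv\<^bsub>G\<^esub> b) (inv\<^bsub>H\<^esub> h) (inv\<^bsub>G\<^esub> a)"
proof (rule W.inv_equality)
  have h1: "h \<noteq> \<one>\<^bsub>H\<^esub>" using assms one_S by auto
  have "(if z = \<one>\<^bsub>H\<^esub> then inv\<^bsub>G\<^esub> b else if z = inv\<^bsub>H\<^esub> h then inv\<^bsub>G\<^esub> a else \<one>\<^bsub>G\<^esub>) \<otimes>\<^bsub>G\<^esub>
        (if h \<otimes>\<^bsub>H\<^esub> z = \<one>\<^bsub>H\<^esub> then a else if h \<otimes>\<^bsub>H\<^esub> z = h then b else \<one>\<^bsub>G\<^esub>) = \<one>\<^bsub>G\<^esub>"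
    if z: "z \<in> carrier H" for z
  proof -
    have "h \<otimes>\<^bsub>H\<^esub> z = \<one>\<^bsub>H\<^esub> \<longleftrightarrow> z = inv\<^bsub>H\<^esub> h"
      using z assms by (metis H.inv_equality H.inv_inv H.r_inv S_carrier)
    moreover have "h \<otimes>\<^bsub>H\<^esub> z = h \<longleftrightarrow> z = \<one>\<^bsub>H\<^esub>"
      using z assms by simp
    moreover have "inv\<^bsub>H\<^esub> h \<noteq> \<one>\<^bsub>H\<^esub>" using h1 assms by (metis H.inv_eq_1_iff S_carrier)
    ultimately show ?thesis using assms by auto
  qed
  then show "switch_walk_switch G H (inv\<^bsub>G\<^esub> b) (inv\<^bsub>H\<^esub> h) (inv\<^bsub>G\<^esub> a) \<otimes>\<^bsub>W\<^esub> switch_walk_switch G H a h b = \<one>\<^bsub>W\<^esub>"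
    using assms unfolding switch_walk_switch_def wreath_mult wreath_one
    by (auto intro!: restrict_ext)
qed (use assms in \<open>auto intro: switch_walk_switch_carrier\<close>)

definition move :: "'b \<Rightarrow> ('b \<Rightarrow> 'a) \<times> 'b" where
  "move x = ((\<lambda>z\<in>carrier H. \<one>\<^bsub>G\<^esub>), x)"

definition single_lamp :: "'b \<Rightarrow> 'a \<Rightarrow> ('b \<Rightarrow> 'a) \<times> 'b" where
  "single_lamp x g = ((\<lambda>z\<in>carrier H. if z = x then g else \<one>\<^bsub>G\<^esub>), \<one>\<^bsub>H\<^esub>)"

lemma gen_mult: "p \<in> generate W gens \<Longrightarrow> q \<in> generate W gens \<Longrightarrow> p \<otimes>\<^bsub>W\<^esub> q \<in> generate W gens"
  by (rule generate.eng)

lemma gen_sws: "h \<in> S \<Longrightarrow> a \<in> A \<Longrightarrow> b \<in> A \<Longrightarrow> switch_walk_switch G H a h b \<in> generate W gens"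
  by (rule generate.incl) (rule gensI)

text \<open>In this and the next lemma \<open>\<one> \<in> A\<close> is essential: it allows a step without switching. If, for
  instance, \<open>A = {1, -1}\<close> in \<open>\<int>\<close>, then every step changes the sum of all lamps by an even number.\<close>

lemma move_generated:
  assumes "x \<in> carrier H"
  shows "move x \<in> generate W gens"
proof -
  obtain w where "set w \<subseteq> S" "word_prod H w = x" using H.sym_gen_set_word [OF S assms] .
  moreover have "move (word_prod H w) \<in> generate W gens" if "set w \<subseteq> S" for w
    using that
  proof (induction w)
    case Nil
    have "move \<one>\<^bsub>H\<^esub> = \<one>\<^bsub>W\<^esub>" by (simp add: move_def wreath_one)
    then show ?case using generate.one by (metis word_prod_Nil)
  next
    case (Cons h w)
    have h: "h \<in> S" "h \<in> carrier H" using Cons.prems by auto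
    have "word_prod H w \<in> carrier H" using Cons.prems S_sub by auto
    then have "move (h \<otimes>\<^bsub>H\<^esub> word_prod H w) = switch_walk_switch G H \<one>\<^bsub>G\<^esub> h \<one>\<^bsub>G\<^esub> \<otimes>\<^bsub>W\<^esub> move (word_prod H w)"
      using h unfolding move_def switch_walk_switch_def wreath_mult
      by (auto intro!: restrict_ext)
    then show ?case using Cons gen_sws [OF h(1) one_A one_A] by (auto intro: gen_mult)
  qed
  ultimately show ?thesis by blast
qed

lemma single_lamp_one_generated:
  assumes "g \<in> carrier G"
  shows "single_lamp \<one>\<^bsub>H\<^esub> g \<in> generate W gens"
proof -
  obtain w where "set w \<subseteq> A" "word_prod G w = g" using G.sym_gen_set_word [OF A assms] .
  moreover have "single_lamp \<one>\<^bsub>H\<^esub> (word_prod G w) \<in> generate W gens" if "set w \<subseteq> A" for w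
    using that
  proof (induction w)
    case Nil
    have "single_lamp \<one>\<^bsub>H\<^esub> \<one>\<^bsub>G\<^esub> = \<one>\<^bsub>W\<^esub>" by (auto simp: single_lamp_def wreath_one)
    then show ?case using generate.one by (metis word_prod_Nil)
  next
    case (Cons a w)
    have a: "a \<in> A" "a \<in> carrier G" using Cons.prems by auto
    have wG: "word_prod G w \<in> carrier G" using Cons.prems A_sub by auto
    obtain h where h: "h \<in> S" using S_sub by auto
    have "single_lamp \<one>\<^bsub>H\<^esub> a = switch_walk_switch G H a h \<one>\<^bsub>G\<^esub> \<otimes>\<^bsub>W\<^esub> move (inv\<^bsub>H\<^esub> h)"
      using h a unfolding move_def switch_walk_switch_def wreath_mult single_lamp_def
      by (auto intro!: restrict_ext)
    then have "single_lamp \<one>\<^bsub>H\<^esub> a \<in> generate W gens"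
      using h by (auto intro!: gen_mult gen_sws a one_A move_generated)
    moreover have "single_lamp \<one>\<^bsub>H\<^esub> (a \<otimes>\<^bsub>G\<^esub> word_prod G w)
        = single_lamp \<one>\<^bsub>H\<^esub> a \<otimes>\<^bsub>W\<^esub> single_lamp \<one>\<^bsub>H\<^esub> (word_prod G w)"
      using a wG unfolding wreath_mult single_lamp_def by (auto intro!: restrict_ext)
    ultimately show ?case using Cons by (auto intro: gen_mult)
  qed
  ultimately show ?thesis by blast
qed

lemma single_lamp_generated:
  assumes "x \<in> carrier H" "g \<in> carrier G"
  shows "single_lamp x g \<in> generate W gens"
proof -
  have "(inv\<^bsub>H\<^esub> x \<otimes>\<^bsub>H\<^esub> z = \<one>\<^bsub>H\<^esub>) = (z = x)" if "z \<in> carrier H" for z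
    using that assms by (metis H.inv_closed H.inv_equality H.inv_inv H.l_inv)
  then have "single_lamp x g = move x \<otimes>\<^bsub>W\<^esub> (single_lamp \<one>\<^bsub>H\<^esub> g \<otimes>\<^bsub>W\<^esub> move (inv\<^bsub>H\<^esub> x))"
    using assms unfolding move_def wreath_mult single_lamp_def by (auto intro!: restrict_ext)
  then show ?thesis
    using assms by (auto intro!: gen_mult move_generated single_lamp_one_generated)
qed

lemma lamps_generated:
  assumes "finite F" "f \<in> carrier H \<rightarrow>\<^sub>E carrier G" "{z \<in> carrier H. f z \<noteq> \<one>\<^bsub>G\<^esub>} \<subseteq> F" "F \<subseteq> carrier H"
  shows "(f, \<one>\<^bsub>H\<^esub>) \<in> generate W gens"
  using assms
proof (induction F arbitrary: f)
  case empty
  then have "f z = \<one>\<^bsub>G\<^esub>" if "z \<in> carrier H" for z using that by auto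
  then have "f = (\<lambda>z\<in>carrier H. \<one>\<^bsub>G\<^esub>)"
    using empty.prems(1) by (intro extensionalityI [of f "carrier H"]) (auto simp: PiE_iff)
  then have "(f, \<one>\<^bsub>H\<^esub>) = \<one>\<^bsub>W\<^esub>" by (simp add: wreath_one)
  then show ?case using generate.one by metis
next
  case (insert x F)
  have x: "x \<in> carrier H" using insert.prems by auto
  have fG: "f z \<in> carrier G" if "z \<in> carrier H" for z using insert.prems(1) that by (auto simp: PiE_iff)
  define f' where "f' = f(x := \<one>\<^bsub>G\<^esub>)"
  have "(f', \<one>\<^bsub>H\<^esub>) \<in> generate W gens"
  proof (rule insert.IH)
    show "f' \<in> carrier H \<rightarrow>\<^sub>E carrier G"
      using insert.prems(1) x by (auto simp: f'_def PiE_iff extensional_def)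
    show "{z \<in> carrier H. f' z \<noteq> \<one>\<^bsub>G\<^esub>} \<subseteq> F" using insert.prems(2) by (auto simp: f'_def)
    show "F \<subseteq> carrier H" using insert.prems by auto
  qed
  moreover have "(f, \<one>\<^bsub>H\<^esub>) = single_lamp x (f x) \<otimes>\<^bsub>W\<^esub> (f', \<one>\<^bsub>H\<^esub>)"
  proof -
    have "f = (\<lambda>z\<in>carrier H. (\<lambda>z\<in>carrier H. if z = x then f x else \<one>\<^bsub>G\<^esub>) z \<otimes>\<^bsub>G\<^esub> f' (inv\<^bsub>H\<^esub> \<one>\<^bsub>H\<^esub> \<otimes>\<^bsub>H\<^esub> z))"
    proof (rule extensionalityI [of f "carrier H"])
      show "f \<in> extensional (carrier H)" using insert.prems(1) by (auto simp: PiE_iff)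
    qed (use fG x in \<open>auto simp: f'_def\<close>)
    then show ?thesis unfolding single_lamp_def wreath_mult by simp
  qed
  moreover have "single_lamp x (f x) \<in> generate W gens"
    using x fG by (intro single_lamp_generated) auto
  ultimately show ?case by (simp add: gen_mult)
qed

lemma sym_gen_set_gens: "sym_gen_set W gens"
  unfolding sym_gen_set_def
proof (intro conjI ballI)
  show "finite gens" using A_sub S_sub by (simp add: gens_def)
  show "gens \<noteq> {}" using A_sub S_sub by (simp add: gens_def)
  show "gens \<subseteq> carrier W" by (rule gens_carrier)
  show "inv\<^bsub>W\<^esub> s \<in> gens" if s: "s \<in> gens" for s
  proof -
    obtain h a b where "h \<in> S" "a \<in> A" "b \<in> A" "s = switch_walk_switch G H a h b"
      using s by (rule gens_cases)
    then show ?thesis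
      using A_inv S_inv by (simp add: inv_switch_walk_switch gensI)
  qed
  show "generate W gens = carrier W"
  proof
    show "generate W gens \<subseteq> carrier W" using gens_carrier by (rule W.generate_incl)
    show "carrier W \<subseteq> generate W gens"
    proof
      fix p assume p: "p \<in> carrier W"
      obtain f x where fx: "p = (f, x)" by force
      have f: "f \<in> carrier H \<rightarrow>\<^sub>E carrier G" "finite {z \<in> carrier H. f z \<noteq> \<one>\<^bsub>G\<^esub>}" "x \<in> carrier H"
        using p by (auto simp: fx in_carrier_wreath_iff)
      have fG: "f z \<in> carrier G" if "z \<in> carrier H" for z using f(1) that by (auto simp: PiE_iff)
      have "f = (\<lambda>z\<in>carrier H. f z \<otimes>\<^bsub>G\<^esub> (\<lambda>z\<in>carrier H. \<one>\<^bsub>G\<^esub>) (inv\<^bsub>H\<^esub> \<one>\<^bsub>H\<^esub> \<otimes>\<^bsub>H\<^esub> z))"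
      proof (rule extensionalityI [of f "carrier H"])
        show "f \<in> extensional (carrier H)" using f(1) by (auto simp: PiE_iff)
      qed (use fG in auto)
      then have "p = (f, \<one>\<^bsub>H\<^esub>) \<otimes>\<^bsub>W\<^esub> move x"
        using f(3) unfolding fx move_def wreath_mult by simp
      then show "p \<in> generate W gens"
        using lamps_generated [OF f(2,1)] move_generated [OF f(3)] by (auto intro: gen_mult)
    qed
  qed
qed

text \<open>One step multiplies at most two lamps by a generator.\<close>

lemma sum_lamp_lengths_le:
  assumes "set w \<subseteq> gens" "finite Z" "Z \<subseteq> carrier H"
  shows "(\<Sum>z\<in>Z. word_dist G A (fst (word_prod W w) z) \<one>\<^bsub>G\<^esub>) \<le> 2 * length w"
  using assms
proof (induction w arbitrary: Z)
  case Nil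
  then show ?case using A by (auto simp: wreath_one intro!: sum.neutral)
next
  case (Cons s w)
  have "s \<in> gens" using Cons.prems by simp
  then obtain h a b where s: "h \<in> S" "a \<in> A" "b \<in> A" "s = switch_walk_switch G H a h b"
    by (rule gens_cases)
  have hH: "h \<in> carrier H" using s by simp
  obtain f x where fx: "word_prod W w = (f, x)" by force
  have "word_prod W w \<in> carrier W" using Cons.prems gens_carrier by auto
  then have fG: "f z \<in> carrier G" if "z \<in> carrier H" for z
    using that by (auto simp: fx in_carrier_wreath_iff PiE_iff)
  define l where "l z = (if z = \<one>\<^bsub>H\<^esub> then a else if z = h then b else \<one>\<^bsub>G\<^esub>)" for z
  have lA: "l z \<in> A" for z using s one_A by (simp add: l_def)
  have fst_eq: "fst (word_prod W (s # w)) z = l z \<otimes>\<^bsub>G\<^esub> f (inv\<^bsub>H\<^esub> h \<otimes>\<^bsub>H\<^esub> z)" if "z \<in> carrier H" for z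
    using that by (simp add: fx s switch_walk_switch_def wreath_mult l_def)
  let ?d = "\<lambda>g. word_dist G A g \<one>\<^bsub>G\<^esub>"
  have "(\<Sum>z\<in>Z. ?d (fst (word_prod W (s # w)) z)) \<le> (\<Sum>z\<in>Z. ?d (l z) + ?d (f (inv\<^bsub>H\<^esub> h \<otimes>\<^bsub>H\<^esub> z)))"
  proof (rule sum_mono)
    fix z assume "z \<in> Z"
    then have z: "z \<in> carrier H" using Cons.prems by auto
    show "?d (fst (word_prod W (s # w)) z) \<le> ?d (l z) + ?d (f (inv\<^bsub>H\<^esub> h \<otimes>\<^bsub>H\<^esub> z))"
      unfolding fst_eq [OF z] using lA fG z hH by (intro G.word_dist_mult_le [OF A]) auto
  qed
  also have "\<dots> = (\<Sum>z\<in>Z. ?d (l z)) + (\<Sum>z\<in>Z. ?d (f (inv\<^bsub>H\<^esub> h \<otimes>\<^bsub>H\<^esub> z)))"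
    by (rule sum.distrib)
  also have "(\<Sum>z\<in>Z. ?d (l z)) \<le> 2"
  proof -
    have "(\<Sum>z\<in>Z. ?d (l z)) = (\<Sum>z\<in>Z \<inter> {\<one>\<^bsub>H\<^esub>, h}. ?d (l z))"
      using Cons.prems A by (intro sum.mono_neutral_right) (auto simp: l_def)
    also have "\<dots> \<le> (\<Sum>z\<in>Z \<inter> {\<one>\<^bsub>H\<^esub>, h}. 1)"
      by (intro sum_mono G.word_dist_generator_le [OF A] lA)
    also have "\<dots> \<le> card {\<one>\<^bsub>H\<^esub>, h}" by (simp add: card_mono)
    also have "\<dots> \<le> 2" by (simp add: card_insert_if)
    finally show ?thesis .
  qed
  also have "(\<Sum>z\<in>Z. ?d (f (inv\<^bsub>H\<^esub> h \<otimes>\<^bsub>H\<^esub> z))) = (\<Sum>z\<in>(\<lambda>z. inv\<^bsub>H\<^esub> h \<otimes>\<^bsub>H\<^esub> z) ` Z. ?d (f z))"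
  proof -
    have "inj_on (\<lambda>z. inv\<^bsub>H\<^esub> h \<otimes>\<^bsub>H\<^esub> z) Z"
      using Cons.prems hH by (auto simp: inj_on_def subset_iff)
    then show ?thesis by (simp add: sum.reindex)
  qed
  also have "\<dots> \<le> 2 * length w"
    using Cons.IH [of "(\<lambda>z. inv\<^bsub>H\<^esub> h \<otimes>\<^bsub>H\<^esub> z) ` Z"] Cons.prems hH by (auto simp: fx)
  finally show ?case by simp
qed

lemma pmf_of_set_gens:
  "pmf_of_set gens = bind_pmf (pmf_of_set S) (\<lambda>h. bind_pmf (pmf_of_set A)
     (\<lambda>a. bind_pmf (pmf_of_set A) (\<lambda>b. return_pmf (switch_walk_switch G H a h b))))"
proof -
  have "pmf_of_set gens = map_pmf (\<lambda>(h, a, b). switch_walk_switch G H a h b) (pmf_of_set (S \<times> A \<times> A))"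
    unfolding gens_def using A_sub S_sub by (intro map_pmf_of_set_inj [symmetric] inj_on_switch_walk_switch) auto
  also have "pmf_of_set (S \<times> A \<times> A) = pair_pmf (pmf_of_set S) (pair_pmf (pmf_of_set A) (pmf_of_set A))"
    using A_sub S_sub by (simp add: pmf_of_set_Times)
  finally show ?thesis
    by (simp add: pair_pmf_def map_bind_pmf map_pmf_def bind_assoc_pmf bind_return_pmf)
qed

text \<open>At each of its visits to \<open>z\<close> the walker multiplies the lamp there by an independent uniform element
  of \<open>A\<close>.\<close>

lemma law_of_lamp:
  assumes "z \<in> carrier H"
  shows "map_pmf (\<lambda>p. fst p z) (walk W gens t) =
         bind_pmf (replicate_pmf t (pmf_of_set S)) (\<lambda>w. walk G A (visits H w z))"
  using assms
proof (induction t arbitrary: z)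
  case 0
  then show ?case by (simp add: wreath_one bind_return_pmf)
next
  case (Suc t)
  define R where "R = replicate_pmf t (pmf_of_set S)"
  define l where "l h a b = (if z = \<one>\<^bsub>H\<^esub> then a else if z = h then b else \<one>\<^bsub>G\<^esub>)" for h a b
  have "map_pmf (\<lambda>p. fst p z) (walk W gens (Suc t)) =
      bind_pmf (pmf_of_set S) (\<lambda>h. bind_pmf (pmf_of_set A) (\<lambda>a. bind_pmf (pmf_of_set A) (\<lambda>b.
        map_pmf (\<lambda>p. fst (switch_walk_switch G H a h b \<otimes>\<^bsub>W\<^esub> p) z) (walk W gens t))))"
    by (simp add: walk_Suc pmf_of_set_gens map_bind_pmf bind_assoc_pmf bind_return_pmf pmf.map_comp o_def)
  also have "\<dots> = bind_pmf (pmf_of_set S) (\<lambda>h. bind_pmf R (\<lambda>w. walk G A (visits H (h # w) z)))"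
  proof (rule bind_pmf_cong [OF refl])
    fix h assume "h \<in> set_pmf (pmf_of_set S)"
    then have h: "h \<in> S" using S_sub by simp
    then have hH: "h \<in> carrier H" and h1: "h \<noteq> \<one>\<^bsub>H\<^esub>" using one_S by auto
    define y where "y = inv\<^bsub>H\<^esub> h \<otimes>\<^bsub>H\<^esub> z"
    have yH: "y \<in> carrier H" using Suc.prems hH by (simp add: y_def)
    have lamp: "map_pmf (\<lambda>p. fst (switch_walk_switch G H a h b \<otimes>\<^bsub>W\<^esub> p) z) (walk W gens t) =
        bind_pmf R (\<lambda>w. map_pmf (\<lambda>g. l h a b \<otimes>\<^bsub>G\<^esub> g) (walk G A (visits H w y)))" for a b
    proof -
      have "map_pmf (\<lambda>p. fst (switch_walk_switch G H a h b \<otimes>\<^bsub>W\<^esub> p) z) (walk W gens t) =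
          map_pmf (\<lambda>p. l h a b \<otimes>\<^bsub>G\<^esub> fst p y) (walk W gens t)"
        using Suc.prems
        by (intro map_pmf_cong refl)
           (simp add: switch_walk_switch_def wreath_mult l_def y_def split: prod.splits, auto simp: wreath_def)
      also have "\<dots> = map_pmf (\<lambda>g. l h a b \<otimes>\<^bsub>G\<^esub> g) (map_pmf (\<lambda>p. fst p y) (walk W gens t))"
        by (simp add: pmf.map_comp o_def)
      also have "\<dots> = bind_pmf R (\<lambda>w. map_pmf (\<lambda>g. l h a b \<otimes>\<^bsub>G\<^esub> g) (walk G A (visits H w y)))"
        by (simp add: Suc.IH [OF yH] R_def map_bind_pmf)
      finally show ?thesis .
    qed
    have "bind_pmf (pmf_of_set A) (\<lambda>a. bind_pmf (pmf_of_set A) (\<lambda>b. bind_pmf R (\<lambda>w.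
            map_pmf (\<lambda>g. l h a b \<otimes>\<^bsub>G\<^esub> g) (walk G A (visits H w y))))) =
          bind_pmf R (\<lambda>w. walk G A (visits H (h # w) z))"
    proof -
      consider "z = \<one>\<^bsub>H\<^esub>" "z \<noteq> h" | "z \<noteq> \<one>\<^bsub>H\<^esub>" "z = h" | "z \<noteq> \<one>\<^bsub>H\<^esub>" "z \<noteq> h" using h1 by blast
      then show ?thesis
      proof cases
        case 1
        then have "bind_pmf (pmf_of_set A) (\<lambda>a. bind_pmf (pmf_of_set A) (\<lambda>b. bind_pmf R (\<lambda>w.
            map_pmf (\<lambda>g. l h a b \<otimes>\<^bsub>G\<^esub> g) (walk G A (visits H w y))))) =
            bind_pmf R (\<lambda>w. bind_pmf (pmf_of_set A) (\<lambda>a. map_pmf (\<lambda>g. a \<otimes>\<^bsub>G\<^esub> g) (walk G A (visits H w y))))"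
          by (simp add: l_def bind_commute_pmf [of R])
        also have "\<dots> = bind_pmf R (\<lambda>w. walk G A (Suc (visits H w y)))"
          by (simp only: walk_Suc)
        finally show ?thesis using 1 by (simp add: y_def)
      next
        case 2
        then have "bind_pmf (pmf_of_set A) (\<lambda>a. bind_pmf (pmf_of_set A) (\<lambda>b. bind_pmf R (\<lambda>w.
            map_pmf (\<lambda>g. l h a b \<otimes>\<^bsub>G\<^esub> g) (walk G A (visits H w y))))) =
            bind_pmf R (\<lambda>w. bind_pmf (pmf_of_set A) (\<lambda>a. map_pmf (\<lambda>g. a \<otimes>\<^bsub>G\<^esub> g) (walk G A (visits H w y))))"
          by (simp add: l_def bind_commute_pmf [of R])
        also have "\<dots> = bind_pmf R (\<lambda>w. walk G A (Suc (visits H w y)))"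
          by (simp only: walk_Suc)
        finally show ?thesis using 2 by (simp add: y_def)
      next
        case 3
        have "map_pmf (\<lambda>g. \<one>\<^bsub>G\<^esub> \<otimes>\<^bsub>G\<^esub> g) (walk G A n) = walk G A n" for n
        proof -
          have "map_pmf (\<lambda>g. \<one>\<^bsub>G\<^esub> \<otimes>\<^bsub>G\<^esub> g) (walk G A n) = map_pmf (\<lambda>g. g) (walk G A n)"
            by (rule map_pmf_cong) (use G.set_walk_subset [OF A, of n] in auto)
          then show ?thesis by simp
        qed
        then show ?thesis using 3 by (simp add: l_def y_def)
      qed
    qed
    then show "bind_pmf (pmf_of_set A) (\<lambda>a. bind_pmf (pmf_of_set A) (\<lambda>b.
        map_pmf (\<lambda>p. fst (switch_walk_switch G H a h b \<otimes>\<^bsub>W\<^esub> p) z) (walk W gens t))) =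
        bind_pmf R (\<lambda>w. walk G A (visits H (h # w) z))"
      by (simp only: lamp)
  qed
  also have "\<dots> = bind_pmf (replicate_pmf (Suc t) (pmf_of_set S)) (\<lambda>w. walk G A (visits H w z))"
    by (simp add: R_def bind_assoc_pmf bind_return_pmf)
  finally show ?case .
qed

end

section \<open>Local times\<close>

lemma finite_set_replicate_pmf:
  assumes "finite (set_pmf p)"
  shows "finite (set_pmf (replicate_pmf n p))"
proof -
  have "set_pmf (replicate_pmf n p) = {xs. set xs \<subseteq> set_pmf p \<and> length xs = n}"
    by (auto simp: set_replicate_pmf in_lists_conv_set)
  then show ?thesis using finite_lists_length_eq [OF assms, of n] by simp
qed

lemma expectation_replicate_pmf_Suc:
  fixes F :: "'a list \<Rightarrow> real"
  assumes "finite S" "S \<noteq> {}"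
  shows "measure_pmf.expectation (replicate_pmf (Suc t) (pmf_of_set S)) F =
     (\<Sum>h\<in>S. measure_pmf.expectation (replicate_pmf t (pmf_of_set S)) (\<lambda>w. F (h # w))) / real (card S)"
proof -
  have fin: "finite (set_pmf (replicate_pmf t (pmf_of_set S)))"
    using assms by (intro finite_set_replicate_pmf) simp
  have "replicate_pmf (Suc t) (pmf_of_set S) = bind_pmf (pmf_of_set S) (\<lambda>h. map_pmf (\<lambda>w. h # w) (replicate_pmf t (pmf_of_set S)))"
    by (simp add: map_pmf_def)
  then show ?thesis
    using assms fin by (simp add: pmf_expectation_bind_pmf_of_set divide_inverse mult.commute sum_distrib_left)
qed

context group
begin

abbreviation expect_visits :: "'a set \<Rightarrow> nat \<Rightarrow> (nat \<Rightarrow> real) \<Rightarrow> 'a \<Rightarrow> real" where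
  "expect_visits S t F z \<equiv> measure_pmf.expectation (replicate_pmf t (pmf_of_set S)) (\<lambda>w. F (visits G w z))"

text \<open>The summand with index \<open>j\<close> accounts for the departure of step \<open>j + 1\<close> from \<open>z\<close> and for its
  arrival there.\<close>

lemma expectation_visits:
  assumes S: "sym_gen_set G S" and z: "z \<in> carrier G"
  shows "expect_visits S t real z = (\<Sum>j<t. pmf (walk G S j) z + pmf (walk G S (Suc j)) z)"
  using z
proof (induction t arbitrary: z)
  case 0
  then show ?case by simp
next
  case (Suc t)
  have finS: "finite S" "S \<noteq> {}" and SG: "S \<subseteq> carrier G" and invS: "\<And>s. s \<in> S \<Longrightarrow> inv s \<in> S"
    using S by (auto simp: sym_gen_set_def)
  have card: "real (card S) > 0" using finS by (simp add: card_gt_0_iff)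
  have fin: "finite (set_pmf (replicate_pmf t (pmf_of_set S)))"
    using finS by (intro finite_set_replicate_pmf) simp
  have int: "integrable (replicate_pmf t (pmf_of_set S)) (F :: _ \<Rightarrow> real)" for F
    by (rule integrable_measure_pmf_finite [OF fin])
  let ?p = "\<lambda>j x. pmf (walk G S j) x"
  have avg: "(\<Sum>h\<in>S. ?p j (inv h \<otimes> z)) = real (card S) * ?p (Suc j) z" for j
  proof -
    have "(\<Sum>h\<in>S. ?p j (inv h \<otimes> z)) = (\<Sum>h\<in>S. ?p j (h \<otimes> z))"
      by (rule sum.reindex_bij_witness [where i = "\<lambda>s. inv s" and j = "\<lambda>s. inv s"])
         (use invS SG in auto)
    then show ?thesis using card by (simp add: pmf_walk_Suc [OF S Suc.prems])
  qed
  have step: "measure_pmf.expectation (replicate_pmf t (pmf_of_set S)) (\<lambda>w. real (visits G (h # w) z))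
      = ?p 0 z + ?p 0 (inv h \<otimes> z) + (\<Sum>j<t. ?p j (inv h \<otimes> z) + ?p (Suc j) (inv h \<otimes> z))" if h: "h \<in> S" for h
  proof -
    have hG: "h \<in> carrier G" using h SG by auto
    have "z = h \<longleftrightarrow> inv h \<otimes> z = \<one>"
      using hG Suc.prems by (metis inv_equality inv_inv inv_closed l_inv)
    then have "of_bool (z = h) = ?p 0 (inv h \<otimes> z)" "of_bool (z = \<one>) = ?p 0 z" by auto
    moreover have "inv h \<otimes> z \<in> carrier G" using hG Suc.prems by simp
    ultimately show ?thesis using int by (simp add: Suc.IH)
  qed
  have "expect_visits S (Suc t) real z = (\<Sum>h\<in>S. ?p 0 z + ?p 0 (inv h \<otimes> z) +
        (\<Sum>j<t. ?p j (inv h \<otimes> z) + ?p (Suc j) (inv h \<otimes> z))) / real (card S)"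
    unfolding expectation_replicate_pmf_Suc [OF finS]
    by (intro arg_cong2 [where f = "(/)"] sum.cong refl step)
  also have "(\<Sum>h\<in>S. ?p 0 z + ?p 0 (inv h \<otimes> z) + (\<Sum>j<t. ?p j (inv h \<otimes> z) + ?p (Suc j) (inv h \<otimes> z)))
      = real (card S) * ?p 0 z + real (card S) * ?p (Suc 0) z
          + (\<Sum>j<t. real (card S) * ?p (Suc j) z + real (card S) * ?p (Suc (Suc j)) z)"
  proof -
    have "(\<Sum>h\<in>S. \<Sum>j<t. ?p j (inv h \<otimes> z) + ?p (Suc j) (inv h \<otimes> z))
        = (\<Sum>j<t. \<Sum>h\<in>S. ?p j (inv h \<otimes> z) + ?p (Suc j) (inv h \<otimes> z))" by (rule sum.swap)
    also have "\<dots> = (\<Sum>j<t. real (card S) * ?p (Suc j) z + real (card S) * ?p (Suc (Suc j)) z)"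
      by (intro sum.cong refl) (simp only: sum.distrib avg)
    finally show ?thesis by (simp only: sum.distrib avg sum_constant)
  qed
  also have "\<dots> / real (card S) = ?p 0 z + ?p (Suc 0) z + (\<Sum>j<t. ?p (Suc j) z + ?p (Suc (Suc j)) z)"
    using card by (simp add: add_divide_distrib sum_divide_distrib)
  also have "\<dots> = (\<Sum>j<Suc t. ?p j z + ?p (Suc j) z)"
    by (simp only: sum.lessThan_Suc_shift)
  finally show ?case .
qed

text \<open>At the time of a visit to \<open>z\<close>, the expected number of later visits is at most \<open>V\<close>. The square counts
  pairs of visits, and the pairs with two different entries are counted twice. Since \<open>\<one> \<notin> S\<close>, a
  single step counts at most once.\<close>

lemma expectation_visits_sq_le:
  assumes S: "sym_gen_set G S" and one_S: "\<one> \<notin> S" and z: "z \<in> carrier G"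
    and V: "\<And>s y. s < t \<Longrightarrow> y \<in> carrier G \<Longrightarrow> expect_visits S s real y \<le> V"
  shows "expect_visits S t (\<lambda>n. (real n)\<^sup>2) z \<le> (1 + 2 * V) * expect_visits S t real z"
  using z V
proof (induction t arbitrary: z)
  case 0
  then show ?case by simp
next
  case (Suc t)
  have finS: "finite S" "S \<noteq> {}" and SG: "S \<subseteq> carrier G" using S by (auto simp: sym_gen_set_def)
  have fin: "finite (set_pmf (replicate_pmf t (pmf_of_set S)))"
    using finS by (intro finite_set_replicate_pmf) simp
  have int: "integrable (replicate_pmf t (pmf_of_set S)) (F :: _ \<Rightarrow> real)" for F
    by (rule integrable_measure_pmf_finite [OF fin])
  let ?E = "\<lambda>F. measure_pmf.expectation (replicate_pmf t (pmf_of_set S)) F"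
  have step: "?E (\<lambda>w. (real (visits G (h # w) z))\<^sup>2) \<le> (1 + 2 * V) * ?E (\<lambda>w. real (visits G (h # w) z))"
    if h: "h \<in> S" for h
  proof -
    define d :: real where "d = of_bool (z = \<one>) + of_bool (z = h)"
    have "h \<noteq> \<one>" using h one_S by auto
    then have d: "d\<^sup>2 = d" "0 \<le> d" by (auto simp: d_def)
    define y where "y = inv h \<otimes> z"
    have yG: "y \<in> carrier G" using h SG Suc.prems(1) by (auto simp: y_def)
    let ?v = "\<lambda>w. real (visits G w y)"
    have v: "real (visits G (h # w) z) = d + ?v w" for w by (simp add: d_def y_def)
    have "?E (\<lambda>w. (real (visits G (h # w) z))\<^sup>2) = ?E (\<lambda>w. d + 2 * d * ?v w + (?v w)\<^sup>2)"
      unfolding v by (simp add: power2_sum d(1))  (simp add: algebra_simps)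
    also have "\<dots> = d + 2 * d * ?E ?v + ?E (\<lambda>w. (?v w)\<^sup>2)" using int by simp
    also have "\<dots> \<le> d + 2 * d * V + (1 + 2 * V) * ?E ?v"
    proof (intro add_mono mult_left_mono)
      show "?E ?v \<le> V" using Suc.prems(2) [of t y] yG by simp
      show "?E (\<lambda>w. (?v w)\<^sup>2) \<le> (1 + 2 * V) * ?E ?v"
        using Suc.prems(2) by (intro Suc.IH yG) simp
    qed (use d in auto)
    also have "\<dots> = (1 + 2 * V) * ?E (\<lambda>w. d + ?v w)" using int by (simp add: algebra_simps)
    finally show ?thesis by (simp only: v)
  qed
  have "(\<Sum>h\<in>S. ?E (\<lambda>w. (real (visits G (h # w) z))\<^sup>2)) \<le> (\<Sum>h\<in>S. (1 + 2 * V) * ?E (\<lambda>w. real (visits G (h # w) z)))"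
    by (intro sum_mono step)
  then show ?case
    unfolding expectation_replicate_pmf_Suc [OF finS] sum_distrib_left [symmetric] times_divide_eq_right
    by (rule divide_right_mono) simp
qed

lemma expectation_visits_le:
  assumes S: "sym_gen_set G S" and z: "z \<in> carrier G"
  shows "expect_visits S t real z \<le> 2 * (\<Sum>j<t. collision_prob S (j div 2))"
proof -
  have "expect_visits S t real z = (\<Sum>j<t. pmf (walk G S j) z + pmf (walk G S (Suc j)) z)"
    by (rule expectation_visits [OF S z])
  also have "\<dots> \<le> (\<Sum>j<t. 2 * collision_prob S (j div 2))"
  proof (rule sum_mono)
    fix j
    have "collision_prob S (Suc j div 2) \<le> collision_prob S (j div 2)"
      by (intro collision_prob_antimono S div_le_mono) simp
    then show "pmf (walk G S j) z + pmf (walk G S (Suc j)) z \<le> 2 * collision_prob S (j div 2)"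
      using pmf_walk_le_collision_prob [OF S z, of j] pmf_walk_le_collision_prob [OF S z, of "Suc j"] by linarith
  qed
  finally show ?thesis by (simp add: sum_distrib_left)
qed

end

text \<open>A substitute for Hoelder's inequality: it bounds the moment of order \<open>\<beta>\<close> of a random number \<open>n\<close>
  from below by its first two moments. With \<open>x = n / m\<close> it says \<open>x - x\<^sup>2 \<le> x\<^bsup>\<beta>\<^esup>\<close>.\<close>

lemma powr_ge_quadratic:
  fixes m \<beta> :: real
  assumes "m > 0" "0 \<le> \<beta>" "\<beta> \<le> 1"
  shows "m powr \<beta> * (real n / m - (real n)\<^sup>2 / m\<^sup>2) \<le> real n powr \<beta>"
proof (cases "n = 0")
  case False
  define x where "x = real n / m"
  have x: "x > 0" using False assms by (simp add: x_def)
  have "x - x\<^sup>2 \<le> x powr \<beta>"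
  proof (cases "x \<le> 1")
    case True
    have "x - x\<^sup>2 \<le> x powr 1" using x by simp
    also have "\<dots> \<le> x powr \<beta>" using True x assms by (intro powr_mono') auto
    finally show ?thesis .
  next
    case False
    then have "x * 1 \<le> x * x" using x by (intro mult_left_mono) auto
    then have "x - x\<^sup>2 \<le> 0" by (simp add: power2_eq_square)
    then show ?thesis using powr_ge_zero [of x \<beta>] by linarith
  qed
  then have "m powr \<beta> * (x - x\<^sup>2) \<le> m powr \<beta> * x powr \<beta>" by (rule mult_left_mono) simp
  also have "\<dots> = real n powr \<beta>"
    using assms x by (simp add: powr_mult [symmetric] x_def)
  finally show ?thesis by (simp add: x_def power_divide)
qed simp

context wreath_walk
begin

text \<open>The quadratic bound is used with \<open>m = 2 K\<close>, where \<open>K\<close> bounds the ratio of the second to the first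
  moment of the number of visits; this choice makes the negative term at most half the positive one.\<close>

lemma speed_ge:
  assumes c: "c > 0" and \<beta>: "0 \<le> \<beta>" "\<beta> \<le> 1"
    and G_speed: "\<And>n. c * real n powr \<beta> \<le>
       measure_pmf.expectation (walk G A n) (\<lambda>g. real (word_dist G A g \<one>\<^bsub>G\<^esub>))"
  shows "c / 4 * real t * (1 + 4 * (\<Sum>j<t. H.collision_prob S (j div 2))) powr (\<beta> - 1)
    \<le> measure_pmf.expectation (walk W gens t) (\<lambda>p. real (word_dist W gens p \<one>\<^bsub>W\<^esub>))"
proof -
  define V where "V = 2 * (\<Sum>j<t. H.collision_prob S (j div 2))"
  define K where "K = 1 + 2 * V"
  define m where "m = 2 * K"
  have V0: "V \<ge> 0" unfolding V_def using H.collision_prob_pos [OF S] by (intro mult_nonneg_nonneg sum_nonneg) (auto intro: less_imp_le)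
  then have K: "K \<ge> 1" and m: "m > 0" by (auto simp: K_def m_def)
  define Z where "Z = (\<Union>j\<le>t. set_pmf (walk H S j))"
  have finZ: "finite Z" unfolding Z_def using finite_set_walk [OF S] by auto
  have ZH: "Z \<subseteq> carrier H" unfolding Z_def using H.set_walk_subset [OF S] by blast
  define R where "R = replicate_pmf t (pmf_of_set S)"
  have finR: "finite (set_pmf R)" unfolding R_def using S_sub by (intro finite_set_replicate_pmf) simp
  have intR: "integrable R (F :: _ \<Rightarrow> real)" for F by (rule integrable_measure_pmf_finite [OF finR])
  have finW: "finite (set_pmf (walk W gens t))" by (rule finite_set_walk [OF sym_gen_set_gens])
  have intW: "integrable (walk W gens t) (F :: _ \<Rightarrow> real)" for F by (rule integrable_measure_pmf_finite [OF finW])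
  let ?d = "\<lambda>g. real (word_dist G A g \<one>\<^bsub>G\<^esub>)"
  have lamp: "measure_pmf.expectation (walk W gens t) (\<lambda>p. ?d (fst p z)) \<ge>
       c * m powr \<beta> / (4 * K) * H.expect_visits S t real z" if z: "z \<in> carrier H" for z
  proof -
    let ?n = "\<lambda>w. real (visits H w z)"
    have sq: "measure_pmf.expectation R (\<lambda>w. (?n w)\<^sup>2) \<le> K * measure_pmf.expectation R ?n"
      unfolding R_def K_def
    proof (rule H.expectation_visits_sq_le [OF S one_S z])
      fix s y assume s: "s < t" and y: "y \<in> carrier H"
      have "H.expect_visits S s real y \<le> 2 * (\<Sum>j<s. H.collision_prob S (j div 2))"
        by (rule H.expectation_visits_le [OF S y])
      also have "\<dots> \<le> V"
        unfolding V_def using s H.collision_prob_pos [OF S]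
        by (intro mult_left_mono sum_mono2) (auto intro: less_imp_le)
      finally show "H.expect_visits S s real y \<le> V" .
    qed
    have "c * m powr \<beta> / (4 * K) * measure_pmf.expectation R ?n
        = c * m powr \<beta> * (measure_pmf.expectation R ?n / m - K * measure_pmf.expectation R ?n / m\<^sup>2)"
      using K by (simp add: m_def field_simps power2_eq_square)
    also have "\<dots> \<le> c * m powr \<beta> * (measure_pmf.expectation R ?n / m - measure_pmf.expectation R (\<lambda>w. (?n w)\<^sup>2) / m\<^sup>2)"
      using c sq by (intro mult_left_mono diff_left_mono divide_right_mono) auto
    also have "\<dots> = measure_pmf.expectation R (\<lambda>w. c * (m powr \<beta> * (?n w / m - (?n w)\<^sup>2 / m\<^sup>2)))"
      using intR by simp
    also have "\<dots> \<le> measure_pmf.expectation R (\<lambda>w. measure_pmf.expectation (walk G A (visits H w z)) ?d)"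
    proof (rule integral_mono [OF intR intR])
      fix w
      have "c * (m powr \<beta> * (?n w / m - (?n w)\<^sup>2 / m\<^sup>2)) \<le> c * ?n w powr \<beta>"
        using c by (intro mult_left_mono powr_ge_quadratic m \<beta>) auto
      also have "\<dots> \<le> measure_pmf.expectation (walk G A (visits H w z)) ?d" by (rule G_speed)
      finally show "c * (m powr \<beta> * (?n w / m - (?n w)\<^sup>2 / m\<^sup>2)) \<le> measure_pmf.expectation (walk G A (visits H w z)) ?d" .
    qed
    also have "\<dots> = measure_pmf.expectation (bind_pmf R (\<lambda>w. walk G A (visits H w z))) ?d"
    proof -
      have "measure_pmf.expectation (bind_pmf R (\<lambda>w. walk G A (visits H w z))) ?d
          = (\<Sum>w\<in>set_pmf R. pmf R w *\<^sub>R measure_pmf.expectation (walk G A (visits H w z)) ?d)"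
        by (rule pmf_expectation_bind [OF finR]) (auto intro: finite_set_walk [OF A])
      also have "\<dots> = measure_pmf.expectation R (\<lambda>w. measure_pmf.expectation (walk G A (visits H w z)) ?d)"
        by (subst integral_measure_pmf_real [OF finR]) (auto simp: mult.commute)
      finally show ?thesis by simp
    qed
    also have "bind_pmf R (\<lambda>w. walk G A (visits H w z)) = map_pmf (\<lambda>p. fst p z) (walk W gens t)"
      unfolding R_def by (rule law_of_lamp [OF z, symmetric])
    finally show ?thesis by (simp add: R_def)
  qed
  \<comment> \<open>The finite set \<open>Z\<close> contains all positions up to time \<open>t\<close>.\<close>
  have total: "(\<Sum>z\<in>Z. H.expect_visits S t real z) = 2 * real t"
  proof -
    have "(\<Sum>z\<in>Z. H.expect_visits S t real z) = (\<Sum>z\<in>Z. \<Sum>j<t. pmf (walk H S j) z + pmf (walk H S (Suc j)) z)"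
      by (intro sum.cong refl H.expectation_visits [OF S]) (use ZH in auto)
    also have "\<dots> = (\<Sum>j<t. \<Sum>z\<in>Z. pmf (walk H S j) z + pmf (walk H S (Suc j)) z)" by (rule sum.swap)
    also have "\<dots> = (\<Sum>j<t. 2)"
    proof (rule sum.cong [OF refl])
      fix j assume "j \<in> {..<t}"
      then have "j \<in> {..t}" "Suc j \<in> {..t}" by auto
      then have "set_pmf (walk H S j) \<subseteq> Z" "set_pmf (walk H S (Suc j)) \<subseteq> Z"
        unfolding Z_def by blast+
      then show "(\<Sum>z\<in>Z. pmf (walk H S j) z + pmf (walk H S (Suc j)) z) = 2"
        using finZ by (simp add: sum.distrib sum_pmf_eq_1)
    qed
    finally show ?thesis by simp
  qed
  have "c * m powr \<beta> / (4 * K) * (2 * real t) = (\<Sum>z\<in>Z. c * m powr \<beta> / (4 * K) * H.expect_visits S t real z)"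
    by (simp only: total [symmetric] sum_distrib_left)
  also have "\<dots> \<le> (\<Sum>z\<in>Z. measure_pmf.expectation (walk W gens t) (\<lambda>p. ?d (fst p z)))"
    by (intro sum_mono lamp) (use ZH in auto)
  also have "\<dots> = measure_pmf.expectation (walk W gens t) (\<lambda>p. \<Sum>z\<in>Z. ?d (fst p z))"
    by (rule Bochner_Integration.integral_sum [symmetric]) (rule intW)
  also have "\<dots> \<le> measure_pmf.expectation (walk W gens t) (\<lambda>p. 2 * real (word_dist W gens p \<one>\<^bsub>W\<^esub>))"
  proof (rule integral_mono_AE [OF intW intW], rule AE_pmfI)
    fix p assume "p \<in> set_pmf (walk W gens t)"
    then have "p \<in> carrier W" using W.set_walk_subset [OF sym_gen_set_gens] by blast
    then obtain w where w: "set w \<subseteq> gens" "length w = word_dist W gens p \<one>\<^bsub>W\<^esub>" "word_prod W w = p"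
      using W.word_dist_attained [OF sym_gen_set_gens] by blast
    have "(\<Sum>z\<in>Z. word_dist G A (fst p z) \<one>\<^bsub>G\<^esub>) \<le> 2 * word_dist W gens p \<one>\<^bsub>W\<^esub>"
      using sum_lamp_lengths_le [OF w(1) finZ ZH] by (simp add: w)
    then have "real (\<Sum>z\<in>Z. word_dist G A (fst p z) \<one>\<^bsub>G\<^esub>) \<le> real (2 * word_dist W gens p \<one>\<^bsub>W\<^esub>)"
      by (simp only: of_nat_le_iff)
    then show "(\<Sum>z\<in>Z. ?d (fst p z)) \<le> 2 * real (word_dist W gens p \<one>\<^bsub>W\<^esub>)" by simp
  qed
  finally have main: "c * m powr \<beta> / (4 * K) * (2 * real t) \<le>
      2 * measure_pmf.expectation (walk W gens t) (\<lambda>p. real (word_dist W gens p \<one>\<^bsub>W\<^esub>))" by simp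
  have "K powr (\<beta> - 1) \<le> m powr \<beta> / K"
  proof -
    have "K powr \<beta> \<le> m powr \<beta>" using K \<beta> by (intro powr_mono2) (auto simp: m_def)
    then have "K powr \<beta> / K \<le> m powr \<beta> / K" using K by (intro divide_right_mono) auto
    then show ?thesis using K by (simp add: powr_diff)
  qed
  then have "c / 4 * real t * K powr (\<beta> - 1) \<le> c / 4 * real t * (m powr \<beta> / K)"
    using c by (intro mult_left_mono) auto
  also have "\<dots> \<le> measure_pmf.expectation (walk W gens t) (\<lambda>p. real (word_dist W gens p \<one>\<^bsub>W\<^esub>))"
    using main K by (simp add: field_simps)
  finally show ?thesis by (simp add: K_def V_def)
qed

end

section \<open>Lazy walks and elementary bounds on speed exponents\<close>

context group
begin

lemma expectation_word_dist_le:
  assumes S: "sym_gen_set G S"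
  shows "measure_pmf.expectation (walk G S t) (\<lambda>x. real (word_dist G S x \<one>)) \<le> real t"
proof -
  have fin: "finite (set_pmf (walk G S t))" by (rule finite_set_walk [OF S])
  have "measure_pmf.expectation (walk G S t) (\<lambda>x. real (word_dist G S x \<one>)) \<le> measure_pmf.expectation (walk G S t) (\<lambda>x. real t)"
  proof (rule integral_mono_AE, rule integrable_measure_pmf_finite [OF fin], simp, rule AE_pmfI)
    fix x assume "x \<in> set_pmf (walk G S t)"
    then obtain w where "set w \<subseteq> S" "length w = t" "x = word_prod G w" by (auto simp: set_walk [OF S])
    then show "real (word_dist G S x \<one>) \<le> real t" using word_dist_le_length [OF S] by auto
  qed
  then show ?thesis by simp
qed

lemma speed_exponent_le_1:
  assumes "speed_exponent G \<beta>"
  shows "\<beta> \<le> 1"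
proof (rule ccontr)
  assume "\<not> \<beta> \<le> 1"
  then have b: "\<beta> - 1 > 0" by simp
  obtain S c where S: "sym_gen_set G S" and c: "c > 0"
    and le: "\<forall>t::nat. measure_pmf.expectation (walk G S t) (\<lambda>x. real (word_dist G S x \<one>)) \<ge> c * real t powr \<beta>"
    using assms unfolding speed_exponent_def by blast
  obtain t :: nat where "max 1 ((2 / c) powr (1 / (\<beta> - 1))) < real t"
    using reals_Archimedean2 by blast
  then have t: "real t > (2 / c) powr (1 / (\<beta> - 1))" "t \<ge> 1" by auto
  have "2 / c = ((2 / c) powr (1 / (\<beta> - 1))) powr (\<beta> - 1)" using b c by (simp add: powr_powr)
  also have "\<dots> \<le> real t powr (\<beta> - 1)" using t b by (intro powr_mono2) auto
  finally have "2 * real t \<le> c * (real t powr (\<beta> - 1) * real t)" using c t by (simp add: field_simps)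
  also have "real t powr (\<beta> - 1) * real t = real t powr \<beta>" using t by (simp add: powr_diff)
  also have "c * real t powr \<beta> \<le> real t"
    using le expectation_word_dist_le [OF S, of t] by (meson order_trans)
  finally show False using t by simp
qed

lemma bdd_above_speed_exponents: "bdd_above {\<beta>. speed_exponent G \<beta>}"
  using speed_exponent_le_1 by (auto simp: bdd_above_def)

text \<open>Every element is the position at time \<open>n + 1\<close> with probability at most \<open>1 / card S\<close>, so with at least two
  generators the walk is away from the identity with probability at least \<open>1/2\<close>.\<close>

lemma speed_exponent_0:
  assumes fg: "finitely_generated G" and inf: "infinite (carrier G)"
  shows "speed_exponent G 0"
proof -
  obtain S0 where S0: "sym_gen_set G S0" "\<one> \<notin> S0" using sym_gen_set_without_one [OF fg inf] .
  define S where "S = insert \<one> S0"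
  have S: "sym_gen_set G S" unfolding S_def by (rule sym_gen_set_insert_one [OF S0(1)])
  have finS: "finite S" "S \<noteq> {}" and SG: "S \<subseteq> carrier G" using S by (auto simp: sym_gen_set_def)
  have "S0 \<noteq> {}" "finite S0" using S0 by (auto simp: sym_gen_set_def)
  then have cardS: "2 \<le> card S" using S0(2) by (simp add: S_def Suc_le_eq card_gt_0_iff)
  have "1 / 2 * real t powr 0 \<le> measure_pmf.expectation (walk G S t) (\<lambda>x. real (word_dist G S x \<one>))" for t
  proof (cases t)
    case 0
    then show ?thesis using S by simp
  next
    case (Suc n)
    let ?W = "walk G S t"
    have fin: "finite (set_pmf ?W)" by (rule finite_set_walk [OF S])
    have "pmf ?W \<one> = (\<Sum>s\<in>S. pmf (walk G S n) (s \<otimes> \<one>)) / real (card S)"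
      unfolding Suc by (rule pmf_walk_Suc [OF S]) simp
    also have "(\<Sum>s\<in>S. pmf (walk G S n) (s \<otimes> \<one>)) = (\<Sum>s\<in>S. pmf (walk G S n) s)"
      by (rule sum.cong) (use SG in auto)
    also have "\<dots> = measure (walk G S n) S" using finS by (simp add: measure_measure_pmf_finite)
    also have "measure (walk G S n) S / real (card S) \<le> 1 / real (card S)"
      by (intro divide_right_mono) auto
    also have "\<dots> \<le> 1 / 2" using cardS by (simp add: field_simps)
    finally have half: "pmf ?W \<one> \<le> 1 / 2" .
    have "1 / 2 \<le> 1 - pmf ?W \<one>" using half by simp
    also have "\<dots> = measure_pmf.expectation ?W (\<lambda>x. 1 - indicator {\<one>} x)"
      using integrable_measure_pmf_finite [OF fin, of "\<lambda>x. indicator {\<one>} x :: real"]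
      by (simp add: measure_pmf_single)
    also have "\<dots> \<le> measure_pmf.expectation ?W (\<lambda>x. real (word_dist G S x \<one>))"
    proof (rule integral_mono_AE, rule integrable_measure_pmf_finite [OF fin],
        rule integrable_measure_pmf_finite [OF fin], rule AE_pmfI)
      fix x assume "x \<in> set_pmf ?W"
      then have xG: "x \<in> carrier G" using set_walk_subset [OF S] by blast
      show "1 - indicator {\<one>} x \<le> real (word_dist G S x \<one>)"
        using word_dist_pos [OF S xG] by (cases "x = \<one>") (auto simp: indicator_def)
    qed
    finally show ?thesis using Suc by simp
  qed
  then show ?thesis unfolding speed_exponent_def using S by (intro conjI exI [of _ S] exI [of _ "1 / 2"]) auto
qed

text \<open>The walk with the identity added to the generators makes each of its steps with probability \<open>q\<close> and
  rests otherwise.\<close>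

lemma walk_insert_one:
  assumes S: "sym_gen_set G S" and one_S: "\<one> \<notin> S"
  defines "q \<equiv> real (card S) / real (card S + 1)"
  shows "walk G (insert \<one> S) t = bind_pmf (binomial_pmf t q) (walk G S)"
proof (induction t)
  case 0
  have "q \<in> {0..1}" by (auto simp: q_def)
  then show ?case by (simp add: binomial_pmf_0 bind_return_pmf)
next
  case (Suc t)
  have finS: "finite S" "S \<noteq> {}" and SG: "S \<subseteq> carrier G" using S by (auto simp: sym_gen_set_def)
  have q: "q \<in> {0..1}" by (auto simp: q_def)
  have step: "pmf_of_set (insert \<one> S) = bind_pmf (bernoulli_pmf q) (\<lambda>b. if b then pmf_of_set S else return_pmf \<one>)"
  proof (rule pmf_eqI)
    fix x
    have "pmf (bind_pmf (bernoulli_pmf q) (\<lambda>b. if b then pmf_of_set S else return_pmf \<one>)) x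
        = q * pmf (pmf_of_set S) x + (1 - q) * pmf (return_pmf \<one>) x"
      using q by (simp add: pmf_bind)
    also have "\<dots> = pmf (pmf_of_set (insert \<one> S)) x"
    proof -
      have N: "real (card S) > 0" using finS by (simp add: card_gt_0_iff)
      then have qN: "q / real (card S) = 1 / real (card S + 1)" by (simp add: q_def)
      have q1: "1 - q = 1 / real (card S + 1)" by (simp add: q_def diff_divide_eq_iff)
      consider "x = \<one>" "x \<notin> S" | "x \<noteq> \<one>" "x \<in> S" | "x \<noteq> \<one>" "x \<notin> S" using one_S by blast
      then show ?thesis
        by cases (use finS one_S qN q1 in \<open>simp_all add: indicator_def\<close>)
    qed
    finally show "pmf (pmf_of_set (insert \<one> S)) x
       = pmf (bind_pmf (bernoulli_pmf q) (\<lambda>b. if b then pmf_of_set S else return_pmf \<one>)) x" by simp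
  qed
  have id: "map_pmf (\<lambda>x. \<one> \<otimes> x) (walk G S k) = walk G S k" for k
  proof -
    have "map_pmf (\<lambda>x. \<one> \<otimes> x) (walk G S k) = map_pmf (\<lambda>x. x) (walk G S k)"
      by (rule map_pmf_cong) (use set_walk_subset [OF S, of k] in auto)
    then show ?thesis by simp
  qed
  let ?B = "binomial_pmf t q"
  have "walk G (insert \<one> S) (Suc t) = bind_pmf (bernoulli_pmf q)
      (\<lambda>b. bind_pmf (if b then pmf_of_set S else return_pmf \<one>)
        (\<lambda>s. bind_pmf ?B (\<lambda>k. map_pmf (\<lambda>x. s \<otimes> x) (walk G S k))))"
    by (simp add: walk_Suc step bind_assoc_pmf Suc.IH map_bind_pmf)
  also have "\<dots> = bind_pmf (bernoulli_pmf q) (\<lambda>b. bind_pmf ?B (\<lambda>k. walk G S ((if b then 1 else 0) + k)))"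
  proof (rule bind_pmf_cong [OF refl])
    fix b
    show "bind_pmf (if b then pmf_of_set S else return_pmf \<one>)
        (\<lambda>s. bind_pmf ?B (\<lambda>k. map_pmf (\<lambda>x. s \<otimes> x) (walk G S k)))
      = bind_pmf ?B (\<lambda>k. walk G S ((if b then 1 else 0) + k))"
    proof (cases b)
      case True
      then show ?thesis by (simp add: walk_Suc bind_commute_pmf [of ?B])
    next
      case False
      then show ?thesis by (simp add: bind_return_pmf id)
    qed
  qed
  also have "\<dots> = bind_pmf (binomial_pmf (Suc t) q) (walk G S)"
    using q by (simp add: binomial_pmf_Suc bind_assoc_pmf bind_return_pmf)
  finally show ?case .
qed

lemma word_dist_insert_one:
  assumes S: "sym_gen_set G S" and x: "x \<in> carrier G"
  shows "word_dist G S x \<one> \<le> word_dist G (insert \<one> S) x \<one>"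
proof -
  have SG: "S \<subseteq> carrier G" using S by (auto simp: sym_gen_set_def)
  obtain w where w: "set w \<subseteq> insert \<one> S" "length w = word_dist G (insert \<one> S) x \<one>" "word_prod G w = x"
    using word_dist_attained [OF sym_gen_set_insert_one [OF S] x] .
  define v where "v = filter (\<lambda>s. s \<noteq> \<one>) w"
  have "word_prod G (filter (\<lambda>s. s \<noteq> \<one>) w) = word_prod G w" if "set w \<subseteq> carrier G" for w
    using that by (induction w) auto
  then have "word_prod G v = x" using w SG by (auto simp: v_def)
  moreover have "set v \<subseteq> S" using w by (auto simp: v_def)
  ultimately have "word_dist G S x \<one> \<le> length v" using word_dist_le_length [OF S] by blast
  also have "\<dots> \<le> length w" by (simp add: v_def)
  finally show ?thesis using w by simp
qed

text \<open>If \<open>k \<le> t\<close> is the number of steps the lazy walk makes up to time \<open>t\<close>, then \<open>k\<^bsup>\<beta>\<^esup> \<ge> k t\<^bsup>\<beta>-1\<^esup>\<close>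
  as \<open>\<beta> \<le> 1\<close>, and the expectation of \<open>k\<close> is \<open>q t\<close>.\<close>

lemma speed_exponent_with_one:
  assumes "speed_exponent G \<beta>"
  obtains S c where "sym_gen_set G S" "\<one> \<in> S" "c > 0"
    "\<forall>t::nat. c * real t powr \<beta> \<le> measure_pmf.expectation (walk G S t) (\<lambda>x. real (word_dist G S x \<one>))"
proof -
  obtain S c where S: "sym_gen_set G S" and c: "c > 0" and b0: "\<beta> \<ge> 0"
    and speed: "\<forall>t::nat. measure_pmf.expectation (walk G S t) (\<lambda>x. real (word_dist G S x \<one>)) \<ge> c * real t powr \<beta>"
    using assms unfolding speed_exponent_def by blast
  have b1: "\<beta> \<le> 1" by (rule speed_exponent_le_1 [OF assms])
  show thesis
  proof (cases "\<one> \<in> S")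
    case True
    then show thesis using that S c speed by blast
  next
    case False
    have finS: "finite S" "S \<noteq> {}" using S by (auto simp: sym_gen_set_def)
    define q where "q = real (card S) / real (card S + 1)"
    have q: "q > 0" "q \<in> {0..1}" using finS by (auto simp: q_def card_gt_0_iff)
    let ?S = "insert \<one> S"
    have S': "sym_gen_set G ?S" by (rule sym_gen_set_insert_one [OF S])
    have "c * q * real t powr \<beta> \<le> measure_pmf.expectation (walk G ?S t) (\<lambda>x. real (word_dist G ?S x \<one>))" for t
    proof -
      let ?B = "binomial_pmf t q"
      have finB: "finite (set_pmf ?B)" by (rule finite_set_pmf_binomial_pmf [OF q(2)])
      have intB: "integrable ?B (F :: _ \<Rightarrow> real)" for F by (rule integrable_measure_pmf_finite [OF finB])
      have le_t: "k \<le> t" if "k \<in> set_pmf ?B" for k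
        using that q by (auto simp: set_pmf_binomial_eq split: if_splits)
      have mean: "measure_pmf.expectation ?B real = real t * q"
        using q(2)
      proof (induction t)
        case (Suc t)
        have eq: "binomial_pmf (Suc t) q = bind_pmf (bernoulli_pmf q) (\<lambda>b. map_pmf (\<lambda>k. of_bool b + k) (binomial_pmf t q))"
          using Suc.prems by (simp add: binomial_pmf_Suc map_pmf_def of_bool_def)
        have fin: "finite (set_pmf (binomial_pmf t q))" by (rule finite_set_pmf_binomial_pmf [OF Suc.prems])
        have int: "integrable (binomial_pmf t q) real" by (rule integrable_measure_pmf_finite [OF fin])
        have "measure_pmf.expectation (binomial_pmf (Suc t) q) real =
          (\<Sum>b\<in>UNIV. pmf (bernoulli_pmf q) b *\<^sub>R measure_pmf.expectation (map_pmf (\<lambda>k. of_bool b + k) (binomial_pmf t q)) real)"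
          unfolding eq by (rule pmf_expectation_bind) (use fin in auto)
        also have "\<dots> = q * (1 + real t * q) + (1 - q) * (real t * q)"
          using Suc.IH [OF Suc.prems] Suc.prems int by (simp add: UNIV_bool)
        finally show ?case by (simp add: algebra_simps)
      qed (simp add: binomial_pmf_0)
      have "c * q * real t powr \<beta> \<le> c * (measure_pmf.expectation ?B (\<lambda>k. real k * real t powr (\<beta> - 1)))"
        using intB mean c q by (cases "t = 0") (auto simp: powr_diff field_simps)
      also have "\<dots> = measure_pmf.expectation ?B (\<lambda>k. c * (real k * real t powr (\<beta> - 1)))" by simp
      also have "\<dots> \<le> measure_pmf.expectation ?B (\<lambda>k. measure_pmf.expectation (walk G S k) (\<lambda>x. real (word_dist G S x \<one>)))"
      proof (rule integral_mono_AE [OF intB intB], rule AE_pmfI)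
        fix k assume k: "k \<in> set_pmf ?B"
        have "real k * real t powr (\<beta> - 1) \<le> real k powr \<beta>"
        proof (cases "k = 0")
          case False
          have "real t powr (\<beta> - 1) \<le> real k powr (\<beta> - 1)"
            using b1 le_t [OF k] False by (intro powr_mono2') auto
          then have "real k * real t powr (\<beta> - 1) \<le> real k * real k powr (\<beta> - 1)" by (rule mult_left_mono) simp
          then show ?thesis using False by (simp add: powr_diff)
        qed simp
        then have "c * (real k * real t powr (\<beta> - 1)) \<le> c * real k powr \<beta>" using c by simp
        also have "\<dots> \<le> measure_pmf.expectation (walk G S k) (\<lambda>x. real (word_dist G S x \<one>))" using speed by blast
        finally show "c * (real k * real t powr (\<beta> - 1)) \<le> measure_pmf.expectation (walk G S k) (\<lambda>x. real (word_dist G S x \<one>))" .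
      qed
      also have "\<dots> = measure_pmf.expectation (walk G ?S t) (\<lambda>x. real (word_dist G S x \<one>))"
      proof -
        have "measure_pmf.expectation (walk G ?S t) (\<lambda>x. real (word_dist G S x \<one>))
          = (\<Sum>k\<in>set_pmf ?B. pmf ?B k *\<^sub>R measure_pmf.expectation (walk G S k) (\<lambda>x. real (word_dist G S x \<one>)))"
          unfolding walk_insert_one [OF S False] q_def [symmetric]
          by (rule pmf_expectation_bind [OF finB]) (auto intro: finite_set_walk [OF S])
        also have "\<dots> = measure_pmf.expectation ?B (\<lambda>k. measure_pmf.expectation (walk G S k) (\<lambda>x. real (word_dist G S x \<one>)))"
          by (subst integral_measure_pmf_real [OF finB]) (auto simp: mult.commute)
        finally show ?thesis by simp
      qed
      also have "\<dots> \<le> measure_pmf.expectation (walk G ?S t) (\<lambda>x. real (word_dist G ?S x \<one>))"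
      proof (rule integral_mono_AE, rule integrable_measure_pmf_finite [OF finite_set_walk [OF S']],
          rule integrable_measure_pmf_finite [OF finite_set_walk [OF S']], rule AE_pmfI)
        fix x assume "x \<in> set_pmf (walk G ?S t)"
        then have "x \<in> carrier G" using set_walk_subset [OF S'] by blast
        then show "real (word_dist G S x \<one>) \<le> real (word_dist G ?S x \<one>)"
          using word_dist_insert_one [OF S] by simp
      qed
      finally show ?thesis .
    qed
    then show thesis using that [OF S', of "c * q"] c q by simp
  qed
qed

end

section \<open>The speed exponent of a wreath product\<close>

lemma Suc_le_double_Suc_half: "real j + 1 \<le> 2 * (real (j div 2) + 1)"
proof -
  have "j + 1 \<le> 2 * (j div 2 + 1)" by presburger
  then have "real (j + 1) \<le> real (2 * (j div 2 + 1))" by (simp only: of_nat_le_iff)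
  then show ?thesis by simp
qed

lemma sum_inverse_sqrt_le: "(\<Sum>j<t. 1 / sqrt (real j + 1)) \<le> 2 * sqrt (real t)"
proof (induction t)
  case (Suc t)
  define a b where "a = sqrt (real t)" and "b = sqrt (real t + 1)"
  have ab: "a \<ge> 0" "b > 0" "b\<^sup>2 = a\<^sup>2 + 1" by (auto simp: a_def b_def)
  have "0 \<le> (b - a)\<^sup>2" by simp
  then have "2 * a * b \<le> 2 * b\<^sup>2 - 1" using ab(3) by (simp add: power2_diff mult.commute mult.left_commute)
  then have "(2 * a * b + 1) / b \<le> 2 * b\<^sup>2 / b" using ab(2) by (intro divide_right_mono) auto
  then have "2 * a + 1 / b \<le> 2 * b" using ab(2) by (simp add: add_divide_distrib power2_eq_square)
  then show ?case using Suc by (simp add: a_def b_def add.commute)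
qed simp

lemma sum_inverse_le: "t \<ge> 1 \<Longrightarrow> (\<Sum>j<t. 1 / (real j + 1)) \<le> 1 + ln (real t)"
proof (induction t rule: dec_induct)
  case (step t)
  have "ln (real t / (real t + 1)) \<le> real t / (real t + 1) - 1" using step by (intro ln_le_minus_one) auto
  then have "1 / (real t + 1) \<le> ln (real t + 1) - ln (real t)"
    using step by (simp add: ln_div field_simps)
  then show ?case using step.IH by (simp add: add.commute)
qed simp

context wreath_walk
begin

text \<open>Growth of order \<open>t\<^bsup>\<gamma>\<^esup>\<close> of the bound on the expected number of visits turns a speed exponent of \<open>G\<close>
  into one of the wreath product; the cases \<open>\<gamma> = 1/2\<close> and \<open>\<gamma>\<close> arbitrarily small are needed.\<close>

lemma speed_exponent_wreathI:
  assumes c: "c > 0" and \<beta>: "0 \<le> \<beta>" "\<beta> \<le> 1"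
    and G_speed: "\<forall>n. c * real n powr \<beta> \<le>
       measure_pmf.expectation (walk G A n) (\<lambda>g. real (word_dist G A g \<one>\<^bsub>G\<^esub>))"
    and D: "D > 0" and \<gamma>: "0 \<le> \<gamma>" "\<gamma> \<le> 1"
    and green: "\<And>t. t \<ge> 1 \<Longrightarrow> 1 + 4 * (\<Sum>j<t. H.collision_prob S (j div 2)) \<le> D * real t powr \<gamma>"
  shows "speed_exponent W (1 + \<gamma> * (\<beta> - 1))"
proof -
  define c' where "c' = c / 4 * D powr (\<beta> - 1)"
  have c': "c' > 0" using c D by (simp add: c'_def)
  have "c' * real t powr (1 + \<gamma> * (\<beta> - 1))
     \<le> measure_pmf.expectation (walk W gens t) (\<lambda>p. real (word_dist W gens p \<one>\<^bsub>W\<^esub>))" for t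
  proof (cases "t = 0")
    case False
    then have t: "t \<ge> 1" by simp
    define K where "K = 1 + 4 * (\<Sum>j<t. H.collision_prob S (j div 2))"
    have K: "K \<ge> 1" unfolding K_def using H.collision_prob_pos [OF S] by (simp add: sum_nonneg less_imp_le)
    have "c' * real t powr (1 + \<gamma> * (\<beta> - 1)) = c / 4 * real t * (D * real t powr \<gamma>) powr (\<beta> - 1)"
      using t D by (simp add: c'_def powr_mult powr_powr powr_add)
    also have "\<dots> \<le> c / 4 * real t * K powr (\<beta> - 1)"
      using c K green [OF t] \<beta> by (intro mult_left_mono powr_mono2') (auto simp: K_def)
    also have "\<dots> \<le> measure_pmf.expectation (walk W gens t) (\<lambda>p. real (word_dist W gens p \<one>\<^bsub>W\<^esub>))"
      unfolding K_def by (rule speed_ge [OF c \<beta>]) (use G_speed in blast)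
    finally show ?thesis .
  qed simp
  moreover have "0 \<le> 1 + \<gamma> * (\<beta> - 1)"
  proof -
    have "\<gamma> * (1 - \<beta>) \<le> 1 * 1" using \<beta> \<gamma> by (intro mult_mono) auto
    then show ?thesis by (simp add: algebra_simps)
  qed
  ultimately show ?thesis
    unfolding speed_exponent_def using sym_gen_set_gens c' by blast
qed

lemma green_le_sqrt:
  assumes inf: "infinite (carrier H)"
  obtains D where "D > 0" "\<forall>t\<ge>1. 1 + 4 * (\<Sum>j<t. H.collision_prob S (j div 2)) \<le> D * real t powr (1/2)"
proof -
  obtain C where C: "C > 0" "\<forall>n. H.collision_prob S n ^ 2 * (real n + 1) \<le> C"
    "\<not> virtually_Z H \<longrightarrow> (\<forall>n. H.collision_prob S n * (real n + 1) \<le> C)"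
    using H.collision_prob_decay [OF S inf] .
  have "1 + 4 * (\<Sum>j<t. H.collision_prob S (j div 2)) \<le> (1 + 8 * sqrt (2 * C)) * real t powr (1/2)" if t: "t \<ge> 1" for t
  proof -
    have "H.collision_prob S (j div 2) \<le> sqrt (2 * C) * (1 / sqrt (real j + 1))" for j
    proof -
      let ?u = "H.collision_prob S (j div 2)"
      have "?u ^ 2 * (real j + 1) \<le> ?u ^ 2 * (2 * (real (j div 2) + 1))"
        by (intro mult_left_mono Suc_le_double_Suc_half) auto
      also have "\<dots> = 2 * (?u ^ 2 * (real (j div 2) + 1))" by simp
      also have "\<dots> \<le> 2 * C" using C(2) by (intro mult_left_mono) auto
      finally have "?u ^ 2 \<le> 2 * C / (real j + 1)" by (simp add: field_simps)
      then have "?u \<le> sqrt (2 * C / (real j + 1))" by (rule real_le_rsqrt)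
      then show ?thesis by (simp add: real_sqrt_divide)
    qed
    then have "(\<Sum>j<t. H.collision_prob S (j div 2)) \<le> (\<Sum>j<t. sqrt (2 * C) * (1 / sqrt (real j + 1)))"
      by (intro sum_mono)
    also have "\<dots> = sqrt (2 * C) * (\<Sum>j<t. 1 / sqrt (real j + 1))" by (simp only: sum_distrib_left)
    also have "\<dots> \<le> sqrt (2 * C) * (2 * sqrt (real t))" using C(1) by (intro mult_left_mono sum_inverse_sqrt_le) auto
    finally have "1 + 4 * (\<Sum>j<t. H.collision_prob S (j div 2)) \<le> 1 + 4 * (sqrt (2 * C) * (2 * sqrt (real t)))"
      by linarith
    also have "\<dots> \<le> sqrt (real t) + 4 * (sqrt (2 * C) * (2 * sqrt (real t)))" using t by simp
    also have "\<dots> = (1 + 8 * sqrt (2 * C)) * real t powr (1/2)"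
      by (simp only: powr_half_sqrt of_nat_0_le_iff) (simp only: algebra_simps)
    finally show ?thesis .
  qed
  moreover have "1 + 8 * sqrt (2 * C) > 0" using C(1) by (simp add: add_pos_nonneg)
  ultimately show thesis using that by blast
qed

lemma green_le_powr:
  assumes inf: "infinite (carrier H)" and not: "\<not> virtually_Z H" and \<epsilon>: "\<epsilon> > 0"
  obtains D where "D > 0" "\<forall>t\<ge>1. 1 + 4 * (\<Sum>j<t. H.collision_prob S (j div 2)) \<le> D * real t powr \<epsilon>"
proof -
  obtain C where C: "C > 0" "\<forall>n. H.collision_prob S n ^ 2 * (real n + 1) \<le> C"
    "\<not> virtually_Z H \<longrightarrow> (\<forall>n. H.collision_prob S n * (real n + 1) \<le> C)"
    using H.collision_prob_decay [OF S inf] .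
  have "1 + 4 * (\<Sum>j<t. H.collision_prob S (j div 2)) \<le> (1 + 8 * C * (1 + 1 / \<epsilon>)) * real t powr \<epsilon>" if t: "t \<ge> 1" for t
  proof -
    have "H.collision_prob S (j div 2) \<le> 2 * C * (1 / (real j + 1))" for j
    proof -
      let ?u = "H.collision_prob S (j div 2)"
      have "?u > 0" by (rule H.collision_prob_pos [OF S])
      then have "?u * (real j + 1) \<le> ?u * (2 * (real (j div 2) + 1))"
        by (intro mult_left_mono Suc_le_double_Suc_half) auto
      also have "\<dots> = 2 * (?u * (real (j div 2) + 1))" by simp
      also have "\<dots> \<le> 2 * C" using C(3) not by (intro mult_left_mono) auto
      finally show ?thesis by (simp add: field_simps)
    qed
    then have "(\<Sum>j<t. H.collision_prob S (j div 2)) \<le> (\<Sum>j<t. 2 * C * (1 / (real j + 1)))"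
      by (intro sum_mono)
    also have "\<dots> = 2 * C * (\<Sum>j<t. 1 / (real j + 1))" by (simp only: sum_distrib_left)
    also have "\<dots> \<le> 2 * C * (1 + ln (real t))" using C(1) t by (intro mult_left_mono sum_inverse_le) auto
    finally have "1 + 4 * (\<Sum>j<t. H.collision_prob S (j div 2)) \<le> 1 + 8 * C * (1 + ln (real t))"
      by linarith
    also have "\<dots> \<le> real t powr \<epsilon> + 8 * C * ((1 + 1 / \<epsilon>) * real t powr \<epsilon>)"
    proof -
      have one: "1 \<le> real t powr \<epsilon>" using t \<epsilon> by (simp add: ge_one_powr_ge_zero)
      have "ln (real t powr \<epsilon>) \<le> real t powr \<epsilon> - 1" using t by (intro ln_le_minus_one) auto
      then have "\<epsilon> * ln (real t) \<le> real t powr \<epsilon>" using t by (simp add: ln_powr)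
      then have "ln (real t) \<le> 1 / \<epsilon> * real t powr \<epsilon>" using \<epsilon> by (simp add: field_simps)
      then have "1 + ln (real t) \<le> (1 + 1 / \<epsilon>) * real t powr \<epsilon>" using one by (simp add: algebra_simps)
      then have "8 * C * (1 + ln (real t)) \<le> 8 * C * ((1 + 1 / \<epsilon>) * real t powr \<epsilon>)"
        using C(1) by (intro mult_left_mono) auto
      then show ?thesis using one by linarith
    qed
    finally show ?thesis by (simp add: algebra_simps)
  qed
  moreover have "1 + 8 * C * (1 + 1 / \<epsilon>) > 0" using C(1) \<epsilon> by (simp add: add_pos_pos)
  ultimately show thesis using that by blast
qed

end

theorem theorem6p1:
  fixes G :: "('a, 'm) monoid_scheme" and H :: "('b, 'n) monoid_scheme"
  assumes "group G" and "infinite (carrier G)" and "finitely_generated G"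
    and "group H" and "infinite (carrier H)" and "finitely_generated H"
  shows "(linear_growth H \<longleftrightarrow> virtually_Z H) \<and>
         (linear_growth H \<longrightarrow> beta_star (wreath G H) \<ge> (1 + beta_star G) / 2) \<and>
         (\<not> linear_growth H \<longrightarrow> beta_star (wreath G H) = 1)"
proof -
  interpret G: group G by fact
  interpret H: group H by fact
  interpret W: group "wreath G H" by (rule wreath_group) fact+
  have lin: "linear_growth H \<longleftrightarrow> virtually_Z H"
    using assms by (intro H.linear_growth_iff_virtually_Z)
  obtain S where S: "sym_gen_set H S" "\<one>\<^bsub>H\<^esub> \<notin> S"
    using H.sym_gen_set_without_one [OF assms(6,5)] .
  have speed0: "speed_exponent G 0" by (rule G.speed_exponent_0 [OF assms(3,2)])
  have le_beta: "\<beta> \<le> beta_star (wreath G H)" if "speed_exponent (wreath G H) \<beta>" for \<beta>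
    unfolding beta_star_def using that by (intro cSup_upper W.bdd_above_speed_exponents) simp
  have "(1 + \<beta>) / 2 \<le> beta_star (wreath G H)" if sp: "speed_exponent G \<beta>" for \<beta>
  proof -
    have b: "0 \<le> \<beta>" "\<beta> \<le> 1" using sp G.speed_exponent_le_1 by (auto simp: speed_exponent_def)
    obtain A c where A: "sym_gen_set G A" "\<one>\<^bsub>G\<^esub> \<in> A" and c: "c > 0"
      and speed: "\<forall>t::nat. c * real t powr \<beta> \<le> measure_pmf.expectation (walk G A t) (\<lambda>x. real (word_dist G A x \<one>\<^bsub>G\<^esub>))"
      using G.speed_exponent_with_one [OF sp] .
    interpret wreath_walk G H A S by standard (fact A S)+
    obtain D where D: "D > 0" "\<forall>t\<ge>1. 1 + 4 * (\<Sum>j<t. H.collision_prob S (j div 2)) \<le> D * real t powr (1/2)"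
      using green_le_sqrt [OF assms(5)] .
    have "speed_exponent (wreath G H) (1 + 1 / 2 * (\<beta> - 1))"
      by (rule speed_exponent_wreathI [OF c b speed D(1)]) (use D(2) in auto)
    then have "1 + 1 / 2 * (\<beta> - 1) \<le> beta_star (wreath G H)" by (rule le_beta)
    then show ?thesis by (simp add: field_simps)
  qed
  then have "\<beta> \<le> 2 * beta_star (wreath G H) - 1" if "speed_exponent G \<beta>" for \<beta>
    using that by fastforce
  then have "beta_star G \<le> 2 * beta_star (wreath G H) - 1"
    unfolding beta_star_def [of G] using speed0 by (intro cSup_least) auto
  then have part1: "beta_star (wreath G H) \<ge> (1 + beta_star G) / 2" by simp
  have part2: "beta_star (wreath G H) = 1" if not: "\<not> linear_growth H"
  proof (rule antisym)
    obtain A c where A: "sym_gen_set G A" "\<one>\<^bsub>G\<^esub> \<in> A" and c: "c > 0"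
      and speed: "\<forall>t::nat. c * real t powr 0 \<le> measure_pmf.expectation (walk G A t) (\<lambda>x. real (word_dist G A x \<one>\<^bsub>G\<^esub>))"
      using G.speed_exponent_with_one [OF speed0] .
    interpret wreath_walk G H A S by standard (fact A S)+
    have exp: "speed_exponent (wreath G H) (1 - \<epsilon>)" if \<epsilon>: "0 < \<epsilon>" "\<epsilon> \<le> 1" for \<epsilon>
    proof -
      obtain D where D: "D > 0" "\<forall>t\<ge>1. 1 + 4 * (\<Sum>j<t. H.collision_prob S (j div 2)) \<le> D * real t powr \<epsilon>"
        using green_le_powr [OF assms(5) _ \<epsilon>(1)] not lin by blast
      have "speed_exponent (wreath G H) (1 + \<epsilon> * (0 - 1))"
        by (rule speed_exponent_wreathI [OF c _ _ speed D(1)]) (use D(2) \<epsilon> in auto)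
      then show ?thesis by simp
    qed
    show "beta_star (wreath G H) \<le> 1"
      unfolding beta_star_def using exp [of 1] W.speed_exponent_le_1 by (intro cSup_least) auto
    show "1 \<le> beta_star (wreath G H)"
    proof (rule ccontr)
      assume "\<not> ?thesis"
      then have less: "beta_star (wreath G H) < 1" by simp
      have "0 \<le> beta_star (wreath G H)" using le_beta [OF exp [of 1]] by simp
      define \<epsilon> where "\<epsilon> = (1 - beta_star (wreath G H)) / 2"
      have "1 - \<epsilon> \<le> beta_star (wreath G H)"
        by (intro le_beta exp) (use less \<open>0 \<le> beta_star (wreath G H)\<close> in \<open>auto simp: \<epsilon>_def\<close>)
      then show False using less by (simp add: \<epsilon>_def field_simps)
    qed
  qed
  show ?thesis using lin part1 part2 by blast
qed

end
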